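(* Let $d\geq 2$ be an integer. Then there exists a Delone set $Y\subset\mathbb{R}^d$ such that (a) there is no bijection $f:Y\to\mathbb{Z}^d$ that is Lipschitz and co-homogeneous, and (b) there is no bijection $f:Y\to\mathbb{Z}^d$ that is co-Lipschitz and homogeneous.
   Context: $\|\cdot\|$ is the Euclidean norm and $B(0,R)$ is the open Euclidean ball of radius $R$ centred at $0$. A set $Y\subset\mathbb{R}^d$ is a Delone set if there is $s>0$ such that every closed ball of radius $s$ in $\mathbb{R}^d$ contains at most one point of $Y$, and there is $S>0$ such that every closed ball of radius $S$ in $\mathbb{R}^d$ contains at least one point of $Y$. Let $K,X\subseteq\mathbb{R}^d$ and $f:K\to X$. For a non-decreasing function $\omega:[0,2)\to[0,\infty)$ with $\omega(0)=0$ (no continuity is required), $f$ is $\omega$-homogeneous if there is $c>0$ such that for each $R>0$, $\|f(x)-f(y)\|\le cR\,\omega\left(\frac{\|x-y\|}{R}\right)$ whenever $x,y\in B(0,R)\cap K$. $f$ is homogeneous if it is $\omega$-homogeneous for some such $\omega$. A bijection $f$ is co-homogeneous if $f^{-1}$ is homogeneous, and co-Lipschitz if $f^{-1}$ is Lipschitz. *)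

theory Defs
  imports "HOL-Analysis.Analysis"
begin

definition delone :: "'a::euclidean_space set \<Rightarrow> bool" where
  "delone Y \<longleftrightarrow>
     (\<exists>s>0. \<forall>z. \<exists>\<^sub>\<le>\<^sub>1 y. y \<in> Y \<inter> cball z s) \<and>
     (\<exists>S>0. \<forall>z. \<exists>y. y \<in> Y \<inter> cball z S)"

text \<open>A modulus is a map from the half-open interval \<open>[0,2)\<close> to \<open>[0,\<infinity>)\<close>; it is represented by a
  total function on the reals whose values outside \<open>[0,2)\<close> are irrelevant. No continuity at \<open>0\<close>
  is required. For \<open>x\<close>, \<open>y\<close> in the open ball of radius \<open>R\<close> the argument \<open>norm (x - y) / R\<close> below
  is always in \<open>[0,2)\<close>.\<close>

definition modulus :: "(real \<Rightarrow> real) \<Rightarrow> bool" where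
  "modulus \<omega> \<longleftrightarrow> \<omega> \<in> {0..<2} \<rightarrow> {0..} \<and> mono_on {0..<2} \<omega> \<and> \<omega> 0 = 0"

definition omega_homogeneous_on ::
    "(real \<Rightarrow> real) \<Rightarrow> 'a::euclidean_space set \<Rightarrow> ('a \<Rightarrow> 'b::euclidean_space) \<Rightarrow> bool" where
  "omega_homogeneous_on \<omega> K f \<longleftrightarrow>
     (\<exists>c>0. \<forall>R>0. \<forall>x \<in> ball 0 R \<inter> K. \<forall>y \<in> ball 0 R \<inter> K.
        norm (f x - f y) \<le> c * R * \<omega> (norm (x - y) / R))"

definition homogeneous_on :: "'a::euclidean_space set \<Rightarrow> ('a \<Rightarrow> 'b::euclidean_space) \<Rightarrow> bool" where
  "homogeneous_on K f \<longleftrightarrow> (\<exists>\<omega>. modulus \<omega> \<and> omega_homogeneous_on \<omega> K f)"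

definition Lipschitz_map_on :: "'a::euclidean_space set \<Rightarrow> ('a \<Rightarrow> 'b::euclidean_space) \<Rightarrow> bool" where
  "Lipschitz_map_on K f \<longleftrightarrow> (\<exists>L. L-lipschitz_on K f)"

text \<open>The next two notions are meant for \<open>f\<close> with \<open>bij_betw f K X\<close>; then \<open>inv_into K f\<close> is the
  inverse bijection from \<open>X = f ` K\<close> to \<open>K\<close>.\<close>

definition co_homogeneous_on :: "'a::euclidean_space set \<Rightarrow> ('a \<Rightarrow> 'b::euclidean_space) \<Rightarrow> bool" where
  "co_homogeneous_on K f \<longleftrightarrow> homogeneous_on (f ` K) (inv_into K f)"

definition co_Lipschitz_on :: "'a::euclidean_space set \<Rightarrow> ('a \<Rightarrow> 'b::euclidean_space) \<Rightarrow> bool" where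
  "co_Lipschitz_on K f \<longleftrightarrow> Lipschitz_map_on (f ` K) (inv_into K f)"

definition integer_lattice :: "(real ^ 'n) set" where
  "integer_lattice = {x. \<forall>i. x $ i \<in> \<int>}"

end

theory Submission
  imports Defs "HOL-Complex_Analysis.Great_Picard"
begin

text \<open>Since moduli may jump at \<open>0\<close>, a homogeneous map is one of linear growth. Both statements therefore
  concern a Lipschitz bijection \<open>h\<close>, in one direction or the other, between \<open>\<int>\<^sup>d\<close> and
  \<open>Y = \<int>\<^sup>d \<union> (\<Lambda> + e/2)\<close> whose inverse has linear growth. Rescaling \<open>h\<close> along the scales \<open>R\<^sub>k\<close> at which
  \<open>\<Lambda>\<close> imitates a fixed set \<open>S\<close> yields a Lipschitz map \<open>H\<close> that transports the density \<open>1 + 1\<^sub>S\<close> to the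
  density \<open>1\<close> or conversely.

  Preimages under such an \<open>H\<close> of balls have comparable volume. By blow-ups \<open>H\<close> is nearly linear on some
  ball in every open set, and Brouwer's theorem then shows that a maximal family of disjoint compact sets
  stably covering a common ball splits \<open>H\<close> over that ball into finitely many bilipschitz sheets.

  The set \<open>S\<close> is built in levels, by alternately adding and removing sparse arrays of tiny cubes. Where the
  sheets have almost the greatest possible stretch in direction \<open>e\<close>, all of them are nearly translations
  along \<open>e\<close> in most places of a fine level (the Burago--Kleiner argument, with all sheets treated
  simultaneously). Moving a cube of the array along \<open>e\<close> then changes the mass on the base sheet without
  changing the volumes of its images, which contradicts the balance of masses.\<close>

section \<open>Blow-ups of Lipschitz maps\<close>

text \<open>The obstacle is that \<open>H\<close> may fold space: linear growth of an inverse says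
  nothing about nearby points. The mass identity has to replace the lower Lipschitz bound, by
  limiting how many separated points crowd over one ball. With several sheets, mass gained by an
  array on one of them could be compensated by the array, or by older parts of \<open>S\<close>, on
  another. This shapes the arrays. All periods are at least the length of a window, so that on every
  sheet a window meets a volume of the array bounded in units of one cube. Along \<open>e\<close>
  the period is exactly that length, so that windows tile whole lines and averaged slope estimates
  reach most of them. The sparseness that makes later levels negligible is obtained across
  \<open>e\<close>, where dimension at least two enters. Adding and removing alternate because a
  window has to start outside the current set, while \<open>S\<close> may fill most of the region at
  hand; then the complement takes its place. One \<open>Y\<close> serves both directions, since the
  balance of masses carries signs and an index set of weighted sheets, and so allows
  \<open>S\<close> on either side of \<open>H\<close>.\<close>

lemma asymptotically_lipschitz_subsequence:
  fixes f :: "nat \<Rightarrow> 'a::euclidean_space \<Rightarrow> 'b::euclidean_space"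
  assumes "L \<ge> 0" and lip: "\<And>n x y. norm (f n x - f n y) \<le> L * norm (x - y) + \<epsilon> n"
    and eps: "\<epsilon> \<longlonglongrightarrow> 0" and bdd: "\<And>n. norm (f n 0) \<le> B"
  obtains r g where "strict_mono (r :: nat \<Rightarrow> nat)" "\<And>x. (\<lambda>n. f (r n) x) \<longlonglongrightarrow> g x"
    "\<And>x y. norm (g x - g y) \<le> L * norm (x - y)"
proof -
  obtain E where E: "\<And>n. norm (\<epsilon> n) \<le> E"
    using eps convergent_imp_Bseq[of \<epsilon>] unfolding Bseq_def convergent_def by auto
  have E0: "E \<ge> 0" using E[of 0] norm_ge_zero[of "\<epsilon> 0"] by linarith
  have B0: "B \<ge> 0" using bdd[of 0] norm_ge_zero[of "f 0 0"] by linarith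
  \<comment> \<open>Countably many points suffice for a diagonal subsequence: \<open>lip\<close>
    transports convergence from a dense set to every point, up to an error that vanishes.\<close>
  obtain D :: "'a set" where D: "countable D" "closure D = UNIV"
    using separable[of UNIV] by (metis top.extremum_unique)
  \<comment> \<open>The maps are bounded only pointwise; dividing by \<open>w x\<close>, a bound for
    all \<open>f n x\<close>, gives the uniform bound required by the diagonal argument.\<close>
  define w where "w = (\<lambda>x::'a. L * norm x + E + B + 1)"
  have w: "w x > 0" for x unfolding w_def using \<open>L \<ge> 0\<close> E0 B0 by (simp add: add_nonneg_pos)
  have fw: "norm (f n x) \<le> w x" for n x
  proof -
    have "norm (f n x) \<le> norm (f n x - f n 0) + norm (f n 0)"
      by (metis diff_add_cancel norm_triangle_ineq)
    then show ?thesis unfolding w_def using lip[of n x 0] bdd[of n] E[of n] by auto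
  qed
  have "norm (f n x /\<^sub>R w x) \<le> 1" for n x
    using fw[of n x] w[of x] by (simp add: field_simps)
  then obtain r where r: "strict_mono (r :: nat \<Rightarrow> nat)"
      "\<And>x. x \<in> D \<Longrightarrow> \<exists>l. (\<lambda>n. f (r n) x /\<^sub>R w x) \<longlonglongrightarrow> l"
    using function_convergent_subsequence[OF D(1), of "\<lambda>n x. f n x /\<^sub>R w x" 1] by metis
  have convD: "convergent (\<lambda>n. f (r n) x)" if x: "x \<in> D" for x
  proof -
    obtain l where "(\<lambda>n. f (r n) x /\<^sub>R w x) \<longlonglongrightarrow> l" using r(2)[OF x] by auto
    then have "(\<lambda>n. w x *\<^sub>R (f (r n) x /\<^sub>R w x)) \<longlonglongrightarrow> w x *\<^sub>R l"
      by (intro tendsto_intros)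
    moreover have "w x *\<^sub>R (f (r n) x /\<^sub>R w x) = f (r n) x" for n
      using w[of x] by (metis less_numeral_extra(3) scaleR_cancel_left divideR_right)
    ultimately show ?thesis unfolding convergent_def by auto
  qed
  \<comment> \<open>The additive error admits discontinuous maps, such as a lattice map precomposed
    with rounding; it disappears in the limit.\<close>
  have epsr: "(\<lambda>n. \<epsilon> (r n)) \<longlonglongrightarrow> 0"
    using LIMSEQ_subseq_LIMSEQ[OF eps r(1)] by (simp add: o_def)
  have conv: "convergent (\<lambda>n. f (r n) x)" for x
  proof -
    have "Cauchy (\<lambda>n. f (r n) x)"
    proof (rule metric_CauchyI)
      fix e :: real assume e: "e > 0"
      obtain y where y: "y \<in> D" "dist y x < e / (8 * (L + 1))"
        using D(2) e \<open>L \<ge> 0\<close> by (metis UNIV_I closure_approachable divide_pos_pos mult_pos_pos zero_less_numeral add_nonneg_pos zero_less_one)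
      have "L * norm (x - y) \<le> (L + 1) * (e / (8 * (L + 1)))"
        using y(2) \<open>L \<ge> 0\<close> by (intro mult_mono) (auto simp: dist_norm norm_minus_commute)
      also have "\<dots> = e / 8" using \<open>L \<ge> 0\<close> by (simp add: field_simps)
      finally have Ly: "L * norm (x - y) \<le> e / 8" .
      obtain N1 where N1: "\<And>n. n \<ge> N1 \<Longrightarrow> norm (\<epsilon> (r n)) < e / 8"
        using epsr e by (metis LIMSEQ_D diff_zero divide_pos_pos zero_less_numeral)
      obtain N2 where N2: "\<And>m n. m \<ge> N2 \<Longrightarrow> n \<ge> N2 \<Longrightarrow> dist (f (r m) y) (f (r n) y) < e / 4"
        using convD[OF y(1)] e unfolding Cauchy_convergent_iff[symmetric]
        by (metis metric_CauchyD divide_pos_pos zero_less_numeral)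
      show "\<exists>M. \<forall>m\<ge>M. \<forall>n\<ge>M. dist (f (r m) x) (f (r n) x) < e"
      proof (intro exI[of _ "max N1 N2"] allI impI)
        fix m n assume mn: "max N1 N2 \<le> m" "max N1 N2 \<le> n"
        have a: "dist (f (r m) x) (f (r m) y) \<le> e / 4" "dist (f (r n) y) (f (r n) x) \<le> e / 4"
          using lip[of "r m" x y] lip[of "r n" x y] Ly N1[of m] N1[of n] mn by (auto simp: dist_norm norm_minus_commute)
        show "dist (f (r m) x) (f (r n) x) < e"
          using a N2[of m n] mn e dist_triangle[of "f (r m) x" "f (r n) x" "f (r m) y"]
            dist_triangle[of "f (r m) y" "f (r n) x" "f (r n) y"] by auto
      qed
    qed
    then show ?thesis by (simp add: Cauchy_convergent_iff)
  qed
  define g where "g x = lim (\<lambda>n. f (r n) x)" for x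
  have lim: "(\<lambda>n. f (r n) x) \<longlonglongrightarrow> g x" for x
    using conv[of x] unfolding g_def by (simp add: convergent_LIMSEQ_iff)
  have "norm (g x - g y) \<le> L * norm (x - y)" for x y
  proof (rule LIMSEQ_le)
    show "(\<lambda>n. norm (f (r n) x - f (r n) y)) \<longlonglongrightarrow> norm (g x - g y)" by (intro tendsto_intros lim)
    show "(\<lambda>n. L * norm (x - y) + \<epsilon> (r n)) \<longlonglongrightarrow> L * norm (x - y)"
      using tendsto_add[OF tendsto_const epsr] by simp
  qed (use lip in auto)
  then show thesis using that r(1) lim by blast
qed

text \<open>The common Lipschitz constant and the normalisation at the origin give every sequence a
  pointwise convergent subsequence. Invariance under all rescalings makes an extremal element
  informative: its behaviour at every place and scale is again that of an element. A linear element
  of such a class takes the place of a derivative.\<close>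

definition blowup_closed :: "real \<Rightarrow> ('a::euclidean_space \<Rightarrow> 'a) set \<Rightarrow> bool" where
  "blowup_closed L \<G> \<longleftrightarrow> L \<ge> 0 \<and>
     (\<forall>G\<in>\<G>. G 0 = 0 \<and> (\<forall>x y. norm (G x - G y) \<le> L * norm (x - y))) \<and>
     (\<forall>G\<in>\<G>. \<forall>p. \<forall>l>0. (\<lambda>x. (G (p + l *\<^sub>R x) - G p) /\<^sub>R l) \<in> \<G>) \<and>
     (\<forall>g G. (\<forall>n. g n \<in> \<G>) \<longrightarrow> (\<forall>x. (\<lambda>n. g n x) \<longlonglongrightarrow> G x) \<longrightarrow> G \<in> \<G>)"

lemma blowup_closed_subsequence:
  assumes "blowup_closed L \<G>" "\<And>n::nat. g n \<in> \<G>"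
  obtains r G where "strict_mono (r :: nat \<Rightarrow> nat)" "\<And>x. (\<lambda>n. g (r n) x) \<longlonglongrightarrow> G x" "G \<in> \<G>"
proof -
  obtain r G where "strict_mono (r :: nat \<Rightarrow> nat)" "\<And>x. (\<lambda>n. g (r n) x) \<longlonglongrightarrow> G x"
  proof (rule asymptotically_lipschitz_subsequence[of L g "\<lambda>_. 0" 0])
    show "L \<ge> 0" using assms(1) unfolding blowup_closed_def by auto
    show "norm (g n x - g n y) \<le> L * norm (x - y) + 0" for n x y
      using assms unfolding blowup_closed_def by simp
    show "norm (g n 0) \<le> 0" for n using assms unfolding blowup_closed_def by simp
  qed (auto intro: that)
  then show thesis using that assms unfolding blowup_closed_def by metis
qed

text \<open>Strict convexity of the Euclidean norm. With \<open>b = w - a\<close>, the square of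
  \<open>norm (a - t *\<^sub>R w)\<close> equals (1-t)|a|^2 + t|b|^2 - t(1-t)|w|^2, and the two
  upper bounds make this at most 0.\<close>

lemma near_extremal_affine:
  fixes a w :: "'a::real_inner"
  assumes "norm a \<le> c * t" "norm (w - a) \<le> c * (1 - t)" "norm w = c" "0 \<le> t" "t \<le> 1"
  shows "a = t *\<^sub>R w"
proof -
  have c: "c \<ge> 0" using assms(3) by auto
  define b where "b = w - a"
  have a2: "a \<bullet> a \<le> (c * t)\<^sup>2" using power_mono[OF assms(1), of 2] by (simp add: power2_norm_eq_inner)
  have b2: "b \<bullet> b \<le> (c * (1-t))\<^sup>2" using power_mono[OF assms(2), of 2] by (simp add: power2_norm_eq_inner b_def)
  have w: "w = a + b" by (simp add: b_def)
  have ab: "a \<bullet> a + 2 * (a \<bullet> b) + b \<bullet> b = c\<^sup>2"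
    using assms(3) unfolding w by (auto simp: power2_norm_eq_inner inner_simps inner_commute algebra_simps)
  have "(norm (a - t *\<^sub>R w))\<^sup>2 = (1-t)\<^sup>2 * (a \<bullet> a) - 2 * t * (1 - t) * (a \<bullet> b) + t\<^sup>2 * (b \<bullet> b)"
    unfolding power2_norm_eq_inner w by (simp add: inner_simps inner_commute algebra_simps power2_eq_square)
  also have "\<dots> = (1-t) * (a \<bullet> a) + t * (b \<bullet> b) - t * (1 - t) * c\<^sup>2"
    unfolding ab[symmetric] by (simp add: algebra_simps power2_eq_square)
  also have "\<dots> \<le> (1-t) * (c * t)\<^sup>2 + t * (c * (1-t))\<^sup>2 - t * (1 - t) * c\<^sup>2"
    using a2 b2 assms by (intro diff_mono add_mono mult_left_mono) auto
  also have "\<dots> = 0" by (simp add: algebra_simps power2_eq_square)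
  finally show ?thesis by simp
qed

text \<open>A map of maximal stretch \<open>\<parallel>G e\<parallel>\<close> is affine on the segment from \<open>0\<close> to \<open>e\<close>. Blowing up at the midpoint
  makes it affine on a line, and translating along this line to infinity makes it affine along all parallel
  lines, because the increments on a parallel line approach the maximal one.\<close>

lemma blowup_closed_affine_direction:
  fixes e :: "'a::euclidean_space"
  assumes bc: "blowup_closed L \<G>" and ne: "\<G> \<noteq> {}"
  obtains G where "G \<in> \<G>" "\<And>x t. G (x + t *\<^sub>R e) = G x + t *\<^sub>R G e"
proof -
  have L: "L \<ge> 0" and z: "\<And>G. G \<in> \<G> \<Longrightarrow> G 0 = 0"
    and lip: "\<And>G x y. G \<in> \<G> \<Longrightarrow> norm (G x - G y) \<le> L * norm (x - y)"
    and resc: "\<And>G p l. G \<in> \<G> \<Longrightarrow> l > 0 \<Longrightarrow> (\<lambda>x. (G (p + l *\<^sub>R x) - G p) /\<^sub>R l) \<in> \<G>"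
    using bc unfolding blowup_closed_def by auto
  define lam where "lam = (SUP G\<in>\<G>. norm (G e))"
  have bdd: "bdd_above ((\<lambda>G. norm (G e)) ` \<G>)"
    by (intro bdd_aboveI[of _ "L * norm e"]) (use lip[of _ e 0] z in force)
  have le: "norm (G e) \<le> lam" if "G \<in> \<G>" for G unfolding lam_def by (rule cSUP_upper[OF that bdd])
  have "\<exists>G\<in>\<G>. norm (G e) > lam - 1 / Suc n" for n
  proof -
    have "lam - 1 / Suc n < lam" by simp
    then show ?thesis unfolding lam_def by (subst (asm) less_cSUP_iff[OF ne bdd]) 
  qed
  then obtain g where g: "\<And>n. g n \<in> \<G>" "\<And>n. norm (g n e) > lam - 1 / Suc n" by metis
  obtain r G0 where G0: "strict_mono (r :: nat \<Rightarrow> nat)" "\<And>x. (\<lambda>n. g (r n) x) \<longlonglongrightarrow> G0 x" "G0 \<in> \<G>"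
    using blowup_closed_subsequence[of L \<G> g] bc g(1) by metis
  have "norm (G0 e) \<ge> lam"
  proof (rule LIMSEQ_le)
    show "(\<lambda>n. norm (g (r n) e)) \<longlonglongrightarrow> norm (G0 e)" by (intro tendsto_intros G0)
    have "(\<lambda>n. lam - 1 / Suc n) \<longlonglongrightarrow> lam - 0" by (intro tendsto_intros LIMSEQ_Suc lim_1_over_n)
    then show "((\<lambda>n. lam - 1 / Suc n) \<circ> r) \<longlonglongrightarrow> lam" using LIMSEQ_subseq_LIMSEQ G0(1) by force
  qed (use g(2) less_imp_le in auto)
  then have G0e: "norm (G0 e) = lam" using le[OF G0(3)] by simp
  have lam0: "lam \<ge> 0" using G0e by auto
  define w where "w = G0 e"
  have wn: "norm w = lam" using G0e by (simp add: w_def)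
  \<comment> \<open>Rescaling by \<open>t\<close> turns an increment of length \<open>t\<close> into
    the value at \<open>e\<close> of another element, so the supremum bounds increments
    everywhere.\<close>
  have step: "norm (G (x + t *\<^sub>R e) - G x) \<le> lam * t" if "G \<in> \<G>" "t \<ge> 0" for G x t
  proof (cases "t = 0")
    case False
    then have t: "t > 0" using that by auto
    have "norm ((G (x + t *\<^sub>R e) - G x) /\<^sub>R t) \<le> lam" using le[OF resc[OF that(1) t]] by simp
    then show ?thesis using t by (simp add: inverse_eq_divide pos_divide_le_eq)
  qed simp
  have seg: "G0 (t *\<^sub>R e) = t *\<^sub>R w" if t: "0 \<le> t" "t \<le> 1" for t
  proof (rule near_extremal_affine)
    show "norm (G0 (t *\<^sub>R e)) \<le> lam * t" using step[OF G0(3) t(1), of 0] z[OF G0(3)] by simp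
    show "norm (w - G0 (t *\<^sub>R e)) \<le> lam * (1 - t)"
      using step[OF G0(3), of "1 - t" "t *\<^sub>R e"] t by (simp add: w_def flip: scaleR_left_distrib)
  qed (use t G0e w_def in auto)
  define h where "h n x = (G0 ((1/2) *\<^sub>R e + (1 / Suc n) *\<^sub>R x) - G0 ((1/2) *\<^sub>R e)) /\<^sub>R (1 / Suc n)" for n :: nat and x
  have "h n \<in> \<G>" for n unfolding h_def using resc[OF G0(3), of "1 / Suc n" "(1/2) *\<^sub>R e"] by simp
  then obtain r1 G1 where G1: "strict_mono (r1 :: nat \<Rightarrow> nat)" "\<And>x. (\<lambda>n. h (r1 n) x) \<longlonglongrightarrow> G1 x" "G1 \<in> \<G>"
    using blowup_closed_subsequence[of L \<G> h] bc by metis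
  have line: "G1 (t *\<^sub>R e) = t *\<^sub>R w" for t
  proof -
    have hn: "h n (t *\<^sub>R e) = t *\<^sub>R w" if n: "n \<ge> nat \<lceil>2 * \<bar>t\<bar>\<rceil>" for n
    proof -
      have n': "2 * \<bar>t\<bar> \<le> Suc n" using n by linarith
      then have b: "\<bar>t / Suc n\<bar> \<le> 1/2" by (simp add: field_simps abs_divide)
      have e1: "(1/2) *\<^sub>R e + (1 / Suc n) *\<^sub>R t *\<^sub>R e = (1/2 + t / Suc n) *\<^sub>R e"
        by (simp add: scaleR_left_distrib)
      have "h n (t *\<^sub>R e) = ((1/2 + t / Suc n) *\<^sub>R w - (1/2) *\<^sub>R w) /\<^sub>R (1 / Suc n)"
      proof -
        have "0 \<le> 1/2 + t / Suc n" "1/2 + t / Suc n \<le> 1" using b by linarith+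
        then show ?thesis unfolding h_def e1 using seg[of "1/2 + t / Suc n"] seg[of "1/2"] by auto
      qed
      also have "\<dots> = t *\<^sub>R w" by (simp add: scaleR_left_distrib del: of_nat_Suc)
      finally show ?thesis .
    qed
    have "\<forall>\<^sub>F n in sequentially. h (r1 n) (t *\<^sub>R e) = t *\<^sub>R w"
      using eventually_ge_at_top[of "nat \<lceil>2 * \<bar>t\<bar>\<rceil>"]
      by eventually_elim (use hn seq_suble[OF G1(1)] le_trans in blast)
    then have "(\<lambda>n. h (r1 n) (t *\<^sub>R e)) \<longlonglongrightarrow> t *\<^sub>R w" by (rule tendsto_eventually)
    then show ?thesis using LIMSEQ_unique G1(2)[of "t *\<^sub>R e"] by metis
  qed
  define k where "k n x = G1 (real n *\<^sub>R e + x) - G1 (real n *\<^sub>R e)" for n x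
  have "k n \<in> \<G>" for n unfolding k_def using resc[OF G1(3), of 1 "real n *\<^sub>R e"] by simp
  then obtain r2 G2 where G2: "strict_mono (r2 :: nat \<Rightarrow> nat)" "\<And>x. (\<lambda>n. k (r2 n) x) \<longlonglongrightarrow> G2 x" "G2 \<in> \<G>"
    using blowup_closed_subsequence[of L \<G> k] bc by metis
  have pos: "G2 (x + t *\<^sub>R e) - G2 x = t *\<^sub>R w" if t: "t \<ge> 0" for x t
  proof -
    \<comment> \<open>The growth along the parallel line in direction \<open>w\<close>, minus the
      maximal growth. It decreases because no increment exceeds the maximum, and it is bounded below
      because the image of the parallel line keeps bounded distance from that of the base line,
      where the maximum is attained. So its increments tend to 0 at infinity.\<close>
    define f where "f s = G1 (x + s *\<^sub>R e) \<bullet> w - lam\<^sup>2 * s" for s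
    have mono: "f b \<le> f a" if "a \<le> b" for a b
    proof -
      have "(G1 (x + b *\<^sub>R e) - G1 (x + a *\<^sub>R e)) \<bullet> w \<le> norm (G1 (x + b *\<^sub>R e) - G1 (x + a *\<^sub>R e)) * norm w"
        by (rule norm_cauchy_schwarz)
      also have "\<dots> \<le> (lam * (b - a)) * lam"
        using step[OF G1(3), of "b - a" "x + a *\<^sub>R e"] that lam0 wn
        by (intro mult_mono) (auto simp: algebra_simps intro: mult_right_mono)
      finally show ?thesis unfolding f_def by (simp add: inner_simps algebra_simps power2_eq_square)
    qed
    have low: "f a \<ge> - (L * norm x * lam)" for a
    proof -
      have "\<bar>(G1 (x + a *\<^sub>R e) - G1 (a *\<^sub>R e)) \<bullet> w\<bar> \<le> norm (G1 (x + a *\<^sub>R e) - G1 (a *\<^sub>R e)) * norm w"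
        by (rule Cauchy_Schwarz_ineq2)
      also have "\<dots> \<le> (L * norm x) * lam"
        using lip[OF G1(3), of "x + a *\<^sub>R e" "a *\<^sub>R e"] wn L
        by (intro mult_mono) auto
      finally have "\<bar>(G1 (x + a *\<^sub>R e) - G1 (a *\<^sub>R e)) \<bullet> w\<bar> \<le> L * norm x * lam" .
      moreover have "w \<bullet> w = lam\<^sup>2" using G0e w_def by (metis power2_norm_eq_inner)
      ultimately show ?thesis unfolding f_def line by (simp add: inner_simps algebra_simps)
    qed
    define \<phi> where "\<phi> n = f (real n)" for n
    have "decseq \<phi>" unfolding decseq_def \<phi>_def using mono by auto
    then obtain l where l: "\<phi> \<longlonglongrightarrow> l" using decseq_convergent[of \<phi>] low unfolding \<phi>_def by metis
    obtain c :: nat where c: "t \<le> real c" using real_arch_simple by blast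
    have lt: "(\<lambda>n. f (real n + t)) \<longlonglongrightarrow> l"
    proof (rule tendsto_sandwich)
      show "(\<lambda>n. \<phi> (n + c)) \<longlonglongrightarrow> l" using l by (rule LIMSEQ_ignore_initial_segment)
      show "\<phi> \<longlonglongrightarrow> l" by (rule l)
    qed (use mono t c \<phi>_def in auto)
    have "(\<lambda>n. f (real n + t) - \<phi> n) \<longlonglongrightarrow> l - l" by (intro tendsto_diff lt l)
    then have "(\<lambda>n. f (real (r2 n) + t) - \<phi> (r2 n)) \<longlonglongrightarrow> 0"
      using LIMSEQ_subseq_LIMSEQ[OF _ G2(1)] by (fastforce simp: o_def)
    moreover have "f (real (r2 n) + t) - \<phi> (r2 n) = (k (r2 n) (x + t *\<^sub>R e) - k (r2 n) x) \<bullet> w - lam\<^sup>2 * t" for n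
      unfolding f_def \<phi>_def k_def by (simp add: inner_simps algebra_simps)
    moreover have "(\<lambda>n. (k (r2 n) (x + t *\<^sub>R e) - k (r2 n) x) \<bullet> w - lam\<^sup>2 * t)
        \<longlonglongrightarrow> (G2 (x + t *\<^sub>R e) - G2 x) \<bullet> w - lam\<^sup>2 * t"
      by (intro tendsto_intros G2(2))
    ultimately have ip: "(G2 (x + t *\<^sub>R e) - G2 x) \<bullet> w = lam\<^sup>2 * t"
      using LIMSEQ_unique by fastforce
    \<comment> \<open>A vector of length at most \<open>lam * t\<close> whose inner product with
      \<open>w\<close>, of length \<open>lam\<close>, is \<open>lam\<^sup>2 * t\<close> can only be
      \<open>t *\<^sub>R w\<close>.\<close>
    define D where "D = G2 (x + t *\<^sub>R e) - G2 x"
    have "norm D \<le> lam * t" unfolding D_def by (rule step[OF G2(3) t])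
    then have "D \<bullet> D \<le> (lam * t)\<^sup>2" by (metis norm_ge_zero power2_norm_eq_inner power_mono)
    moreover have "w \<bullet> w = lam\<^sup>2" using G0e w_def by (metis power2_norm_eq_inner)
    ultimately have "(norm (D - t *\<^sub>R w))\<^sup>2 \<le> 0"
      using ip unfolding D_def[symmetric] power2_norm_eq_inner
      by (simp add: inner_simps inner_commute algebra_simps power2_eq_square)
    then show ?thesis unfolding D_def by simp
  qed
  have "G2 e = w" using pos[of 1 0] z[OF G2(3)] by simp
  moreover have "G2 (x + t *\<^sub>R e) = G2 x + t *\<^sub>R w" for x t
  proof (cases "t \<ge> 0")
    case True then show ?thesis using pos[of t x] by (simp add: algebra_simps)
  next
    case False
    then have "G2 ((x + t *\<^sub>R e) + (-t) *\<^sub>R e) - G2 (x + t *\<^sub>R e) = (-t) *\<^sub>R w"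
      by (intro pos) auto
    then show ?thesis by (simp add: algebra_simps)
  qed
  ultimately show thesis using that G2(3) by metis
qed

text \<open>Induction over the basis. The maps that are affine along the directions already treated
  form a blow-up closed subclass, so a further direction is gained without losing the earlier ones.
  Since the slopes do not depend on the base point and 0 is fixed, a map that is affine in all basis
  directions is linear.\<close>

lemma blowup_closed_contains_linear:
  fixes \<G> :: "('a::euclidean_space \<Rightarrow> 'a) set"
  assumes bc: "blowup_closed L \<G>" and ne: "\<G> \<noteq> {}"
  obtains T where "T \<in> \<G>" "linear T"
proof -
  have "\<exists>G\<in>\<G>. \<forall>b\<in>B. \<forall>x t. G (x + t *\<^sub>R b) = G x + t *\<^sub>R G b" if "finite B" "B \<subseteq> Basis" for B
    using that
  proof (induction B rule: finite_induct)
    case empty then show ?case using ne by auto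
  next
    case (insert b B)
    define \<H> where "\<H> = {G\<in>\<G>. \<forall>b\<in>B. \<forall>x t. G (x + t *\<^sub>R b) = G x + t *\<^sub>R G b}"
    have "\<H> \<noteq> {}" using insert unfolding \<H>_def by auto
    moreover have "blowup_closed L \<H>"
      unfolding blowup_closed_def
    proof (intro conjI ballI allI impI)
      fix G p and l :: real assume G: "G \<in> \<H>" and l: "l > 0"
      have "(\<lambda>x. (G (p + l *\<^sub>R x) - G p) /\<^sub>R l) \<in> \<G>" using bc G l unfolding blowup_closed_def \<H>_def by auto
      moreover have "(G (p + l *\<^sub>R (x + t *\<^sub>R c)) - G p) /\<^sub>R l = (G (p + l *\<^sub>R x) - G p) /\<^sub>R l + t *\<^sub>R ((G (p + l *\<^sub>R c) - G p) /\<^sub>R l)"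
        if "c \<in> B" for c x t
      proof -
        have "p + l *\<^sub>R (x + t *\<^sub>R c) = (p + l *\<^sub>R x) + (l * t) *\<^sub>R c" by (simp add: algebra_simps)
        then have "G (p + l *\<^sub>R (x + t *\<^sub>R c)) = G (p + l *\<^sub>R x) + (l * t) *\<^sub>R G c"
          using G that unfolding \<H>_def by (metis (mono_tags, lifting) mem_Collect_eq)
        moreover have "G (p + l *\<^sub>R c) = G p + l *\<^sub>R G c" using G that unfolding \<H>_def by auto
        ultimately show ?thesis using l by (simp add: algebra_simps)
      qed
      ultimately show "(\<lambda>x. (G (p + l *\<^sub>R x) - G p) /\<^sub>R l) \<in> \<H>" unfolding \<H>_def by blast
    next
      fix g G assume g: "\<forall>n. g n \<in> \<H>" and lim: "\<forall>x. (\<lambda>n. g n x) \<longlonglongrightarrow> G x"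
      have "\<forall>n. g n \<in> \<G>" using g unfolding \<H>_def by auto
      then have "G \<in> \<G>" using bc lim unfolding blowup_closed_def by blast
      moreover have "G (x + t *\<^sub>R c) = G x + t *\<^sub>R G c" if "c \<in> B" for c x t
      proof (rule LIMSEQ_unique)
        show "(\<lambda>n. g n (x + t *\<^sub>R c)) \<longlonglongrightarrow> G (x + t *\<^sub>R c)" using lim by auto
        have "(\<lambda>n. g n x + t *\<^sub>R g n c) \<longlonglongrightarrow> G x + t *\<^sub>R G c" by (intro tendsto_intros lim[rule_format])
        then show "(\<lambda>n. g n (x + t *\<^sub>R c)) \<longlonglongrightarrow> G x + t *\<^sub>R G c" using g that unfolding \<H>_def by auto
      qed
      ultimately show "G \<in> \<H>" unfolding \<H>_def by auto
    qed (use bc in \<open>auto simp: blowup_closed_def \<H>_def\<close>)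
    ultimately obtain G where "G \<in> \<H>" "\<And>x t. G (x + t *\<^sub>R b) = G x + t *\<^sub>R G b"
      using blowup_closed_affine_direction by metis
    then show ?case unfolding \<H>_def by auto
  qed
  then obtain G where G: "G \<in> \<G>" "\<And>b x t. b \<in> Basis \<Longrightarrow> G (x + t *\<^sub>R b) = G x + t *\<^sub>R G b"
    by (metis finite_Basis order_refl)
  have z: "G 0 = 0" using bc G(1) unfolding blowup_closed_def by auto
  have "G (\<Sum>b\<in>B. (x \<bullet> b) *\<^sub>R b) = (\<Sum>b\<in>B. (x \<bullet> b) *\<^sub>R G b)" if "finite B" "B \<subseteq> Basis" for B x
    using that
  proof (induction B rule: finite_induct)
    case (insert b B)
    then show ?case using G(2)[of b "\<Sum>b\<in>B. (x \<bullet> b) *\<^sub>R b" "x \<bullet> b"] by (simp add: add.commute)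
  qed (simp add: z)
  from this[OF finite_Basis order_refl, unfolded euclidean_representation]
  have "G = (\<lambda>x. \<Sum>b\<in>Basis. (x \<bullet> b) *\<^sub>R G b)" by (rule ext)
  moreover have "linear (\<lambda>x. \<Sum>b\<in>Basis. (x \<bullet> b) *\<^sub>R G b)"
    by (intro linear_compose_sum ballI linearI) (auto simp: inner_simps algebra_simps)
  ultimately show thesis using that G(1) by metis
qed

text \<open>The scale-invariant substitute for a lower Lipschitz bound. It limits the number of
  sheets and, through chains of separated points inside one sheet, also the Lipschitz constants of
  their inverses.\<close>

definition packing_bound :: "nat \<Rightarrow> ('a::euclidean_space \<Rightarrow> 'a) \<Rightarrow> bool" where
  "packing_bound N H \<longleftrightarrow> (\<forall>s>0. \<forall>y X. finite X \<longrightarrow>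
     (\<forall>x\<in>X. \<forall>x'\<in>X. x \<noteq> x' \<longrightarrow> dist x x' > s) \<longrightarrow> H ` X \<subseteq> cball y s \<longrightarrow> card X \<le> N)"

text \<open>The class to which the existence of linear elements is applied consists of all maps that
  \<open>H\<close> imitates somewhere inside \<open>A\<close>. The packing bound keeps the linear
  map from collapsing any direction, with a constant that depends only on \<open>N\<close>.\<close>

lemma near_linear_ball:
  fixes H :: "'a::euclidean_space \<Rightarrow> 'a"
  assumes L: "L \<ge> 0" and lip: "\<And>x y. norm (H x - H y) \<le> L * norm (x - y)"
    and pack: "packing_bound N H" and A: "open A" "A \<noteq> {}" and ep: "\<epsilon> > 0"
  obtains x r T where "r > 0" "cball x r \<subseteq> A" "linear T"
    "\<And>v. norm v \<le> 4 * (real N + 1) * norm (T v)"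
    "\<And>v. norm v \<le> 1 \<Longrightarrow> norm (H (x + r *\<^sub>R v) - H x - r *\<^sub>R T v) \<le> \<epsilon> * r"
proof -
  \<comment> \<open>Imitation is tested on finite sets only, which makes the class closed under
    pointwise limits. The radius \<open>R\<close> is arbitrary, because a blow-up about
    \<open>p\<close> moves the centre by \<open>r *\<^sub>R p\<close> and must still stay inside
    \<open>A\<close>.\<close>
  define near where "near G X R e \<longleftrightarrow> (\<exists>x r. r > 0 \<and> cball x (r * R) \<subseteq> A \<and>
    (\<forall>v\<in>X. norm (H (x + r *\<^sub>R v) - H x - r *\<^sub>R G v) \<le> e * r))" for G :: "'a \<Rightarrow> 'a" and X R e
  define \<C> where "\<C> = {G. G 0 = 0 \<and> (\<forall>x y. norm (G x - G y) \<le> L * norm (x - y)) \<and>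
    (\<forall>X R e. finite X \<longrightarrow> R > 0 \<longrightarrow> e > 0 \<longrightarrow> near G X R e)}"
  have bc: "blowup_closed L \<C>"
    unfolding blowup_closed_def
  proof (intro conjI ballI allI impI)
    fix G p and l :: real assume G: "G \<in> \<C>" and l: "l > 0"
    let ?G = "\<lambda>x. (G (p + l *\<^sub>R x) - G p) /\<^sub>R l"
    have Glip: "norm (G x - G y) \<le> L * norm (x - y)" for x y using G unfolding \<C>_def by auto
    have "norm (?G x - ?G y) \<le> L * norm (x - y)" for x y
    proof -
      have "norm (?G x - ?G y) = norm (G (p + l *\<^sub>R x) - G (p + l *\<^sub>R y)) / l"
        using l by (simp add: divide_inverse flip: scaleR_diff_right)
      also have "\<dots> \<le> (L * norm ((p + l *\<^sub>R x) - (p + l *\<^sub>R y))) / l"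
        using Glip[of "p + l *\<^sub>R x" "p + l *\<^sub>R y"] l by (intro divide_right_mono) auto
      also have "\<dots> = L * norm (x - y)"
        using l by (simp flip: scaleR_diff_right)
      finally show ?thesis .
    qed
    moreover have "near ?G X R e" if X: "finite X" "R > 0" "e > 0" for X R e
    proof -
      have "near G (insert p ((\<lambda>v. p + l *\<^sub>R v) ` X)) (norm p + l * R) (e * l / 2)"
        using G X l unfolding \<C>_def by (simp add: add_nonneg_pos)
      then obtain x r where r: "r > 0" "cball x (r * (norm p + l * R)) \<subseteq> A"
        and nr: "\<And>v. v \<in> insert p ((\<lambda>v. p + l *\<^sub>R v) ` X) \<Longrightarrow> norm (H (x + r *\<^sub>R v) - H x - r *\<^sub>R G v) \<le> (e * l / 2) * r"
        unfolding near_def by blast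
      show ?thesis unfolding near_def
      proof (intro exI[of _ "x + r *\<^sub>R p"] exI[of _ "r * l"] conjI ballI)
        show "r * l > 0" using r l by simp
        show "cball (x + r *\<^sub>R p) (r * l * R) \<subseteq> A"
        proof
          fix y assume "y \<in> cball (x + r *\<^sub>R p) (r * l * R)"
          then have "norm (y - x) \<le> norm (r *\<^sub>R p) + r * l * R"
            using norm_triangle_ineq[of "y - (x + r *\<^sub>R p)" "r *\<^sub>R p"]
            by (simp add: dist_norm norm_minus_commute algebra_simps)
          then have "y \<in> cball x (r * (norm p + l * R))"
            using r(1) by (simp add: dist_norm norm_minus_commute algebra_simps)
          then show "y \<in> A" using r(2) by blast
        qed
        fix v assume v: "v \<in> X"
        have "(r * l) *\<^sub>R ?G v = r *\<^sub>R (G (p + l *\<^sub>R v) - G p)" using l by simp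
        then have "H (x + r *\<^sub>R p + (r * l) *\<^sub>R v) - H (x + r *\<^sub>R p) - (r * l) *\<^sub>R ?G v
          = (H (x + r *\<^sub>R (p + l *\<^sub>R v)) - H x - r *\<^sub>R G (p + l *\<^sub>R v)) - (H (x + r *\<^sub>R p) - H x - r *\<^sub>R G p)"
          by (simp only:) (simp add: algebra_simps)
        also have "norm \<dots> \<le> (e * l / 2) * r + (e * l / 2) * r"
          by (intro order_trans[OF norm_triangle_ineq4] add_mono nr) (use v in auto)
        finally show "norm (H (x + r *\<^sub>R p + (r * l) *\<^sub>R v) - H (x + r *\<^sub>R p) - (r * l) *\<^sub>R ?G v) \<le> e * (r * l)"
          by (simp add: algebra_simps)
      qed
    qed
    moreover have "?G 0 = 0" by simp
    ultimately show "?G \<in> \<C>" unfolding \<C>_def by blast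
  next
    fix g G assume g: "\<forall>n. g n \<in> \<C>" and lim: "\<forall>x. (\<lambda>n. g n x) \<longlonglongrightarrow> G x"
    have "G 0 = 0" using LIMSEQ_unique[OF lim[rule_format, of 0]] g unfolding \<C>_def by simp
    moreover have "norm (G x - G y) \<le> L * norm (x - y)" for x y
    proof (rule LIMSEQ_le_const2)
      show "(\<lambda>n. norm (g n x - g n y)) \<longlonglongrightarrow> norm (G x - G y)" by (intro tendsto_intros lim[rule_format])
    qed (use g in \<open>auto simp: \<C>_def\<close>)
    moreover have "near G X R e" if X: "finite X" "R > 0" "e > 0" for X R e
    proof -
      have "\<forall>\<^sub>F n in sequentially. \<forall>v\<in>X. dist (g n v) (G v) < e / 2"
        using X lim by (intro eventually_ball_finite ballI tendstoD) auto
      then obtain n where n: "\<And>v. v \<in> X \<Longrightarrow> dist (g n v) (G v) < e / 2"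
        unfolding eventually_sequentially by blast
      have "near (g n) X R (e / 2)" using g X unfolding \<C>_def by auto
      then obtain x r where r: "r > 0" "cball x (r * R) \<subseteq> A"
        and nr: "\<And>v. v \<in> X \<Longrightarrow> norm (H (x + r *\<^sub>R v) - H x - r *\<^sub>R g n v) \<le> e / 2 * r"
        unfolding near_def by blast
      have "norm (H (x + r *\<^sub>R v) - H x - r *\<^sub>R G v) \<le> e * r" if v: "v \<in> X" for v
      proof -
        have "H (x + r *\<^sub>R v) - H x - r *\<^sub>R G v = (H (x + r *\<^sub>R v) - H x - r *\<^sub>R g n v) + r *\<^sub>R (g n v - G v)"
          by (simp add: algebra_simps)
        also have "norm \<dots> \<le> e / 2 * r + r * (e / 2)"
          using n[OF v] r(1) by (intro order_trans[OF norm_triangle_ineq] add_mono nr v) (auto simp: dist_norm)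
        finally show ?thesis by (simp add: algebra_simps)
      qed
      then show ?thesis unfolding near_def using r by blast
    qed
    ultimately show "G \<in> \<C>" unfolding \<C>_def by blast
  qed (use L in \<open>auto simp: \<C>_def\<close>)
  obtain x0 where x0: "x0 \<in> A" using A by auto
  \<comment> \<open>Blow-ups of \<open>H\<close> at a single point of \<open>A\<close> show that the
    class is not empty.\<close>
  define f where "f n v = (H (x0 + (1 / real (Suc n)) *\<^sub>R v) - H x0) /\<^sub>R (1 / real (Suc n))" for n :: nat and v
  have flip: "norm (f n v - f n w) \<le> L * norm (v - w) + 0" for n v w
  proof -
    have "norm (f n v - f n w) = real (Suc n) * norm (H (x0 + (1 / real (Suc n)) *\<^sub>R v) - H (x0 + (1 / real (Suc n)) *\<^sub>R w))"
      unfolding f_def by (simp del: of_nat_Suc flip: scaleR_diff_right)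
    also have "\<dots> \<le> real (Suc n) * (L * norm ((1 / real (Suc n)) *\<^sub>R (v - w)))"
      using lip[of "x0 + (1 / real (Suc n)) *\<^sub>R v" "x0 + (1 / real (Suc n)) *\<^sub>R w"]
      by (intro mult_left_mono) (simp_all add: scaleR_diff_right del: of_nat_Suc)
    finally show ?thesis by (simp del: of_nat_Suc)
  qed
  obtain \<rho> G where rG: "strict_mono (\<rho> :: nat \<Rightarrow> nat)" "\<And>x. (\<lambda>n. f (\<rho> n) x) \<longlonglongrightarrow> G x"
    "\<And>x y. norm (G x - G y) \<le> L * norm (x - y)"
  proof (rule asymptotically_lipschitz_subsequence[of L f "\<lambda>_. 0" 0])
    show "norm (f n 0) \<le> 0" for n by (simp add: f_def)
  qed (use L flip in auto)
  have G0: "G 0 = 0" using LIMSEQ_unique[OF rG(2)[of 0]] by (simp add: f_def)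
  have "near G X R e" if X: "finite X" "R > 0" "e > 0" for X R e
  proof -
    obtain d where d: "d > 0" "cball x0 d \<subseteq> A" using A(1) x0 open_contains_cball by blast
    obtain M :: nat where M: "R / d < real M" using reals_Archimedean2 by blast
    have "\<forall>\<^sub>F n in sequentially. \<forall>v\<in>X. dist (f (\<rho> n) v) (G v) < e"
      using X rG(2) by (intro eventually_ball_finite ballI tendstoD) auto
    then obtain K where K: "\<And>n v. n \<ge> K \<Longrightarrow> v \<in> X \<Longrightarrow> dist (f (\<rho> n) v) (G v) < e"
      unfolding eventually_sequentially by blast
    define m where "m = \<rho> (max M K)"
    have m: "m \<ge> M" unfolding m_def using seq_suble[OF rG(1), of "max M K"] by linarith
    define r where "r = 1 / real (Suc m)"
    have r: "r > 0" unfolding r_def by simp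
    have "R / d < real (Suc m)" using M m by linarith
    then have "r * R \<le> d" using d unfolding r_def by (simp add: field_simps del: of_nat_Suc)
    then have "cball x0 (r * R) \<subseteq> A" using d(2) subset_cball by blast
    moreover have "norm (H (x0 + r *\<^sub>R v) - H x0 - r *\<^sub>R G v) \<le> e * r" if v: "v \<in> X" for v
    proof -
      have "H (x0 + r *\<^sub>R v) - H x0 - r *\<^sub>R G v = r *\<^sub>R (f m v - G v)"
        using r unfolding f_def r_def by (simp add: scaleR_diff_right del: of_nat_Suc)
      then show ?thesis using K[of "max M K" v] v r by (simp add: m_def[symmetric] dist_norm)
    qed
    ultimately show ?thesis unfolding near_def using r by blast
  qed
  then have "G \<in> \<C>" unfolding \<C>_def using rG(3) G0 by blast
  then obtain T where T: "T \<in> \<C>" "linear T" using blowup_closed_contains_linear[OF bc] by blast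
  \<comment> \<open>Otherwise \<open>N + 1\<close> points spaced by \<open>r\<close> along
    \<open>v\<close> are mapped into a ball of radius \<open>r / 2\<close>: a quarter comes from the
    small slope, a quarter from the error of imitation.\<close>
  have unit: "norm (T v) * (4 * (real N + 1)) \<ge> 1" if v: "norm v = 1" for v
  proof (rule ccontr)
    assume "\<not> ?thesis"
    then have small: "norm (T v) * (4 * (real N + 1)) < 1" by simp
    have "near T ((\<lambda>j. real j *\<^sub>R v) ` {..N}) 1 (1/4)" using T(1) unfolding \<C>_def by simp
    then obtain x r where r: "r > 0"
      and nr: "\<And>j. j \<le> N \<Longrightarrow> norm (H (x + r *\<^sub>R (real j *\<^sub>R v)) - H x - r *\<^sub>R T (real j *\<^sub>R v)) \<le> 1 / 4 * r"
      unfolding near_def by blast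
    define p where "p j = x + r *\<^sub>R (real j *\<^sub>R v)" for j :: nat
    have dp: "dist (p i) (p j) = r * \<bar>real i - real j\<bar>" for i j
      unfolding p_def dist_norm using v r by (simp add: abs_mult flip: scaleR_diff_left right_diff_distrib)
    have far: "dist (p i) (p j) > r / 2" if "i \<noteq> j" for i j
    proof -
      have "\<bar>real i - real j\<bar> \<ge> 1" using that by linarith
      then have "r * \<bar>real i - real j\<bar> \<ge> r * 1" using r by (intro mult_left_mono) auto
      then show ?thesis unfolding dp using r by linarith
    qed
    have "inj_on p {..N}" by (intro inj_onI) (use far r in \<open>metis dist_self half_gt_zero less_asym\<close>)
    then have "card (p ` {..N}) = Suc N" by (simp add: card_image)
    moreover have "card (p ` {..N}) \<le> N"
    proof -
      have "H ` p ` {..N} \<subseteq> cball (H x) (r / 2)"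
      proof (intro subsetI, elim imageE, simp only: mem_cball atMost_iff)
        fix j assume j: "j \<le> N"
        have "norm (T v) * real j \<le> norm (T v) * (real N + 1)" using j by (intro mult_left_mono) auto
        then have "norm (r *\<^sub>R T (real j *\<^sub>R v)) \<le> r * (1/4)"
          using small r by (simp add: linear_scale[OF T(2)]) (simp add: algebra_simps)
        then have "norm (H (p j) - H x) \<le> 1/4 * r + r * (1/4)"
          using nr[OF j] norm_triangle_ineq[of "H (p j) - H x - r *\<^sub>R T (real j *\<^sub>R v)" "r *\<^sub>R T (real j *\<^sub>R v)"]
          unfolding p_def by simp
        then show "dist (H x) (H (p j)) \<le> r / 2" by (simp add: dist_norm norm_minus_commute)
      qed
      moreover have "\<forall>x\<in>p ` {..N}. \<forall>x'\<in>p ` {..N}. x \<noteq> x' \<longrightarrow> dist x x' > r / 2" using far by (metis imageE)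
      moreover have "r / 2 > 0" using r by simp
      ultimately show ?thesis using pack unfolding packing_bound_def by (metis finite_imageI finite_atMost)
    qed
    ultimately show False by simp
  qed
  have lower: "norm v \<le> 4 * (real N + 1) * norm (T v)" for v
  proof (cases "v = 0")
    case False
    have "norm v * 1 \<le> norm v * (norm (T (v /\<^sub>R norm v)) * (4 * (real N + 1)))"
      using False by (intro mult_left_mono unit) auto
    also have "norm (T (v /\<^sub>R norm v)) = norm (T v) / norm v"
      using False by (simp add: linear_scale[OF T(2)] divide_inverse)
    finally show ?thesis using False by (simp add: mult.commute)
  qed simp
  \<comment> \<open>On a net of mesh \<delta>, the Lipschitz bounds of \<open>H\<close> and of
    \<open>T\<close> cost a quarter of \<epsilon> each, and imitation on the net costs the remaining
    half.\<close>
  define \<delta> where "\<delta> = \<epsilon> / (4 * (L + 1))"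
  have dl: "\<delta> > 0" unfolding \<delta>_def using ep L by auto
  have Ld: "L * \<delta> \<le> \<epsilon> / 4" unfolding \<delta>_def using ep L by (simp add: field_simps)
  obtain X :: "'a set" where X: "finite X" "cball 0 1 \<subseteq> (\<Union>x\<in>X. ball x \<delta>)"
    using compact_cball[of "0::'a" 1] dl unfolding compact_eq_totally_bounded by blast
  have "near T X 1 (\<epsilon> / 2)" using T(1) X(1) ep unfolding \<C>_def by simp
  then obtain x r where r: "r > 0" "cball x (r * 1) \<subseteq> A"
      and nr: "\<And>v. v \<in> X \<Longrightarrow> norm (H (x + r *\<^sub>R v) - H x - r *\<^sub>R T v) \<le> \<epsilon> / 2 * r"
    unfolding near_def by blast
  have Tlip: "norm (T x - T y) \<le> L * norm (x - y)" for x y using T(1) unfolding \<C>_def by auto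
  show thesis
  proof (rule that[OF r(1) _ T(2) lower])
    show "cball x r \<subseteq> A" using r by simp
    fix v :: 'a assume "norm v \<le> 1"
    then have "v \<in> (\<Union>x\<in>X. ball x \<delta>)" using X(2) by (auto simp: subset_iff)
    then obtain u where u: "u \<in> X" "dist u v < \<delta>" by auto
    have uv: "L * norm (v - u) \<le> L * \<delta>" using u L by (intro mult_left_mono) (auto simp: dist_norm norm_minus_commute)
    have "norm (H (x + r *\<^sub>R v) - H (x + r *\<^sub>R u)) \<le> L * norm (r *\<^sub>R (v - u))"
      using lip[of "x + r *\<^sub>R v" "x + r *\<^sub>R u"] by (simp add: scaleR_diff_right)
    also have "\<dots> = r * (L * norm (v - u))" using r by simp
    also have "\<dots> \<le> r * (\<epsilon> / 4)" using uv Ld r by (intro mult_left_mono) auto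
    finally have 1: "norm (H (x + r *\<^sub>R v) - H (x + r *\<^sub>R u)) \<le> r * (\<epsilon> / 4)" .
    have "norm (T u - T v) \<le> \<epsilon> / 4" using Tlip[of u v] uv Ld by (simp add: norm_minus_commute)
    then have 2: "norm (r *\<^sub>R (T u - T v)) \<le> r * (\<epsilon> / 4)" using r by simp
    have "H (x + r *\<^sub>R v) - H x - r *\<^sub>R T v = (H (x + r *\<^sub>R v) - H (x + r *\<^sub>R u)) + (H (x + r *\<^sub>R u) - H x - r *\<^sub>R T u) + r *\<^sub>R (T u - T v)"
      by (simp add: algebra_simps)
    also have "norm \<dots> \<le> r * (\<epsilon> / 4) + \<epsilon> / 2 * r + r * (\<epsilon> / 4)"
      by (intro order_trans[OF norm_triangle_ineq] add_mono order_trans[OF norm_triangle_ineq] 1 2 nr u)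
    finally show "norm (H (x + r *\<^sub>R v) - H x - r *\<^sub>R T v) \<le> \<epsilon> * r" by (simp add: algebra_simps)
  qed
qed

section \<open>Stable coverings and sheets\<close>

text \<open>The consequence of nonzero degree over \<open>V\<close> that the proof uses, stated
  without degree. It depends on \<open>H\<close> only through the values on the frontier, so
  \<open>H\<close> may be modified freely inside \<open>A\<close>.\<close>

definition stably_covers :: "('a::euclidean_space \<Rightarrow> 'a) \<Rightarrow> 'a set \<Rightarrow> 'a set \<Rightarrow> bool" where
  "stably_covers H A V \<longleftrightarrow> compact A \<and> H ` frontier A \<inter> V = {} \<and>
     (\<forall>g. continuous_on A g \<longrightarrow> (\<forall>x\<in>frontier A. g x = H x) \<longrightarrow> V \<subseteq> g ` A)"

text \<open>If \<open>k\<close> had no zero, the map sending \<open>v\<close> to the opposite of the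
  normalised \<open>k v\<close> would have a fixed point by Brouwer's theorem. It lies on the
  sphere, where \<open>k v\<close> is a negative multiple of \<open>v\<close> and thus has distance
  at least 1 from \<open>v\<close>.\<close>

lemma zero_if_near_id_on_sphere:
  fixes k :: "'a::euclidean_space \<Rightarrow> 'a"
  assumes cont: "continuous_on (cball 0 1) k" and near: "\<And>v. norm v = 1 \<Longrightarrow> norm (k v - v) < 1"
  obtains v where "norm v \<le> 1" "k v = 0"
proof (rule ccontr)
  assume "\<not> thesis"
  then have nz: "\<And>v. v \<in> cball 0 1 \<Longrightarrow> k v \<noteq> 0" using that by auto
  have "continuous_on (cball 0 1) (\<lambda>v. - (k v /\<^sub>R norm (k v)))"
    using nz by (intro continuous_intros cont) auto
  moreover have "(\<lambda>v. - (k v /\<^sub>R norm (k v))) \<in> cball 0 1 \<rightarrow> cball 0 1" using nz by auto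
  ultimately obtain v where v: "v \<in> cball 0 1" "- (k v /\<^sub>R norm (k v)) = v"
    using brouwer[of "cball 0 1" "\<lambda>v. - (k v /\<^sub>R norm (k v))"] by auto
  have "norm (- (k v /\<^sub>R norm (k v))) = 1" using nz[OF v(1)] by simp
  then have n1: "norm v = 1" by (simp only: v(2))
  have "k v = - (norm (k v) *\<^sub>R v)" using v(2) nz[OF v(1)] by (metis divideR_right minus_minus norm_eq_zero scaleR_minus_right)
  then have "k v - v = - ((norm (k v) + 1) *\<^sub>R v)" by (simp add: algebra_simps)
  then have "norm (k v - v) = norm (k v) + 1" using n1 by (metis abs_of_nonneg add_nonneg_nonneg mult.right_neutral norm_ge_zero norm_minus_cancel norm_scaleR zero_le_one)
  then show False using near[OF n1] by (smt (verit) norm_ge_zero)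
qed

text \<open>On the boundary, \<open>g - y\<close> differs from the linear part by less than
  \<open>c * r\<close>: half for the error of \<open>H\<close>, half for the distance of
  \<open>y\<close> from the centre. The inverse of \<open>T\<close> has norm at most
  \<open>1 / c\<close>, so after composing with it the rescaled map is within 1 of the identity on
  the sphere.\<close>

lemma near_linear_stably_covers:
  fixes H :: "'a::euclidean_space \<Rightarrow> 'a"
  assumes r: "r > 0" and T: "linear T" and c: "c > 0" "\<And>v. c * norm v \<le> norm (T v)"
    and near: "\<And>v. norm v \<le> 1 \<Longrightarrow> norm (H (x + r *\<^sub>R v) - H x - r *\<^sub>R T v) \<le> c / 2 * r"
  shows "stably_covers H (cball x r) (ball (H x) (c / 2 * r))"
  unfolding stably_covers_def
proof (intro conjI allI impI subsetI)
  have scaled: "\<exists>v. norm v = 1 \<and> u = x + r *\<^sub>R v" if "u \<in> sphere x r" for u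
    using that r by (intro exI[of _ "(u - x) /\<^sub>R r"]) (auto simp: dist_norm norm_minus_commute)
  show "H ` frontier (cball x r) \<inter> ball (H x) (c / 2 * r) = {}"
  proof -
    have "norm (H u - H x) \<ge> c / 2 * r" if u: "u \<in> sphere x r" for u
    proof -
      obtain v where v: "norm v = 1" "u = x + r *\<^sub>R v" using scaled[OF u] by auto
      have "c * r \<le> norm (r *\<^sub>R T v)" using c(2)[of v] v r by simp
      also have "\<dots> \<le> norm (H u - H x) + c / 2 * r"
        using near[of v] v norm_triangle_ineq4[of "H u - H x" "H u - H x - r *\<^sub>R T v"] by simp
      finally show ?thesis by simp
    qed
    then show ?thesis using r by (fastforce simp: dist_norm norm_minus_commute)
  qed
  fix g y assume cont: "continuous_on (cball x r) g" and fr: "\<forall>u\<in>frontier (cball x r). g u = H u"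
    and y: "y \<in> ball (H x) (c / 2 * r)"
  have "inj T"
    unfolding linear_injective_0[OF T] using c by (metis mult_pos_pos norm_zero not_less zero_less_norm_iff)
  then obtain T' where T': "linear T'" "\<And>v. T' (T v) = v" "\<And>v. T (T' v) = v"
    using linear_injective_isomorphism[OF T] by metis
  have T'b: "norm (T' w) * c \<le> norm w" for w using c(2)[of "T' w"] T'(3) by (simp add: mult.commute)
  define k where "k v = T' ((g (x + r *\<^sub>R v) - y) /\<^sub>R r)" for v
  have "continuous_on (cball 0 1) k"
    unfolding k_def
    by (intro linear_continuous_on_compose[OF _ T'(1)] continuous_intros continuous_on_compose2[OF cont])
       (use r in \<open>auto simp: dist_norm intro!: continuous_intros\<close>)
  moreover have "norm (k v - v) < 1" if v: "norm v = 1" for v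
  proof -
    have "x + r *\<^sub>R v \<in> frontier (cball x r)" using v r by (simp add: dist_norm)
    then have g: "g (x + r *\<^sub>R v) = H (x + r *\<^sub>R v)" using fr by blast
    have "k v - v = T' ((g (x + r *\<^sub>R v) - y) /\<^sub>R r - T v)"
      unfolding k_def using T'(2) by (simp add: linear_diff[OF T'(1)])
    then have "norm (k v - v) * c \<le> norm ((g (x + r *\<^sub>R v) - y) /\<^sub>R r - T v)" using T'b by metis
    also have "(g (x + r *\<^sub>R v) - y) /\<^sub>R r - T v = ((H (x + r *\<^sub>R v) - H x - r *\<^sub>R T v) + (H x - y)) /\<^sub>R r"
      using r unfolding g by (simp add: algebra_simps)
    also have "norm \<dots> = norm ((H (x + r *\<^sub>R v) - H x - r *\<^sub>R T v) + (H x - y)) / r"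
      using r by (simp add: divide_inverse)
    also have "\<dots> < (c / 2 * r + c / 2 * r) / r"
      using near[of v] v y r
      by (intro divide_strict_right_mono order.strict_trans1[OF norm_triangle_ineq] add_le_less_mono) (auto simp: dist_norm)
    also have "\<dots> = c" using r by simp
    finally show ?thesis using c(1) by simp
  qed
  ultimately obtain v where v: "norm v \<le> 1" "k v = 0" using zero_if_near_id_on_sphere by blast
  have "T (k v) = (g (x + r *\<^sub>R v) - y) /\<^sub>R r" unfolding k_def by (rule T'(3))
  then have "g (x + r *\<^sub>R v) = y" using v(2) r linear_0[OF T] by simp
  moreover have "x + r *\<^sub>R v \<in> cball x r" using v r by (simp add: dist_norm mult_le_cancel_left2)
  ultimately show "y \<in> g ` cball x r" by blast
qed simp

lemma stably_covering_ball:
  fixes H :: "'a::euclidean_space \<Rightarrow> 'a"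
  assumes L: "L \<ge> 0" and lip: "\<And>x y. norm (H x - H y) \<le> L * norm (x - y)"
    and pack: "packing_bound N H" and A: "open A" "A \<noteq> {}"
  obtains x r \<rho> where "r > 0" "\<rho> > 0" "cball x r \<subseteq> A" "stably_covers H (cball x r) (ball (H x) \<rho>)"
proof -
  define c where "c = 1 / (4 * (real N + 1))"
  have c: "c > 0" unfolding c_def by simp
  obtain x r T where T: "r > 0" "cball x r \<subseteq> A" "linear T"
    "\<And>v. norm v \<le> 4 * (real N + 1) * norm (T v)"
    "\<And>v. norm v \<le> 1 \<Longrightarrow> norm (H (x + r *\<^sub>R v) - H x - r *\<^sub>R T v) \<le> c / 2 * r"
    using near_linear_ball[OF L lip pack A, of "c/2"] c by (metis half_gt_zero)
  have "c * norm v \<le> norm (T v)" for v using T(4)[of v] unfolding c_def by (simp add: field_simps)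
  then have "stably_covers H (cball x r) (ball (H x) (c / 2 * r))"
    using near_linear_stably_covers[OF T(1,3) c _ T(5)] by blast
  then show thesis using that[of r "c / 2 * r" x] T c by simp
qed

section \<open>Splitting a Lipschitz map with a packing bound into sheets\<close>

lemma finite_separation:
  fixes X :: "'a::metric_space set"
  assumes "finite X"
  obtains s where "s > 0" "\<And>x x'. x \<in> X \<Longrightarrow> x' \<in> X \<Longrightarrow> x \<noteq> x' \<Longrightarrow> dist x x' > s"
proof -
  define D where "D = insert 1 ((\<lambda>(x, x'). dist x x') ` {p \<in> X \<times> X. fst p \<noteq> snd p})"
  have D: "finite D" "D \<noteq> {}" unfolding D_def using assms by auto
  have "Min D > 0" using D by (subst Min_gr_iff) (auto simp: D_def)
  moreover have "dist x x' > Min D / 2" if "x \<in> X" "x' \<in> X" "x \<noteq> x'" for x x'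
  proof -
    have "dist x x' \<in> D" unfolding D_def using that by force
    then have "Min D \<le> dist x x'" using D by simp
    then show ?thesis using \<open>Min D > 0\<close> by linarith
  qed
  ultimately show thesis using that[of "Min D / 2"] by simp
qed

lemma stably_covers_mono: "stably_covers H A V \<Longrightarrow> V' \<subseteq> V \<Longrightarrow> stably_covers H A V'"
  unfolding stably_covers_def by blast

definition disjoint_covers :: "('a::euclidean_space \<Rightarrow> 'a) \<Rightarrow> nat \<Rightarrow> (nat \<Rightarrow> 'a set) \<Rightarrow> 'a \<Rightarrow> real \<Rightarrow> bool" where
  "disjoint_covers H m A y r \<longleftrightarrow> r > 0 \<and> (\<forall>i<m. stably_covers H (A i) (ball y r)) \<and>
     (\<forall>i<m. \<forall>j<m. i \<noteq> j \<longrightarrow> A i \<inter> A j = {})"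

text \<open>The sets \<open>A i\<close> form a largest disjoint family covering a common ball. If the part of \<open>A i\<close> over a smaller
  ball \<open>B\<close> were disconnected, then by maximality each of its two pieces would miss a point of \<open>B\<close>;
  retracting \<open>B\<close> radially from these points onto its boundary would give a map that agrees with \<open>H\<close> on the
  frontier of \<open>A i\<close> and misses the centre of \<open>B\<close>. So this part is connected, and the packing bound controls its
  diameter.\<close>

lemma sheets:
  fixes H :: "'a::euclidean_space \<Rightarrow> 'a"
  assumes L: "L \<ge> 0" and lip: "\<And>x y. norm (H x - H y) \<le> L * norm (x - y)"
    and pack: "packing_bound N H"
  obtains y0 r0 m \<phi> where "r0 > 0" "m \<ge> (1::nat)"
    "\<And>i y y'. i < m \<Longrightarrow> y \<in> ball y0 r0 \<Longrightarrow> y' \<in> ball y0 r0 \<Longrightarrow> norm (\<phi> i y - \<phi> i y') \<le> (real N + 1) * norm (y - y')"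
    "\<And>i y. i < m \<Longrightarrow> y \<in> ball y0 r0 \<Longrightarrow> H (\<phi> i y) = y"
    "\<And>u. H u \<in> ball y0 r0 \<Longrightarrow> \<exists>i<m. u = \<phi> i (H u)"
    "\<And>i j y. i < m \<Longrightarrow> j < m \<Longrightarrow> i \<noteq> j \<Longrightarrow> y \<in> ball y0 r0 \<Longrightarrow> \<phi> i y \<noteq> \<phi> j y"
    "\<And>i. i < m \<Longrightarrow> open (\<phi> i ` ball y0 r0)"
proof -
  have "L-lipschitz_on UNIV H" using L lip by (intro lipschitz_onI) (auto simp: dist_norm)
  then have cont: "continuous_on S H" for S
    using lipschitz_on_continuous_on continuous_on_subset by blast
  have opre: "open (H -` V)" if "open V" for V using open_vimage[OF that cont] .
  have surj: "\<exists>u\<in>A. H u = z" if "stably_covers H A V" "z \<in> V" for A V z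
    using that cont unfolding stably_covers_def by blast
  have cpt: "compact A" if "stably_covers H A V" for A V using that unfolding stably_covers_def by blast
  \<comment> \<open>One preimage of the centre from each member gives \<open>m\<close> distinct
    points with the same image. At a scale below their mutual distances the packing bound applies,
    so a largest family exists.\<close>
  have bound: "m \<le> N" if F: "disjoint_covers H m A y r" for m A y r
  proof -
    have "\<exists>u\<in>A i. H u = y" if "i < m" for i
      using F that unfolding disjoint_covers_def by (intro surj[of _ "ball y r"]) auto
    then obtain x where x: "\<And>i. i < m \<Longrightarrow> x i \<in> A i" "\<And>i. i < m \<Longrightarrow> H (x i) = y" by metis
    have "inj_on x {..<m}"
    proof (rule inj_onI, rule ccontr)
      fix i j assume ij: "i \<in> {..<m}" "j \<in> {..<m}" "x i = x j" "i \<noteq> j"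
      then have "x i \<in> A i \<inter> A j" using x(1)[of i] x(1)[of j] by auto
      then show False using F ij unfolding disjoint_covers_def by auto
    qed
    then have "card (x ` {..<m}) = m" by (simp add: card_image)
    moreover obtain s where s: "s > 0" "\<And>u u'. u \<in> x ` {..<m} \<Longrightarrow> u' \<in> x ` {..<m} \<Longrightarrow> u \<noteq> u' \<Longrightarrow> dist u u' > s"
      using finite_separation[of "x ` {..<m}"] by blast
    moreover have "H ` x ` {..<m} \<subseteq> cball y s" using x(2) s(1) by auto
    ultimately show ?thesis using pack unfolding packing_bound_def by (metis finite_imageI finite_lessThan)
  qed
  define P where "P m \<longleftrightarrow> (\<exists>A y r. disjoint_covers H m A y r)" for m
  have "P 0" unfolding P_def disjoint_covers_def by (intro exI[of _ "\<lambda>_. {}"] exI[of _ 0] exI[of _ 1]) auto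
  then obtain m where m: "P m" "\<And>m'. P m' \<Longrightarrow> m' \<le> m"
  proof -
    have "\<forall>k. P k \<longrightarrow> id k < Suc N" using bound unfolding P_def by fastforce
    then show thesis using ex_has_greatest_nat[of P 0 id "Suc N"] \<open>P 0\<close> that by auto
  qed
  \<comment> \<open>Every nonempty open set mapped into the ball contains a small ball that stably
    covers some smaller ball. Families are enlarged, and members shrunk, in this way only.\<close>
  have extend: "\<exists>x q r'. r' > 0 \<and> x \<in> O' \<and> cball x q \<subseteq> O' \<and> ball (H x) r' \<subseteq> ball y r \<and> stably_covers H (cball x q) (ball (H x) r')"
    if O': "open O'" "O' \<noteq> {}" "H ` O' \<subseteq> ball y r" for O' y r
  proof -
    obtain x q \<rho> where x: "q > 0" "\<rho> > 0" "cball x q \<subseteq> O'" "stably_covers H (cball x q) (ball (H x) \<rho>)"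
      using stably_covering_ball[OF L lip pack O'(1,2)] by metis
    have xO: "x \<in> O'" using x(1,3) by auto
    then have "H x \<in> ball y r" using O'(3) by auto
    then obtain e where e: "e > 0" "ball (H x) e \<subseteq> ball y r" by (meson open_ball open_contains_ball)
    have sub: "ball (H x) (min e \<rho>) \<subseteq> ball (H x) \<rho>" "ball (H x) (min e \<rho>) \<subseteq> ball (H x) e" by auto
    show ?thesis
      using stably_covers_mono[OF x(4) sub(1)] sub(2) e x(2,3) xO
      by (intro exI[of _ x] exI[of _ q] exI[of _ "min e \<rho>"]) auto
  qed
  have m1: "m \<ge> 1"
  proof (rule ccontr)
    assume "\<not> m \<ge> 1"
    obtain x q \<rho> where "q > 0" "\<rho> > 0" "stably_covers H (cball x q) (ball (H x) \<rho>)"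
      using stably_covering_ball[OF L lip pack open_UNIV UNIV_not_empty] by metis
    then have "P 1" unfolding P_def disjoint_covers_def
      by (intro exI[of _ "\<lambda>_. cball x q"] exI[of _ "H x"] exI[of _ \<rho>]) auto
    then show False using m(2) \<open>\<not> m \<ge> 1\<close> by blast
  qed
  \<comment> \<open>A point over the ball but outside the family would leave room nearby for one
    more member, over a smaller ball that the old members still cover. This holds for every family
    of \<open>m\<close> members, not just for the chosen one.\<close>
  have all: "\<exists>i<m. u \<in> A i" if F: "disjoint_covers H m A y r" and u: "H u \<in> ball y r" for A y r u
  proof (rule ccontr)
    assume no: "\<not> (\<exists>i<m. u \<in> A i)"
    define O' where "O' = H -` ball y r - (\<Union>i<m. A i)"
    have "closed (\<Union>i<m. A i)"
      using F cpt unfolding disjoint_covers_def by (intro closed_UN) (auto intro: compact_imp_closed)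
    then have "open O'" unfolding O'_def using opre by blast
    moreover have "O' \<noteq> {}" "H ` O' \<subseteq> ball y r" unfolding O'_def using u no by auto
    ultimately obtain x q r' where x: "r' > 0" "cball x q \<subseteq> O'" "ball (H x) r' \<subseteq> ball y r"
        "stably_covers H (cball x q) (ball (H x) r')" using extend by metis
    have "disjoint_covers H (Suc m) (A(m := cball x q)) (H x) r'"
      using F x stably_covers_mono[OF _ x(3)] unfolding disjoint_covers_def O'_def
      by (fastforce simp: less_Suc_eq)
    then have "P (Suc m)" unfolding P_def by blast
    then show False using m(2) by fastforce
  qed
  obtain A y r where F: "disjoint_covers H m A y r" using m(1) unfolding P_def by auto
  have r: "r > 0" and st: "\<And>i. i < m \<Longrightarrow> stably_covers H (A i) (ball y r)"
    and disj: "\<And>i j. i < m \<Longrightarrow> j < m \<Longrightarrow> i \<noteq> j \<Longrightarrow> A i \<inter> A j = {}"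
    using F unfolding disjoint_covers_def by auto
  have conn: "connected (A i \<inter> H -` ball z s)" if i: "i < m" and s: "s > 0" and B: "ball z s \<subseteq> ball y r" for i z s
  proof (rule ccontr)
    define Q where "Q = A i \<inter> H -` ball z s"
    assume "\<not> connected (A i \<inter> H -` ball z s)"
    then obtain E1 E2 where E: "open E1" "open E2" "Q \<subseteq> E1 \<union> E2" "E1 \<inter> E2 \<inter> Q = {}" "E1 \<inter> Q \<noteq> {}" "E2 \<inter> Q \<noteq> {}"
      unfolding Q_def[symmetric] connected_def by auto
    have fr: "H ` frontier (A i) \<inter> ball y r = {}" and cA: "compact (A i)" and
      stab: "\<And>g. continuous_on (A i) g \<Longrightarrow> (\<forall>x\<in>frontier (A i). g x = H x) \<Longrightarrow> ball y r \<subseteq> g ` A i"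
      using st[OF i] unfolding stably_covers_def by auto
    have frA: "frontier (A i) = A i - interior (A i)"
      using cA by (simp add: compact_imp_closed frontier_def)
    have Qi: "Q = interior (A i) \<inter> H -` ball z s"
      using fr B interior_subset[of "A i"] unfolding Q_def frA by blast
    have oQ: "open Q" unfolding Qi using opre[of "ball z s"] by blast
    define P1 P2 where "P1 = Q \<inter> E1" and "P2 = Q \<inter> E2"
    have oP: "open P1" "open P2" "P1 \<inter> P2 = {}" "Q = P1 \<union> P2" "P1 \<noteq> {}" "P2 \<noteq> {}"
      unfolding P1_def P2_def using oQ E by auto
    \<comment> \<open>Shrinking member \<open>i\<close> to a small ball inside \<open>R\<close>
      gives another family of \<open>m\<close> sets, over a ball around \<open>H x\<close>. By
      \<open>all\<close>, no preimage of \<open>H x\<close> lies outside this family, hence none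
      lies in \<open>Q - R\<close>.\<close>
    have miss: "\<exists>q\<in>ball z s. q \<notin> H ` (Q - R)" if R: "open R" "R \<noteq> {}" "R \<subseteq> Q" for R
    proof -
      have "H ` R \<subseteq> ball y r" using R B unfolding Q_def by auto
      then obtain x q r' where x: "r' > 0" "x \<in> R" "cball x q \<subseteq> R" "ball (H x) r' \<subseteq> ball y r"
          "stably_covers H (cball x q) (ball (H x) r')" using extend[OF R(1,2)] by metis
      have "cball x q \<subseteq> A i" using x(3) R(3) unfolding Q_def by blast
      then have F': "disjoint_covers H m (A(i := cball x q)) (H x) r'"
        unfolding disjoint_covers_def
      proof (intro conjI allI impI)
        show "stably_covers H ((A(i := cball x q)) k) (ball (H x) r')" if "k < m" for k
          using x(5) stably_covers_mono[OF st[OF that] x(4)] by (cases "k = i") auto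
        fix k j assume kj: "k < m" "j < m" "k \<noteq> j"
        have "(A(i := cball x q)) k \<subseteq> A k" "(A(i := cball x q)) j \<subseteq> A j"
          using \<open>cball x q \<subseteq> A i\<close> by auto
        then show "(A(i := cball x q)) k \<inter> (A(i := cball x q)) j = {}" using disj[OF kj] by blast
      qed (rule x(1))
      have "H u \<noteq> H x" if u: "u \<in> Q - R" for u
      proof
        assume "H u = H x"
        then obtain j where j: "j < m" "u \<in> (A(i := cball x q)) j" using all[OF F', of u] x(1) by auto
        show False
        proof (cases "j = i")
          case True then show ?thesis using j u x(3) by auto
        next
          case False then show ?thesis using j u disj[OF j(1) i] unfolding Q_def by auto
        qed
      qed
      moreover have "H x \<in> ball z s" using x(2) R(3) unfolding Q_def by auto
      ultimately show ?thesis by (metis imageE)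
    qed
    have sub1: "P1 \<subseteq> Q" and sub2: "P2 \<subseteq> Q" using oP(4) by blast+
    have QP: "Q - P1 = P2" "Q - P2 = P1" using oP(3,4) by blast+
    obtain q1 where q1: "q1 \<in> ball z s" "q1 \<notin> H ` P2" using miss[OF oP(1,5) sub1] unfolding QP by blast
    obtain q2 where q2: "q2 \<in> ball z s" "q2 \<notin> H ` P1" using miss[OF oP(2,6) sub2] unfolding QP by blast
    obtain \<rho>1 where \<rho>1: "continuous_on (- {q1}) \<rho>1" "\<And>u. u \<noteq> q1 \<Longrightarrow> \<rho>1 u \<in> sphere z s" "\<And>u. u \<in> sphere z s \<Longrightarrow> \<rho>1 u = u"
      using sphere_retract_of_punctured_universe_gen[OF q1(1)] unfolding retract_of_def retraction_def by blast
    obtain \<rho>2 where \<rho>2: "continuous_on (- {q2}) \<rho>2" "\<And>u. u \<noteq> q2 \<Longrightarrow> \<rho>2 u \<in> sphere z s" "\<And>u. u \<in> sphere z s \<Longrightarrow> \<rho>2 u = u"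
      using sphere_retract_of_punctured_universe_gen[OF q2(1)] unfolding retract_of_def retraction_def by blast
    define g where "g u = (if u \<in> P2 then \<rho>1 (H u) else if u \<in> P1 then \<rho>2 (H u) else H u)" for u
    define C where "C = A i \<inter> H -` cball z s"
    have cC: "closed C" unfolding C_def
      using cA closed_vimage[OF closed_cball cont] by (intro closed_Int) (auto intro: compact_imp_closed)
    have sph: "H u \<in> sphere z s" if "u \<in> C" "u \<notin> Q" for u using that unfolding C_def Q_def by auto
    \<comment> \<open>Continuity is checked on three closed pieces. On \<open>C - P2\<close> the map
      is \<open>\<rho>2\<close> after \<open>H\<close>, also outside \<open>Q\<close>: points of
      \<open>C\<close> not in \<open>Q\<close> lie over the sphere, where both retractions are the
      identity.\<close>
    have c1: "continuous_on (C - P2) g"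
    proof -
      have ne: "H u \<noteq> q2" if "u \<in> C - P2" for u using that q2 sph[of u] oP(4) by (cases "u \<in> Q") auto
      have "continuous_on (C - P2) (\<lambda>u. \<rho>2 (H u))"
        by (intro continuous_on_compose2[OF \<rho>2(1) cont]) (use ne in auto)
      moreover have "\<rho>2 (H u) = g u" if "u \<in> C - P2" for u
        using that sph[of u] oP(4) \<rho>2(3) unfolding g_def by auto
      ultimately show ?thesis by (rule continuous_on_eq)
    qed
    have c2: "continuous_on (C - P1) g"
    proof -
      have ne: "H u \<noteq> q1" if "u \<in> C - P1" for u using that q1 sph[of u] oP(4) by (cases "u \<in> Q") auto
      have "continuous_on (C - P1) (\<lambda>u. \<rho>1 (H u))"
        by (intro continuous_on_compose2[OF \<rho>1(1) cont]) (use ne in auto)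
      moreover have "\<rho>1 (H u) = g u" if "u \<in> C - P1" for u
        using that sph[of u] oP(4) \<rho>1(3) unfolding g_def by auto
      ultimately show ?thesis by (rule continuous_on_eq)
    qed
    have c3: "continuous_on (A i - Q) g"
      using cont[of "A i - Q"]
    proof (rule continuous_on_eq)
      show "H u = g u" if "u \<in> A i - Q" for u using that sub1 sub2 unfolding g_def by auto
    qed
    have "continuous_on (((A i - Q) \<union> (C - P1)) \<union> (C - P2)) g"
      using cA oQ oP cC by (intro continuous_on_closed_Un c1 c2 c3 closed_Un closed_Diff) (auto intro: compact_imp_closed)
    moreover have "((A i - Q) \<union> (C - P1)) \<union> (C - P2) = A i"
    proof -
      have "Q \<subseteq> C" "C \<subseteq> A i" unfolding C_def Q_def by (auto simp: less_imp_le)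
      then show ?thesis using oP(3) unfolding oP(4) by blast
    qed
    ultimately have "continuous_on (A i) g" by simp
    moreover have "\<forall>x\<in>frontier (A i). g x = H x"
    proof
      fix u assume "u \<in> frontier (A i)"
      then have "u \<notin> Q" unfolding frA Qi by blast
      then show "g u = H u" using sub1 sub2 unfolding g_def by auto
    qed
    ultimately have "ball y r \<subseteq> g ` A i" by (rule stab)
    then obtain u where u: "u \<in> A i" "z = g u" using B s by (meson centre_in_ball imageE subsetD)
    show False
    proof (cases "u \<in> Q")
      case True
      have "g u \<in> sphere z s"
      proof (cases "u \<in> P2")
        case True
        then have "H u \<noteq> q1" using q1(2) by blast
        then show ?thesis using True \<rho>1(2) unfolding g_def by simp
      next
        case False
        then have "u \<in> P1" using \<open>u \<in> Q\<close> oP(4) by blast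
        moreover from this have "H u \<noteq> q2" using q2(2) by blast
        ultimately show ?thesis using False \<rho>2(2) unfolding g_def by simp
      qed
      then show False using u(2) s by auto
    next
      case False
      then have "g u = H u" using oP(4) unfolding g_def by auto
      then show False using u False s unfolding Q_def by auto
    qed
  qed
  \<comment> \<open>A third of the radius leaves room: a ball around \<open>H u\<close> of radius
    below \<open>2 * r / 3\<close> stays inside \<open>ball y r\<close>, and the distance of any two
    images is below that number.\<close>
  have bilip: "norm (u - u') \<le> (real N + 1) * norm (H u - H u')"
    if i: "i < m" and u: "u \<in> A i" "u' \<in> A i" "H u \<in> ball y (r/3)" "H u' \<in> ball y (r/3)" for i u u'
  proof -
    have "norm (u - u') / (real N + 1) \<le> s" if s: "norm (H u - H u') < s" "s < 2 * r / 3" for s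
    proof (rule ccontr)
      assume nt: "\<not> ?thesis"
      define \<delta> where "\<delta> = norm (u - u') / (real N + 1)"
      have ds: "\<delta> > s" unfolding \<delta>_def using nt by simp
      have s0: "s > 0" using s(1) norm_ge_zero[of "H u - H u'"] by linarith
      have "ball (H u) s \<subseteq> ball y r"
      proof
        fix z assume "z \<in> ball (H u) s"
        then show "z \<in> ball y r" using u(3) s(2) dist_triangle[of y z "H u"] by auto
      qed
      then have c: "connected (A i \<inter> H -` ball (H u) s)" by (rule conn[OF i s0])
      define R where "R = A i \<inter> H -` ball (H u) s"
      have uR: "u \<in> R" "u' \<in> R" unfolding R_def using u s s0 by (auto simp: dist_norm)
      have "connected (dist u ` R)" using c unfolding R_def[symmetric]
        by (intro connected_continuous_image continuous_intros)
      moreover have "0 \<in> dist u ` R" "norm (u - u') \<in> dist u ` R" using uR by (force simp: dist_norm)+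
      ultimately have Icc: "{0..norm (u - u')} \<subseteq> dist u ` R" by (simp add: connected_contains_Icc)
      \<comment> \<open>The connected part of the sheet joins \<open>u\<close> to \<open>u'\<close>,
        so the distance from \<open>u\<close> takes every value in between. Points at distances
        \<open>j * \<delta>\<close> are pairwise more than \<open>s\<close> apart although they lie
        over one ball of radius \<open>s\<close>, which is one point too many.\<close>
      have "\<exists>p\<in>R. dist u p = real j * \<delta>" if "j \<le> N" for j
      proof -
        have "real j * \<delta> \<le> (real N + 1) * \<delta>" using that ds s0 by (intro mult_right_mono) auto
        also have "\<dots> = norm (u - u')" unfolding \<delta>_def by simp
        finally have "real j * \<delta> \<in> {0..norm (u - u')}" using ds s0 by simp
        then have "real j * \<delta> \<in> dist u ` R" using Icc by blast
        then show ?thesis by (metis imageE)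
      qed
      then obtain p where p: "\<And>j. j \<le> N \<Longrightarrow> p j \<in> R" "\<And>j. j \<le> N \<Longrightarrow> dist u (p j) = real j * \<delta>" by metis
      have far: "dist (p j) (p k) > s" if "j \<le> N" "k \<le> N" "j \<noteq> k" for j k
      proof -
        have "\<bar>real j - real k\<bar> \<ge> 1" using that by linarith
        then have "s < \<bar>real j - real k\<bar> * \<delta>" using ds s0 by (smt (verit) mult_le_cancel_right1)
        also have "\<dots> = \<bar>dist u (p j) - dist u (p k)\<bar>" using ds s0 p(2) that by (simp add: abs_mult flip: left_diff_distrib)
        also have "\<dots> \<le> dist (p j) (p k)" using dist_triangle[of u "p j" "p k"] dist_triangle[of u "p k" "p j"] by (simp add: dist_commute)
        finally show ?thesis .
      qed
      have "inj_on p {..N}" by (intro inj_onI) (use far s0 in \<open>metis atMost_iff dist_self less_asym\<close>)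
      then have "card (p ` {..N}) = Suc N" by (simp add: card_image)
      moreover have "\<forall>x\<in>p ` {..N}. \<forall>x'\<in>p ` {..N}. x \<noteq> x' \<longrightarrow> dist x x' > s" using far by (metis atMost_iff imageE)
      moreover have "H ` p ` {..N} \<subseteq> cball (H u) s"
      proof (intro subsetI, elim imageE, simp only: atMost_iff)
        fix j assume "j \<le> N"
        then have "H (p j) \<in> ball (H u) s" using p(1)[of j] unfolding R_def by blast
        then show "H (p j) \<in> cball (H u) s" by simp
      qed
      ultimately have "Suc N \<le> N" using pack s0 unfolding packing_bound_def by (metis finite_imageI finite_atMost)
      then show False by simp
    qed
    note le_s = this
    \<comment> \<open>The open ball of radius \<open>s\<close> around \<open>H u\<close> must
      contain \<open>H u'\<close>, so \<open>s\<close> lies strictly above the distance of the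
      images; it now decreases to that distance.\<close>
    have "norm (u - u') / (real N + 1) \<le> norm (H u - H u')"
    proof (rule dense_ge_bounded[of _ "2 * r / 3"])
      show "norm (H u - H u') < 2 * r / 3"
        using u(3,4) dist_triangle[of "H u" "H u'" y] by (simp add: dist_norm norm_minus_commute)
    qed (rule le_s)
    then show ?thesis by (simp add: pos_divide_le_eq mult.commute)
  qed
  define \<phi> where "\<phi> i z = (SOME u. u \<in> A i \<and> H u = z)" for i z
  have sub: "ball y (r/3) \<subseteq> ball y r" using r by (simp add: subset_ball)
  have \<phi>: "\<phi> i z \<in> A i \<and> H (\<phi> i z) = z" if "i < m" "z \<in> ball y (r/3)" for i z
  proof -
    have "\<exists>u\<in>A i. H u = z" using st[OF that(1)] that(2) sub surj by blast
    then show ?thesis unfolding \<phi>_def using someI_ex[of "\<lambda>u. u \<in> A i \<and> H u = z"] by blast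
  qed
  have uniq: "u = \<phi> i (H u)" if "i < m" "u \<in> A i" "H u \<in> ball y (r/3)" for u i
    using bilip[of i u "\<phi> i (H u)"] \<phi>[of i "H u"] that by simp
  show thesis
  proof (rule that[of "r/3" m y \<phi>])
    show "r / 3 > 0" using r by simp
    show "norm (\<phi> i z - \<phi> i z') \<le> (real N + 1) * norm (z - z')" if "i < m" "z \<in> ball y (r/3)" "z' \<in> ball y (r/3)" for i z z'
      using bilip[of i "\<phi> i z" "\<phi> i z'"] \<phi> that by metis
    show "\<exists>i<m. u = \<phi> i (H u)" if u: "H u \<in> ball y (r/3)" for u
    proof -
      have "H u \<in> ball y r" using u sub by blast
      then show ?thesis using all[OF F] uniq u by blast
    qed
    show "open (\<phi> i ` ball y (r/3))" if i: "i < m" for i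
    proof -
      \<comment> \<open>Over the small ball the members exhaust the preimage, so a sheet is an open
        preimage with finitely many compact sets removed.\<close>
      have "\<phi> i ` ball y (r/3) = H -` ball y (r/3) - (\<Union>j\<in>{..<m} - {i}. A j)"
      proof (intro set_eqI iffI)
        fix u assume "u \<in> \<phi> i ` ball y (r/3)"
        then show "u \<in> H -` ball y (r/3) - (\<Union>j\<in>{..<m} - {i}. A j)"
        proof (elim imageE)
          fix z assume z: "u = \<phi> i z" "z \<in> ball y (r/3)"
          have "u \<in> A i" "H u = z" using \<phi>[OF i z(2)] z(1) by auto
          moreover from this have "u \<notin> A j" if "j \<in> {..<m} - {i}" for j
            using disj[OF i, of j] that by auto
          ultimately show ?thesis using z(2) by blast
        qed
      next
        fix u assume u: "u \<in> H -` ball y (r/3) - (\<Union>j\<in>{..<m} - {i}. A j)"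
        then have "H u \<in> ball y r" using sub by blast
        then obtain j where "j < m" "u \<in> A j" using all[OF F] by blast
        then have "u \<in> A i" using u by auto
        then show "u \<in> \<phi> i ` ball y (r/3)" using uniq[OF i, of u] u by blast
      qed
      moreover have "closed (\<Union>j\<in>{..<m} - {i}. A j)"
        using cpt[OF st] by (intro closed_UN) (auto intro: compact_imp_closed)
      ultimately show ?thesis using opre[OF open_ball] by (simp add: open_Diff)
    qed
    show "\<phi> i z \<noteq> \<phi> j z" if "i < m" "j < m" "i \<noteq> j" "z \<in> ball y (r/3)" for i j z
      using \<phi>[OF that(1,4)] \<phi>[OF that(2,4)] disj[OF that(1-3)] by auto
  qed (use m1 \<phi> in auto)
qed

section \<open>Windows along which all sheets are nearly translations\<close>

text \<open>By invariance of domain the image of the open ball is open, by compactness that of the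
  closed ball is closed. Within the smaller ball \<open>B\<close> they agree, since the lower bound
  keeps the bounding sphere from being mapped into \<open>B\<close>; connectedness of
  \<open>B\<close> does the rest.\<close>

lemma covering_of_bilipschitz:
  fixes f :: "'a::euclidean_space \<Rightarrow> 'a"
  assumes cont: "continuous_on (cball w \<rho>) f" and M: "M > 0" and \<rho>: "\<rho> > 0"
    and low: "\<And>x y. x \<in> cball w \<rho> \<Longrightarrow> y \<in> cball w \<rho> \<Longrightarrow> norm (x - y) \<le> M * norm (f x - f y)"
  shows "ball (f w) (\<rho> / M) \<subseteq> f ` cball w \<rho>"
proof -
  define B where "B = ball (f w) (\<rho> / M)"
  have inj: "inj_on f (ball w \<rho>)"
  proof (rule inj_onI)
    fix x y assume "x \<in> ball w \<rho>" "y \<in> ball w \<rho>" "f x = f y"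
    then show "x = y" using low[of x y] by simp
  qed
  have "continuous_on (ball w \<rho>) f" using cont ball_subset_cball continuous_on_subset by blast
  then have op: "open (f ` ball w \<rho>)" using invariance_of_domain inj by blast
  have eq: "B \<inter> f ` cball w \<rho> = B \<inter> f ` ball w \<rho>"
  proof (intro equalityI subsetI)
    fix y assume "y \<in> B \<inter> f ` cball w \<rho>"
    then obtain x where x: "x \<in> cball w \<rho>" "y = f x" "y \<in> B" by blast
    have "norm (x - w) \<le> M * norm (f x - f w)" using low[of x w] x \<rho> by simp
    also have "\<dots> < M * (\<rho> / M)" using x M unfolding B_def by (intro mult_strict_left_mono) (auto simp: dist_norm norm_minus_commute)
    also have "\<dots> = \<rho>" using M by simp
    finally have "x \<in> ball w \<rho>" by (simp add: dist_norm norm_minus_commute)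
    then show "y \<in> B \<inter> f ` ball w \<rho>" using x by blast
  qed (use ball_subset_cball in blast)
  have cpt: "closed (f ` cball w \<rho>)" by (intro compact_imp_closed compact_continuous_image cont compact_cball)
  have "openin (top_of_set B) (B \<inter> f ` ball w \<rho>)" using op by (rule openin_open_Int)
  moreover have "closedin (top_of_set B) (B \<inter> f ` ball w \<rho>)" unfolding eq[symmetric] using cpt by (rule closedin_closed_Int)
  moreover have "connected B" unfolding B_def by simp
  moreover have "f w \<in> B \<inter> f ` ball w \<rho>" unfolding B_def using \<rho> M by auto
  ultimately have "B \<inter> f ` ball w \<rho> = B" unfolding connected_clopen by blast
  then show ?thesis using eq unfolding B_def by blast
qed

lemma telescoping_small_step:
  fixes f :: "nat \<Rightarrow> real"
  assumes "f n - f 0 \<le> B" "n > 0"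
  obtains j where "j < n" "f (Suc j) - f j \<le> B / real n"
proof (rule ccontr)
  assume "\<not> thesis"
  then have "\<And>j. j < n \<Longrightarrow> f (Suc j) - f j > B / real n" using that by force
  then have "(\<Sum>j<n. f (Suc j) - f j) > (\<Sum>j<n. B / real n)"
    using assms(2) by (intro sum_strict_mono) auto
  then show False using assms by (simp add: sum_lessThan_telescope)
qed

text \<open>A window is a row of \<open>P\<close> cubes of side \<open>\<theta>\<close>, only the first of which, centred at \<open>c\<close>, is known to lie in the
  array \<open>A\<close> on the base sheet \<open>i0\<close>. The array occupies a volume \<open>O(\<theta>\<^sup>d)\<close> in each image, independently of \<open>P\<close>, so
  averaging over the row makes the other sheets irrelevant. The radius \<open>r\<close> of the test balls is chosen by
  pigeonhole such that enlarging it hardly changes the volumes of the images.\<close>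

lemma window_imbalance:
  fixes kI :: nat and M K :: real
  assumes M: "M \<ge> 1" and kI: "kI > 0" and K: "K \<ge> 0"
  obtains \<epsilon> \<tau> P0 where "\<epsilon> > 0" "\<tau> > 0"
    "\<And>\<theta> P e c \<xi> I J i0 s S A Z U st \<Omega>. \<lbrakk>\<theta> > 0; P \<ge> (P0::nat); norm (e::'a::euclidean_space) = 1;
      finite (I::nat set); card I = kI; J \<subseteq> I; i0 \<in> J;
      \<And>i x y. i \<in> I \<Longrightarrow> x \<in> \<Omega> \<Longrightarrow> y \<in> \<Omega> \<Longrightarrow> norm (\<xi> i x - \<xi> i y) \<le> M * norm (x - y);
      \<And>i x y. i \<in> I \<Longrightarrow> x \<in> \<Omega> \<Longrightarrow> y \<in> \<Omega> \<Longrightarrow> norm (x - y) \<le> M * norm (\<xi> i x - \<xi> i y :: 'a);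
      \<And>k. k < P \<Longrightarrow> cball (c + (real k * \<theta>) *\<^sub>R e) \<theta> \<subseteq> \<Omega>;
      \<And>x. x \<in> \<Omega> \<Longrightarrow> \<xi> i0 x = x; \<And>i. i \<in> I \<Longrightarrow> \<bar>s i\<bar> \<le> (2::real);
      \<And>F. compact F \<Longrightarrow> F \<subseteq> \<Omega> \<Longrightarrow> (\<Sum>i\<in>I. s i * measure lebesgue (\<xi> i ` F)) + (\<Sum>i\<in>J. measure lebesgue (S \<inter> \<xi> i ` F)) = 0;
      \<And>i k x. i \<in> I \<Longrightarrow> k < P \<Longrightarrow> x \<in> cball c (\<theta>/2) \<Longrightarrow>
         norm (\<xi> i (x + (real k * \<theta>) *\<^sub>R e) - \<xi> i x - (real k * \<theta>) *\<^sub>R U i) \<le> \<epsilon> * \<theta>;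
      \<And>i X. i \<in> J \<Longrightarrow> X \<in> lmeasurable \<Longrightarrow> X \<subseteq> Z i \<Longrightarrow>
         \<bar>measure lebesgue (S \<inter> X) - (if st i then measure lebesgue X else measure lebesgue (A \<inter> X))\<bar> \<le> \<tau> * \<theta> ^ DIM('a);
      \<not> st i0; A \<in> sets lebesgue; cball c (\<theta>/4) \<subseteq> A;
      \<And>i. i \<in> J \<Longrightarrow> Z i \<in> lmeasurable \<and> measure lebesgue (A \<inter> Z i) \<le> K * \<theta> ^ DIM('a);
      \<And>i k. i \<in> J \<Longrightarrow> k < P \<Longrightarrow> \<xi> i ` cball (c + (real k * \<theta>) *\<^sub>R e) (\<theta>/4) \<subseteq> Z i\<rbrakk> \<Longrightarrow> False"
proof -
  define d where "d = DIM('a)"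
  define \<omega> where "\<omega> = unit_ball_vol (real d)"
  have \<omega>: "\<omega> > 0" unfolding \<omega>_def by simp
  have vol: "measure lebesgue (cball z r) = \<omega> * r ^ d" if "r \<ge> 0" for z :: 'a and r
    using content_cball[of r z] that unfolding \<omega>_def d_def by simp
  define \<gamma> where "\<gamma> = \<omega> / 8 ^ d"
  have \<gamma>: "\<gamma> > 0" unfolding \<gamma>_def using \<omega> by simp
  define K2 where "K2 = \<omega> * M ^ d"
  have K2: "K2 > 0" unfolding K2_def using \<omega> M by simp
  obtain J0 :: nat where J0: "12 * real kI * K2 / \<gamma> < real J0" using reals_Archimedean2 by blast
  have "12 * real kI * K2 / \<gamma> \<ge> 0" using K2 \<gamma> by simp
  then have J0p: "real J0 > 0" using J0 by linarith
  \<comment> \<open>The final count sets \<open>real P * \<gamma> * T\<close> against three errors.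
    Replacing \<open>S\<close> by its local description costs a quarter because of \<tau>, the
    variation of volumes less than a half because of \<open>J0\<close>, and the whole array a
    quarter because of \<open>P0\<close>. The bound \<epsilon> keeps the affine error below the
    spacing of the \<open>J0\<close> test radii divided by \<open>M\<close>.\<close>
  define \<epsilon> where "\<epsilon> = 1 / (16 * M * real J0)"
  define \<tau> where "\<tau> = \<gamma> / (8 * real kI)"
  obtain P0 :: nat where P0: "4 * real kI * K / \<gamma> < real P0" using reals_Archimedean2 by blast
  have \<epsilon>: "\<epsilon> > 0" and \<tau>: "\<tau> > 0" unfolding \<epsilon>_def \<tau>_def using M J0p \<gamma> kI by auto
  show thesis
  proof (rule that[OF \<epsilon> \<tau>, of P0])
    fix \<theta> :: real and P :: nat and e c :: 'a and \<xi> :: "nat \<Rightarrow> 'a \<Rightarrow> 'a" and I J :: "nat set" and i0 s S A Z st and U :: "nat \<Rightarrow> 'a" and \<Omega>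
    assume \<theta>: "\<theta> > 0" and P: "P \<ge> P0" and e: "norm e = 1"
      and I: "finite I" "card I = kI" "J \<subseteq> I" "i0 \<in> J"
      and up: "\<And>i x y. i \<in> I \<Longrightarrow> x \<in> \<Omega> \<Longrightarrow> y \<in> \<Omega> \<Longrightarrow> norm (\<xi> i x - \<xi> i y) \<le> M * norm (x - y)"
      and low: "\<And>i x y. i \<in> I \<Longrightarrow> x \<in> \<Omega> \<Longrightarrow> y \<in> \<Omega> \<Longrightarrow> norm (x - y) \<le> M * norm (\<xi> i x - \<xi> i y)"
      and \<Omega>: "\<And>k. k < P \<Longrightarrow> cball (c + (real k * \<theta>) *\<^sub>R e) \<theta> \<subseteq> \<Omega>"
      and id: "\<And>x. x \<in> \<Omega> \<Longrightarrow> \<xi> i0 x = x" and s: "\<And>i. i \<in> I \<Longrightarrow> \<bar>s i\<bar> \<le> (2::real)"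
      and bal: "\<And>F. compact F \<Longrightarrow> F \<subseteq> \<Omega> \<Longrightarrow> (\<Sum>i\<in>I. s i * measure lebesgue (\<xi> i ` F)) + (\<Sum>i\<in>J. measure lebesgue (S \<inter> \<xi> i ` F)) = 0"
      and aff: "\<And>i k x. i \<in> I \<Longrightarrow> k < P \<Longrightarrow> x \<in> cball c (\<theta>/2) \<Longrightarrow>
         norm (\<xi> i (x + (real k * \<theta>) *\<^sub>R e) - \<xi> i x - (real k * \<theta>) *\<^sub>R U i) \<le> \<epsilon> * \<theta>"
      and state: "\<And>i X. i \<in> J \<Longrightarrow> X \<in> lmeasurable \<Longrightarrow> X \<subseteq> Z i \<Longrightarrow>
         \<bar>measure lebesgue (S \<inter> X) - (if st i then measure lebesgue X else measure lebesgue (A \<inter> X))\<bar> \<le> \<tau> * \<theta> ^ DIM('a)"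
      and st0: "\<not> st i0" and A: "A \<in> sets lebesgue" "cball c (\<theta>/4) \<subseteq> A"
      and Z: "\<And>i. i \<in> J \<Longrightarrow> Z i \<in> lmeasurable \<and> measure lebesgue (A \<inter> Z i) \<le> K * \<theta> ^ DIM('a)"
      and inZ: "\<And>i k. i \<in> J \<Longrightarrow> k < P \<Longrightarrow> \<xi> i ` cball (c + (real k * \<theta>) *\<^sub>R e) (\<theta>/4) \<subseteq> Z i"
    have finJ: "finite J" using I finite_subset by blast
    have cJ: "real (card J) \<le> real kI" using card_mono[OF I(1,3)] I(2) by simp
    have "4 * real kI * K / \<gamma> \<ge> 0" using K \<gamma> by simp
    then have Pp: "P > 0" using P0 P by (metis (no_types, lifting) gr0I le_less_trans not_less of_nat_0 le_zero_eq)
    define T where "T = \<theta> ^ d"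
    have T: "T > 0" unfolding T_def using \<theta> by simp
    define ck where "ck k = c + (real k * \<theta>) *\<^sub>R e" for k
    define X where "X i k r = \<xi> i ` cball (ck k) r" for i k r
    define v where "v i k r = measure lebesgue (X i k r)" for i k r
    have sub: "cball (ck k) r \<subseteq> \<Omega>" if "k < P" "r \<le> \<theta>" for k r
      using \<Omega>[OF that(1)] subset_cball[OF that(2)] unfolding ck_def by blast
    have contO: "continuous_on Y (\<xi> i)" if "i \<in> I" "Y \<subseteq> \<Omega>" for i Y
    proof -
      have "M-lipschitz_on Y (\<xi> i)" using up that M by (intro lipschitz_onI) (auto simp: dist_norm subset_iff)
      then show ?thesis by (rule lipschitz_on_continuous_on)
    qed
    have cptX: "compact (X i k r)" if "i \<in> I" "k < P" "r \<le> \<theta>" for i k r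
      unfolding X_def by (intro compact_continuous_image contO that sub) auto
    have lmX: "X i k r \<in> lmeasurable" if "i \<in> I" "k < P" "r \<le> \<theta>" for i k r
      using cptX[OF that] by (rule lmeasurable_compact)
    have vmono: "v i k r \<le> v i k r'" if "i \<in> I" "k < P" "r \<le> r'" "r' \<le> \<theta>" for i k r r'
      unfolding v_def by (intro measure_mono_fmeasurable fmeasurableD lmX that order_trans[OF that(3,4)])
        (use subset_cball[OF that(3)] in \<open>auto simp: X_def\<close>)
    have vbound: "v i k r \<le> K2 * T" if "i \<in> I" "k < P" "0 \<le> r" "r \<le> \<theta>" for i k r
    proof -
      have ckO: "ck k \<in> \<Omega>" using sub[OF that(2), of 0] \<theta> by simp
      have "X i k r \<subseteq> cball (\<xi> i (ck k)) (M * \<theta>)"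
      proof
        fix y assume "y \<in> X i k r"
        then obtain x where x: "x \<in> cball (ck k) r" "y = \<xi> i x" unfolding X_def by blast
        have "norm (\<xi> i (ck k) - \<xi> i x) \<le> M * norm (ck k - x)" using up that(1) ckO sub[OF that(2,4)] x by blast
        also have "\<dots> \<le> M * \<theta>" using x that M by (intro mult_left_mono) (auto simp: dist_norm)
        finally show "y \<in> cball (\<xi> i (ck k)) (M * \<theta>)" using x by (simp add: dist_norm)
      qed
      then have "v i k r \<le> measure lebesgue (cball (\<xi> i (ck k)) (M * \<theta>))"
        unfolding v_def using lmX that by (intro measure_mono_fmeasurable) auto
      also have "\<dots> = K2 * T" using M \<theta> by (subst vol) (auto simp: K2_def T_def power_mult_distrib)
      finally show ?thesis .
    qed
    define \<Delta> where "\<Delta> = \<theta> / (8 * real J0)"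
    have \<Delta>: "\<Delta> > 0" "real J0 * \<Delta> = \<theta> / 8" unfolding \<Delta>_def using \<theta> J0p by auto
    have \<Delta>\<epsilon>: "\<epsilon> * \<theta> < \<Delta> / M" unfolding \<epsilon>_def \<Delta>_def using M J0p \<theta> by (simp add: field_simps)
    \<comment> \<open>The affine displacement moves an image at position \<open>k\<close> into the
      slightly enlarged image at position \<open>k'\<close>: the error
      \<open>\<epsilon> * \<theta>\<close> is below \<open>\<Delta> / M\<close>, and a ball of that
      radius is covered by the image of a ball of radius \<Delta>. One of the positions is 0, since
      the affine comparison starts there.\<close>
    have comp: "v i k r \<le> v i k' (r + \<Delta>)" if i: "i \<in> I" and k: "k < P" "k' < P" "k = 0 \<or> k' = 0" and r: "0 \<le> r" "r + \<Delta> \<le> \<theta> / 2" for i k k' r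
    proof -
      define u where "u = (real k' * \<theta>) *\<^sub>R U i - (real k * \<theta>) *\<^sub>R U i"
      have "(\<lambda>y. u + y) ` X i k r \<subseteq> X i k' (r + \<Delta>)"
      proof (intro image_subsetI)
        fix y assume "y \<in> X i k r"
        then obtain x where x: "x \<in> cball (ck k) r" "y = \<xi> i x" unfolding X_def by blast
        define x' where "x' = x - ck k + ck k'"
        have x': "x' \<in> cball (ck k') r" using x unfolding x'_def by (simp add: dist_norm norm_minus_commute)
        have close: "norm (\<xi> i x' - (u + y)) \<le> \<epsilon> * \<theta>"
        proof (cases "k = 0")
          case True
          have "x \<in> cball c (\<theta>/2)" using x(1) True r \<Delta> by (simp add: ck_def)
          moreover have "x' = x + (real k' * \<theta>) *\<^sub>R e" unfolding x'_def ck_def True by simp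
          ultimately show ?thesis using aff[OF i k(2), of x] x(2) unfolding u_def True by (simp add: algebra_simps)
        next
          case False
          then have k0: "k' = 0" using k by auto
          have "x' \<in> cball c (\<theta>/2)" using x' k0 r \<Delta> by (simp add: ck_def)
          moreover have "x = x' + (real k * \<theta>) *\<^sub>R e" unfolding x'_def ck_def k0 by simp
          ultimately show ?thesis using aff[OF i k(1), of x'] x(2) unfolding u_def k0
            by (simp add: algebra_simps norm_minus_commute)
        qed
        have sub': "cball x' \<Delta> \<subseteq> cball (ck k') (r + \<Delta>)"
        proof
          fix y assume "y \<in> cball x' \<Delta>"
          then show "y \<in> cball (ck k') (r + \<Delta>)" using x' dist_triangle[of "ck k'" y x'] by auto
        qed
        then have subO: "cball x' \<Delta> \<subseteq> \<Omega>" using sub[OF k(2), of "r + \<Delta>"] r \<theta> by auto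
        have "u + y \<in> ball (\<xi> i x') (\<Delta> / M)" using close \<Delta>\<epsilon> by (simp add: dist_norm)
        also have "\<dots> \<subseteq> \<xi> i ` cball x' \<Delta>"
          using subO low[OF i] M \<Delta>(1) by (intro covering_of_bilipschitz contO[OF i]) (auto simp: subset_iff)
        finally show "u + y \<in> X i k' (r + \<Delta>)" unfolding X_def using sub' by blast
      qed
      moreover have "measure lebesgue ((\<lambda>y. u + y) ` X i k r) = v i k r"
        unfolding v_def by (rule measure_translation)
      moreover have "(\<lambda>y. u + y) ` X i k r \<in> sets lebesgue"
        using i k r \<Delta> \<theta> by (intro fmeasurableD measurable_translation lmX) auto
      moreover have "X i k' (r + \<Delta>) \<in> lmeasurable"
        using i k r \<theta> by (intro lmX) auto
      ultimately show ?thesis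
        unfolding v_def using measure_mono_fmeasurable by metis
    qed
    \<comment> \<open>Position 0 is counted once for every \<open>k\<close>, because each position
      is compared with it. The test radii run from \<open>\<theta> / 8\<close> to
      \<open>\<theta> / 4\<close>, so even the largest ball stays in the region where
      \<open>S\<close> is described.\<close>
    define V where "V r = (\<Sum>k<P. \<Sum>i\<in>I. v i k r + v i 0 r)" for r
    define f where "f j = V (\<theta> / 8 + real j * \<Delta>)" for j :: nat
    have quarter: "\<theta> / 8 + real J0 * \<Delta> = \<theta> / 4" using \<Delta> by simp
    have "f J0 \<le> (\<Sum>k<P. \<Sum>i\<in>I. K2 * T + K2 * T)"
      unfolding f_def V_def quarter using \<theta> Pp by (intro sum_mono add_mono vbound) auto
    moreover have "f 0 \<ge> 0" unfolding f_def V_def v_def by (intro sum_nonneg add_nonneg_nonneg) auto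
    ultimately have "f J0 - f 0 \<le> 2 * real P * real kI * K2 * T" using I(2) by simp
    then obtain j where j: "j < J0" "f (Suc j) - f j \<le> 2 * real P * real kI * K2 * T / real J0"
      using telescoping_small_step[of f J0] J0p by auto
    define r where "r = \<theta> / 8 + real j * \<Delta>"
    have "real (Suc j) * \<Delta> \<le> real J0 * \<Delta>" using j \<Delta> by (intro mult_right_mono) auto
    then have rj: "r + \<Delta> \<le> \<theta> / 4" unfolding r_def using \<Delta>(2) by (simp add: algebra_simps)
    have r: "\<theta> / 8 \<le> r" "r \<le> \<theta> / 4" "0 \<le> r" "r \<le> \<theta>" using rj \<Delta>(1) \<theta> unfolding r_def by auto
    have fS: "f (Suc j) = V (r + \<Delta>)" "f j = V r" unfolding f_def r_def by (simp_all add: algebra_simps)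
    have "2 * real P * real kI * K2 * T / real J0 < real P * \<gamma> * T / 6"
      using J0 J0p \<gamma> Pp T by (simp add: field_simps)
    then have jump: "V (r + \<Delta>) - V r < real P * \<gamma> * T / 6" using j(2) fS by simp
    have diff: "\<bar>v i k r - v i 0 r\<bar> \<le> (v i k (r + \<Delta>) + v i 0 (r + \<Delta>)) - (v i k r + v i 0 r)" if "i \<in> I" "k < P" for i k
    proof -
      have "v i k r \<le> v i 0 (r + \<Delta>)" "v i 0 r \<le> v i k (r + \<Delta>)"
        using comp[OF that(1), of k 0 r] comp[OF that(1), of 0 k r] that r rj \<theta> Pp by auto
      moreover have "v i k r \<le> v i k (r + \<Delta>)" "v i 0 r \<le> v i 0 (r + \<Delta>)"
        using that r rj \<theta> Pp \<Delta>(1) by (auto intro!: vmono)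
      ultimately show ?thesis by linarith
    qed
    define Var where "Var = (\<Sum>k<P. \<Sum>i\<in>I. \<bar>v i k r - v i 0 r\<bar>)"
    have "Var \<le> V (r + \<Delta>) - V r"
      unfolding Var_def V_def sum_subtractf[symmetric] by (intro sum_mono diff) auto
    then have Var: "Var < real P * \<gamma> * T / 6" using jump by simp
    \<comment> \<open>Where the older set fills the surroundings, a weighted sheet contributes its
      full volume, which is absorbed into the coefficient. On the other weighted sheets only the
      array counts, through \<open>w\<close>.\<close>
    define \<sigma> where "\<sigma> i = s i + (if i \<in> J \<and> st i then 1 else 0)" for i
    define w where "w i k = (if i \<in> J \<and> \<not> st i then measure lebesgue (A \<inter> X i k r) else 0)" for i k
    have w0: "w i k \<ge> 0" for i k unfolding w_def by simp
    define B where "B k = (\<Sum>i\<in>I. \<sigma> i * v i k r) + (\<Sum>i\<in>I. w i k)" for k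
    have Babs: "\<bar>B k\<bar> \<le> real kI * \<tau> * T" if k: "k < P" for k
    proof -
      have bal': "(\<Sum>i\<in>I. s i * v i k r) + (\<Sum>i\<in>J. measure lebesgue (S \<inter> X i k r)) = 0"
        unfolding v_def X_def by (rule bal) (use sub[OF k r(4)] in auto)
      have e1: "B k = (\<Sum>i\<in>I. s i * v i k r) + (\<Sum>i\<in>I. if i \<in> J then (if st i then v i k r else measure lebesgue (A \<inter> X i k r)) else 0)"
        unfolding B_def sum.distrib[symmetric] by (intro sum.cong) (auto simp: \<sigma>_def w_def algebra_simps)
      have e2: "(\<Sum>i\<in>I. if i \<in> J then (if st i then v i k r else measure lebesgue (A \<inter> X i k r)) else 0)
        = (\<Sum>i\<in>J. if st i then v i k r else measure lebesgue (A \<inter> X i k r))"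
        using I by (simp add: sum.If_cases Int_absorb1)
      have "B k = (\<Sum>i\<in>J. (if st i then v i k r else measure lebesgue (A \<inter> X i k r)) - measure lebesgue (S \<inter> X i k r))"
        unfolding e1 e2 sum_subtractf using bal' by simp
      also have "\<bar>\<dots>\<bar> \<le> (\<Sum>i\<in>J. \<tau> * T)"
      proof (intro order_trans[OF sum_abs] sum_mono)
        fix i assume i: "i \<in> J"
        have "X i k r \<subseteq> Z i" using inZ[OF i k] subset_cball[OF r(2), of "ck k"] unfolding X_def ck_def by blast
        then show "\<bar>(if st i then v i k r else measure lebesgue (A \<inter> X i k r)) - measure lebesgue (S \<inter> X i k r)\<bar> \<le> \<tau> * T"
          using state[OF i lmX[of i k r]] i I k r unfolding v_def T_def d_def by (simp add: abs_minus_commute subset_iff)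
      qed
      also have "\<dots> \<le> real kI * \<tau> * T" using cJ \<tau> T by (simp add: mult_right_mono)
      finally show ?thesis .
    qed
    have v00: "v i0 0 r \<ge> \<gamma> * T" "w i0 0 = v i0 0 r"
    proof -
      have "X i0 0 r = cball c r" unfolding X_def ck_def using id sub[OF Pp r(4)] by (force simp: ck_def)
      moreover have "cball c r \<subseteq> A" using A(2) subset_cball[OF r(2)] by blast
      ultimately show "w i0 0 = v i0 0 r" unfolding w_def v_def using st0 I by (simp add: Int_absorb1)
      have "\<gamma> * T = \<omega> * (\<theta> / 8) ^ d" unfolding \<gamma>_def T_def by (simp add: power_divide)
      also have "\<dots> \<le> \<omega> * r ^ d" using r \<theta> \<omega> by (intro mult_left_mono power_mono) auto
      also have "\<dots> = v i0 0 r" unfolding v_def \<open>X i0 0 r = cball c r\<close> using vol r by simp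
      finally show "v i0 0 r \<ge> \<gamma> * T" .
    qed
    have "(\<Sum>i\<in>I. w i 0) \<ge> w i0 0" using I w0 by (intro member_le_sum) auto
    \<comment> \<open>At position 0 the base sheet carries a full ball of the array, so the volume
      terms are negative by about \<open>\<gamma> * T\<close>. As volumes hardly change along the
      row, at every position the array would have to supply about \<open>\<gamma> * T\<close> on
      some of the sheets. Summed over \<open>P\<close> positions this exceeds the volume of the
      array that is available.\<close>
    then have base: "(\<Sum>i\<in>I. \<sigma> i * v i 0 r) \<le> real kI * \<tau> * T - \<gamma> * T"
      using Babs[OF Pp] v00 unfolding B_def by linarith
    \<comment> \<open>The balls of different positions are disjoint and the sheets injective, so
      along the row the array is never counted twice.\<close>
    have wsum: "(\<Sum>k<P. w i k) \<le> K * T" if i: "i \<in> I" for i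
    proof (cases "i \<in> J \<and> \<not> st i")
      case True
      have disjX: "X i k r \<inter> X i k' r = {}" if kk: "k < P" "k' < P" "k \<noteq> k'" for k k'
      proof (rule ccontr)
        assume "X i k r \<inter> X i k' r \<noteq> {}"
        then obtain x x' where x: "x \<in> cball (ck k) r" "x' \<in> cball (ck k') r" "\<xi> i x = \<xi> i x'" unfolding X_def by auto
        have "norm (x - x') \<le> M * norm (\<xi> i x - \<xi> i x')" using low[OF i] x sub[OF kk(1) r(4)] sub[OF kk(2) r(4)] by blast
        then have "x = x'" using x(3) by simp
        then have "dist (ck k) (ck k') \<le> r + r" using x dist_triangle[of "ck k" "ck k'" x] by (simp add: dist_commute)
        moreover have "dist (ck k) (ck k') = \<bar>real k - real k'\<bar> * \<theta>"
          unfolding ck_def dist_norm using e \<theta> by (simp add: abs_mult flip: scaleR_diff_left left_diff_distrib)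
        moreover have "\<bar>real k - real k'\<bar> \<ge> 1" using kk(3) by linarith
        ultimately show False using r \<theta> mult_right_mono[of 1 "\<bar>real k - real k'\<bar>" \<theta>] by linarith
      qed
      have sets: "A \<inter> X i k r \<in> lmeasurable" if "k < P" for k
        using lmX[OF i that r(4)] A(1) by (metis fmeasurable_Int_fmeasurable Int_commute)
      have "(\<Sum>k<P. w i k) = (\<Sum>k<P. measure lebesgue (A \<inter> X i k r))" using True by (simp add: w_def)
      also have "\<dots> = measure lebesgue (\<Union>k<P. A \<inter> X i k r)"
        using sets disjX by (subst measure_UNION_AE[symmetric]) (auto intro!: AE_I2 simp: pairwise_def)
      also have "\<dots> \<le> measure lebesgue (A \<inter> Z i)"
      proof (intro measure_mono_fmeasurable)
        have "X i k r \<subseteq> Z i" if "k < P" for k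
          using inZ[of i k] True that subset_cball[OF r(2), of "ck k"] unfolding X_def ck_def by blast
        then show "(\<Union>k<P. A \<inter> X i k r) \<subseteq> A \<inter> Z i" by blast
        show "(\<Union>k<P. A \<inter> X i k r) \<in> sets lebesgue" using sets by (intro sets.finite_UN) auto
        show "A \<inter> Z i \<in> lmeasurable" using Z True A(1) by (metis fmeasurable_Int_fmeasurable Int_commute)
      qed
      also have "\<dots> \<le> K * T" using Z True unfolding T_def d_def by blast
      finally show ?thesis .
    next
      case False then show ?thesis using K T by (auto simp: w_def)
    qed
    have "(\<Sum>k<P. \<Sum>i\<in>I. w i k) = (\<Sum>i\<in>I. \<Sum>k<P. w i k)" by (rule sum.swap)
    also have "\<dots> \<le> (\<Sum>i\<in>I. K * T)" by (intro sum_mono wsum)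
    finally have wtot: "(\<Sum>k<P. \<Sum>i\<in>I. w i k) \<le> real kI * K * T" using I(2) by simp
    have perk: "- (real kI * \<tau> * T) \<le> (real kI * \<tau> * T - \<gamma> * T) + 3 * (\<Sum>i\<in>I. \<bar>v i k r - v i 0 r\<bar>) + (\<Sum>i\<in>I. w i k)" if k: "k < P" for k
    proof -
      have "(\<Sum>i\<in>I. \<sigma> i * v i k r) = (\<Sum>i\<in>I. \<sigma> i * v i 0 r) + (\<Sum>i\<in>I. \<sigma> i * (v i k r - v i 0 r))"
        unfolding sum.distrib[symmetric] by (simp add: algebra_simps)
      moreover have "(\<Sum>i\<in>I. \<sigma> i * (v i k r - v i 0 r)) \<le> (\<Sum>i\<in>I. 3 * \<bar>v i k r - v i 0 r\<bar>)"
      proof (intro sum_mono)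
        fix i assume "i \<in> I"
        then have "\<bar>\<sigma> i\<bar> \<le> 3" using s[of i] unfolding \<sigma>_def by auto
        have "\<sigma> i * (v i k r - v i 0 r) \<le> \<bar>\<sigma> i\<bar> * \<bar>v i k r - v i 0 r\<bar>" by (metis abs_ge_self abs_mult)
        also have "\<dots> \<le> 3 * \<bar>v i k r - v i 0 r\<bar>" using \<open>\<bar>\<sigma> i\<bar> \<le> 3\<close> by (intro mult_right_mono) auto
        finally show "\<sigma> i * (v i k r - v i 0 r) \<le> 3 * \<bar>v i k r - v i 0 r\<bar>" .
      qed
      moreover have "(\<Sum>i\<in>I. 3 * \<bar>v i k r - v i 0 r\<bar>) = 3 * (\<Sum>i\<in>I. \<bar>v i k r - v i 0 r\<bar>)"
        by (rule sum_distrib_left[symmetric])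
      ultimately show ?thesis using base Babs[OF k, unfolded B_def] by linarith
    qed
    have "(\<Sum>k<P. - (real kI * \<tau> * T)) \<le> (\<Sum>k<P. (real kI * \<tau> * T - \<gamma> * T) + 3 * (\<Sum>i\<in>I. \<bar>v i k r - v i 0 r\<bar>) + (\<Sum>i\<in>I. w i k))"
      by (intro sum_mono perk) auto
    then have "real P * \<gamma> * T \<le> 2 * real P * real kI * \<tau> * T + 3 * Var + real kI * K * T"
    proof -
      assume *: "(\<Sum>k<P. - (real kI * \<tau> * T)) \<le> (\<Sum>k<P. (real kI * \<tau> * T - \<gamma> * T) + 3 * (\<Sum>i\<in>I. \<bar>v i k r - v i 0 r\<bar>) + (\<Sum>i\<in>I. w i k))"
      have "(\<Sum>k<P. (real kI * \<tau> * T - \<gamma> * T) + 3 * (\<Sum>i\<in>I. \<bar>v i k r - v i 0 r\<bar>) + (\<Sum>i\<in>I. w i k))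
        = real P * (real kI * \<tau> * T - \<gamma> * T) + 3 * Var + (\<Sum>k<P. \<Sum>i\<in>I. w i k)"
        unfolding Var_def sum.distrib sum_distrib_left[symmetric] by simp
      moreover have "(\<Sum>k<P. - (real kI * \<tau> * T)) = - (real P * (real kI * \<tau> * T))" by simp
      ultimately show ?thesis using * wtot by (simp add: algebra_simps)
    qed
    moreover have "2 * real P * real kI * \<tau> * T = real P * \<gamma> * T / 4" unfolding \<tau>_def using kI by simp
    moreover have "real kI * K * T \<le> real P * \<gamma> * T / 4"
    proof -
      have "4 * real kI * K / \<gamma> \<le> real P" using P0 P by linarith
      then have "4 * real kI * K \<le> real P * \<gamma>" using \<gamma> by (simp add: pos_divide_le_eq)
      then have "4 * real kI * K * T \<le> real P * \<gamma> * T" using T by (intro mult_right_mono) auto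
      then show ?thesis by simp
    qed
    moreover have "real P * \<gamma> * T > 0" using Pp \<gamma> T by simp
    ultimately show False using Var by linarith
  qed
qed

text \<open>If the mean of vectors has almost the largest squared length allowed for each of them,
  their variance is small. The quantity that is nearly maximised is the sum over all sheets of the
  squared slopes, over all base points and dyadic step lengths; so a single choice serves all sheets
  and every finer step length.\<close>

lemma near_maximal_slopes:
  fixes \<xi> :: "nat \<Rightarrow> 'a::euclidean_space \<Rightarrow> 'a"
  assumes W: "open W" "W \<noteq> {}" "convex W" and I: "finite I" and M: "M \<ge> 0" and e: "norm e = 1"
    and lip: "\<And>i x y. i \<in> I \<Longrightarrow> x \<in> W \<Longrightarrow> y \<in> W \<Longrightarrow> norm (\<xi> i x - \<xi> i y) \<le> M * norm (x - y)"
    and \<kappa>: "\<kappa> > 0"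
  obtains x0 \<rho> j U where "\<rho> > 0"
    "\<And>x t. x \<in> ball x0 \<rho> \<Longrightarrow> 0 \<le> t \<Longrightarrow> t \<le> 1 / 2 ^ j \<Longrightarrow> x + t *\<^sub>R e \<in> W"
    "\<And>x a. x \<in> ball x0 \<rho> \<Longrightarrow> a \<ge> j \<Longrightarrow>
      (\<Sum>l<2 ^ (a - j). \<Sum>i\<in>I. (norm (2 ^ a *\<^sub>R (\<xi> i (x + (real (Suc l) / 2 ^ a) *\<^sub>R e) - \<xi> i (x + (real l / 2 ^ a) *\<^sub>R e)) - U i))\<^sup>2)
        \<le> 2 ^ (a - j) * \<kappa>"
proof -
  define D where "D x a i = 2 ^ a *\<^sub>R (\<xi> i (x + (1 / 2 ^ a) *\<^sub>R e) - \<xi> i x)" for x and a :: nat and i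
  define \<Phi> where "\<Phi> x a = (\<Sum>i\<in>I. (norm (D x a i))\<^sup>2)" for x a
  define R where "R = {\<Phi> x a |x a. x \<in> W \<and> x + (1 / 2 ^ a) *\<^sub>R e \<in> W}"
  have Db: "norm (D x a i) \<le> M" if "x \<in> W" "x + (1 / 2 ^ a) *\<^sub>R e \<in> W" "i \<in> I" for x a i
  proof -
    have "norm (D x a i) = 2 ^ a * norm (\<xi> i (x + (1 / 2 ^ a) *\<^sub>R e) - \<xi> i x)" unfolding D_def by simp
    also have "\<dots> \<le> 2 ^ a * (M * norm ((1 / 2 ^ a) *\<^sub>R e))"
      using lip[OF that(3,2,1)] by (intro mult_left_mono) auto
    also have "\<dots> = M" using e by simp
    finally show ?thesis .
  qed
  have Rb: "bdd_above R"
  proof (rule bdd_aboveI[of _ "\<Sum>i\<in>I. M\<^sup>2"])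
    fix y assume "y \<in> R"
    then obtain x a where xa: "y = \<Phi> x a" "x \<in> W" "x + (1 / 2 ^ a) *\<^sub>R e \<in> W" unfolding R_def by auto
    show "y \<le> (\<Sum>i\<in>I. M\<^sup>2)" unfolding xa(1) \<Phi>_def by (intro sum_mono power_mono Db xa) auto
  qed
  obtain x1 where x1: "x1 \<in> W" using W by auto
  then obtain r1 where r1: "r1 > 0" "ball x1 r1 \<subseteq> W" using W(1) open_contains_ball by blast
  obtain a1 :: nat where a1: "(1/2) ^ a1 < r1" using real_arch_pow_inv[of r1 "1/2"] r1 by auto
  have "x1 + (1 / 2 ^ a1) *\<^sub>R e \<in> ball x1 r1" using a1 e by (simp add: dist_norm power_divide)
  then have Rne: "R \<noteq> {}" unfolding R_def using x1 r1 by blast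
  define \<Lambda> where "\<Lambda> = Sup R"
  have le: "\<Phi> x a \<le> \<Lambda>" if "x \<in> W" "x + (1 / 2 ^ a) *\<^sub>R e \<in> W" for x a
    unfolding \<Lambda>_def by (rule cSup_upper[OF _ Rb]) (use that in \<open>auto simp: R_def\<close>)
  \<comment> \<open>Two losses add up to \<kappa>: \<eta> for missing the supremum, and
    \<open>2 * \<eta> * M\<close> per sheet for moving the base point away from
    \<open>x0\<close>.\<close>
  define \<eta> where "\<eta> = \<kappa> / (1 + 2 * real (card I) * M)"
  have den: "1 + 2 * real (card I) * M > 0" using M by (simp add: add_pos_nonneg)
  have \<eta>: "\<eta> > 0" "\<eta> * (1 + 2 * real (card I) * M) = \<kappa>" unfolding \<eta>_def using \<kappa> den by auto
  obtain y where "y \<in> R" "y > \<Lambda> - \<eta>" unfolding \<Lambda>_def using less_cSup_iff[OF Rne Rb, of "Sup R - \<eta>"] \<eta> by auto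
  then obtain x0 j where x0: "x0 \<in> W" "x0 + (1 / 2 ^ j) *\<^sub>R e \<in> W" "\<Phi> x0 j > \<Lambda> - \<eta>" unfolding R_def by auto
  define U where "U i = D x0 j i" for i
  have Ub: "norm (U i) \<le> M" if "i \<in> I" for i unfolding U_def by (rule Db[OF x0(1,2) that])
  obtain r2 where r2: "r2 > 0" "ball x0 r2 \<subseteq> W" using W(1) x0 open_contains_ball by blast
  obtain r3 where r3: "r3 > 0" "ball (x0 + (1 / 2 ^ j) *\<^sub>R e) r3 \<subseteq> W" using W(1) x0 open_contains_ball by blast
  define \<rho> where "\<rho> = min (min r2 r3) (\<eta> / (2 ^ j * 2 * (M + 1)))"
  have \<rho>: "\<rho> > 0" unfolding \<rho>_def using r2 r3 \<eta> M by simp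
  have inW: "x + t *\<^sub>R e \<in> W" if x: "x \<in> ball x0 \<rho>" and t: "0 \<le> t" "t \<le> 1 / 2 ^ j" for x t
  proof -
    have a: "x \<in> W" using x r2 unfolding \<rho>_def by auto
    have "x + (1 / 2 ^ j) *\<^sub>R e \<in> ball (x0 + (1 / 2 ^ j) *\<^sub>R e) r3" using x unfolding \<rho>_def by (simp add: dist_norm)
    then have b: "x + (1 / 2 ^ j) *\<^sub>R e \<in> W" using r3 by blast
    have "(1 - t * 2 ^ j) *\<^sub>R x + (t * 2 ^ j) *\<^sub>R (x + (1 / 2 ^ j) *\<^sub>R e) \<in> W"
      using t by (intro convexD[OF W(3) a b]) (auto simp: field_simps)
    also have "(1 - t * 2 ^ j) *\<^sub>R x + (t * 2 ^ j) *\<^sub>R (x + (1 / 2 ^ j) *\<^sub>R e) = x + t *\<^sub>R e"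
      by (simp add: algebra_simps)
    finally show ?thesis .
  qed
  have DU: "norm (D x j i - U i) \<le> \<eta>" if x: "x \<in> ball x0 \<rho>" and i: "i \<in> I" for x i
  proof -
    have xW: "x \<in> W" "x + (1 / 2 ^ j) *\<^sub>R e \<in> W" using inW[OF x, of 0] inW[OF x, of "1 / 2 ^ j"] by auto
    have "D x j i - U i = 2 ^ j *\<^sub>R ((\<xi> i (x + (1 / 2 ^ j) *\<^sub>R e) - \<xi> i (x0 + (1 / 2 ^ j) *\<^sub>R e)) - (\<xi> i x - \<xi> i x0))"
      unfolding U_def D_def by (simp add: algebra_simps)
    also have "norm \<dots> \<le> 2 ^ j * (M * norm (x - x0) + M * norm (x - x0))"
      using lip[OF i xW(2) x0(2)] lip[OF i xW(1) x0(1)]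
      by (simp, intro order_trans[OF norm_triangle_ineq4]) auto
    also have "\<dots> \<le> 2 ^ j * ((M + 1) * \<rho> + (M + 1) * \<rho>)"
      using x M by (intro mult_left_mono add_mono mult_mono) (auto simp: dist_norm norm_minus_commute)
    also have "\<dots> \<le> \<eta>"
    proof -
      have "\<rho> \<le> \<eta> / (2 ^ j * 2 * (M + 1))" unfolding \<rho>_def by simp
      then have "\<rho> * (2 ^ j * 2 * (M + 1)) \<le> \<eta>" using M by (subst (asm) pos_le_divide_eq) auto
      then show ?thesis by (simp add: algebra_simps)
    qed
    finally show ?thesis .
  qed
  show thesis
  proof (rule that[OF \<rho> inW])
    fix x and a :: nat assume x: "x \<in> ball x0 \<rho>" and a: "a \<ge> j"
    define n where "n = (2::nat) ^ (a - j)"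
    define f where "f i l = \<xi> i (x + (real l / 2 ^ a) *\<^sub>R e)" for i l
    define \<delta> where "\<delta> i l = 2 ^ a *\<^sub>R (f i (Suc l) - f i l)" for i l
    have "(2::real) ^ a = 2 ^ (a - j) * 2 ^ j" using a by (simp flip: power_add)
    then have nn: "real n / 2 ^ a = 1 / 2 ^ j" unfolding n_def by simp
    have lW: "x + (real l / 2 ^ a) *\<^sub>R e \<in> W" if "l \<le> n" for l
    proof (rule inW[OF x])
      show "real l / 2 ^ a \<le> 1 / 2 ^ j" unfolding nn[symmetric] using that by (intro divide_right_mono) auto
    qed simp
    have sl: "(\<Sum>i\<in>I. (norm (\<delta> i l))\<^sup>2) \<le> \<Lambda>" if "l < n" for l
    proof -
      have eq: "x + (real (Suc l) / 2 ^ a) *\<^sub>R e = (x + (real l / 2 ^ a) *\<^sub>R e) + (1 / 2 ^ a) *\<^sub>R e"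
        by (simp add: add_divide_distrib scaleR_left_distrib)
      have "\<Phi> (x + (real l / 2 ^ a) *\<^sub>R e) a \<le> \<Lambda>"
        using lW[of l] lW[of "Suc l"] that unfolding eq by (intro le) auto
      then show ?thesis unfolding \<Phi>_def D_def \<delta>_def f_def eq by simp
    qed
    \<comment> \<open>The fine increments add up to a single increment of the coarse step, so their
      mean is almost \<open>U i\<close>.\<close>
    have tot: "(\<Sum>l<n. \<delta> i l) = real n *\<^sub>R D x j i" for i
    proof -
      have "(\<Sum>l<n. \<delta> i l) = 2 ^ a *\<^sub>R (f i n - f i 0)"
        unfolding \<delta>_def scaleR_sum_right[symmetric] by (simp add: sum_lessThan_telescope)
      also have "\<dots> = (real n * 2 ^ j) *\<^sub>R (f i n - f i 0)" using nn by (simp add: field_simps)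
      also have "\<dots> = real n *\<^sub>R D x j i" unfolding f_def D_def nn by simp
      finally show ?thesis .
    qed
    have "(\<Sum>l<n. \<Sum>i\<in>I. (norm (\<delta> i l - U i))\<^sup>2) = (\<Sum>l<n. \<Sum>i\<in>I. (norm (\<delta> i l))\<^sup>2 + ((norm (U i))\<^sup>2 - 2 * (\<delta> i l \<bullet> U i)))"
      by (intro sum.cong refl) (simp add: power2_norm_eq_inner inner_simps inner_commute)
    also have "\<dots> = (\<Sum>l<n. \<Sum>i\<in>I. (norm (\<delta> i l))\<^sup>2) + (\<Sum>l<n. \<Sum>i\<in>I. (norm (U i))\<^sup>2 - 2 * (\<delta> i l \<bullet> U i))"
      by (simp add: sum.distrib)
    also have "(\<Sum>l<n. \<Sum>i\<in>I. (norm (U i))\<^sup>2 - 2 * (\<delta> i l \<bullet> U i)) = (\<Sum>i\<in>I. \<Sum>l<n. (norm (U i))\<^sup>2 - 2 * (\<delta> i l \<bullet> U i))"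
      by (rule sum.swap)
    also have "\<dots> = (\<Sum>i\<in>I. real n * (norm (U i))\<^sup>2 - 2 * (real n * (D x j i \<bullet> U i)))"
    proof (intro sum.cong refl)
      fix i
      have "(\<Sum>l<n. \<delta> i l \<bullet> U i) = real n * (D x j i \<bullet> U i)" unfolding inner_sum_left[symmetric] tot by simp
      then show "(\<Sum>l<n. (norm (U i))\<^sup>2 - 2 * (\<delta> i l \<bullet> U i)) = real n * (norm (U i))\<^sup>2 - 2 * (real n * (D x j i \<bullet> U i))"
        by (simp add: sum_subtractf flip: sum_distrib_left)
    qed
    also have "\<dots> \<le> (\<Sum>i\<in>I. real n * (2 * \<eta> * M - (norm (U i))\<^sup>2))"
    proof (intro sum_mono)
      fix i assume i: "i \<in> I"
      have "\<bar>(D x j i - U i) \<bullet> U i\<bar> \<le> \<eta> * M"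
        using DU[OF x i] Ub[OF i] \<eta> M by (intro order_trans[OF Cauchy_Schwarz_ineq2] mult_mono) auto
      then have "(norm (U i))\<^sup>2 - 2 * (D x j i \<bullet> U i) \<le> 2 * \<eta> * M - (norm (U i))\<^sup>2"
        by (simp add: power2_norm_eq_inner inner_simps)
      then have "real n * ((norm (U i))\<^sup>2 - 2 * (D x j i \<bullet> U i)) \<le> real n * (2 * \<eta> * M - (norm (U i))\<^sup>2)"
        by (intro mult_left_mono) auto
      then show "real n * (norm (U i))\<^sup>2 - 2 * (real n * (D x j i \<bullet> U i)) \<le> real n * (2 * \<eta> * M - (norm (U i))\<^sup>2)"
        by (simp add: algebra_simps)
    qed
    also have "(\<Sum>i\<in>I. real n * (2 * \<eta> * M - (norm (U i))\<^sup>2)) = real n * (real (card I) * (2 * \<eta> * M) - \<Phi> x0 j)"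
      unfolding sum_distrib_left[symmetric] sum_subtractf \<Phi>_def U_def by simp
    also have "(\<Sum>l<n. \<Sum>i\<in>I. (norm (\<delta> i l))\<^sup>2) \<le> real n * \<Lambda>"
      using sum_mono[of "{..<n}" "\<lambda>l. \<Sum>i\<in>I. (norm (\<delta> i l))\<^sup>2" "\<lambda>_. \<Lambda>"] sl by simp
    finally have "(\<Sum>l<n. \<Sum>i\<in>I. (norm (\<delta> i l - U i))\<^sup>2) \<le> real n * (\<Lambda> - \<Phi> x0 j + real (card I) * (2 * \<eta> * M))"
      by (simp add: algebra_simps)
    also have "\<dots> \<le> real n * \<kappa>"
      using x0(3) \<eta>(2) by (intro mult_left_mono) (auto simp: algebra_simps)
    finally show "(\<Sum>l<2 ^ (a - j). \<Sum>i\<in>I. (norm (2 ^ a *\<^sub>R (\<xi> i (x + (real (Suc l) / 2 ^ a) *\<^sub>R e) - \<xi> i (x + (real l / 2 ^ a) *\<^sub>R e)) - U i))\<^sup>2)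
        \<le> 2 ^ (a - j) * \<kappa>"
      unfolding \<delta>_def f_def n_def by simp
  qed
qed

section \<open>Sparse periodic arrays of cubes and their volume\<close>

definition period :: "'a \<Rightarrow> nat \<Rightarrow> nat \<Rightarrow> 'a \<Rightarrow> nat" where
  "period e p q b = (if b = e then 2 ^ p else 2 ^ q)"

text \<open>One cube of side 2^-a per period of the grid. The period along \<open>e\<close> is the
  length of a window, of which the cube occupies the first place; in the other directions
  \<open>q\<close> is chosen larger to make the array sparse.\<close>

definition cells :: "'a::euclidean_space \<Rightarrow> nat \<Rightarrow> nat \<Rightarrow> nat \<Rightarrow> 'a set" where
  "cells e a p q = {x. \<forall>b\<in>Basis. int (period e p q b) dvd \<lfloor>2 ^ a * (x \<bullet> b)\<rfloor>}"

lemma borel_cells [measurable]: "cells e a p q \<in> sets borel"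
proof -
  have "(\<lambda>x::'a. \<lfloor>2 ^ a * (x \<bullet> b)\<rfloor>) \<in> measurable borel (count_space UNIV)" for b
    by measurable
  then have "Measurable.pred borel (\<lambda>x::'a. int (period e p q b) dvd \<lfloor>2 ^ a * (x \<bullet> b)\<rfloor>)" for b
    by (rule measurable_compose) simp
  then have "Measurable.pred borel (\<lambda>x::'a. \<forall>b\<in>Basis. int (period e p q b) dvd \<lfloor>2 ^ a * (x \<bullet> b)\<rfloor>)"
    by (intro pred_intros_finite) auto
  then show ?thesis unfolding cells_def by (simp add: pred_def)
qed

text \<open>All the translates fit into the ball of radius \<open>r + R\<close>; so a supply of
  disjoint translates becomes a bound on density.\<close>

lemma measure_disjoint_translates:
  fixes A :: "'a::euclidean_space set"
  assumes J: "finite J" "\<And>u. u \<in> J \<Longrightarrow> norm u \<le> R" and A: "A \<in> sets lebesgue" and r: "r \<ge> 0"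
    and disj: "\<And>u v x y. u \<in> J \<Longrightarrow> v \<in> J \<Longrightarrow> x \<in> A \<Longrightarrow> y \<in> A \<Longrightarrow> u + x = v + y \<Longrightarrow> u = v"
    and R: "R \<ge> 0"
  shows "real (card J) * measure lebesgue (A \<inter> cball z r) \<le> unit_ball_vol (DIM('a)) * (r + R) ^ DIM('a)"
proof -
  define B where "B = A \<inter> cball z r"
  have B: "B \<in> lmeasurable" unfolding B_def using A by (metis fmeasurable_Int_fmeasurable Int_commute lmeasurable_cball)
  then have Bu: "(+) u ` B \<in> lmeasurable" for u by (rule measurable_translation)
  have "real (card J) * measure lebesgue B = (\<Sum>u\<in>J. measure lebesgue ((+) u ` B))"
    by (simp add: measure_translation)
  also have "\<dots> = measure lebesgue (\<Union>u\<in>J. (+) u ` B)"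
  proof (rule measure_UNION'[symmetric, OF J(1)])
    show "pairwise (\<lambda>u v. disjnt ((+) u ` B) ((+) v ` B)) J"
      unfolding pairwise_def disjnt_iff
    proof (intro ballI impI allI notI, elim conjE imageE)
      fix u v w x y assume "u \<in> J" "v \<in> J" "u \<noteq> v" "w = u + x" "x \<in> B" "w = v + y" "y \<in> B"
      then show False using disj[of u v x y] unfolding B_def by auto
    qed
  qed (use Bu in auto)
  also have "\<dots> \<le> measure lebesgue (cball z (r + R))"
  proof (rule measure_mono_fmeasurable)
    show "(\<Union>u\<in>J. (+) u ` B) \<subseteq> cball z (r + R)"
    proof (clarify)
      fix u x assume ux: "u \<in> J" "x \<in> B"
      have "dist z (u + x) \<le> dist z x + norm u" using dist_triangle[of z "u + x" x] by (simp add: dist_norm)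
      then show "u + x \<in> cball z (r + R)" using J(2)[OF ux(1)] ux(2) unfolding B_def by simp
    qed
    show "(\<Union>u\<in>J. (+) u ` B) \<in> sets lebesgue" using Bu J(1) by (intro sets.finite_UN) auto
  qed simp
  also have "\<dots> = unit_ball_vol (DIM('a)) * (r + R) ^ DIM('a)" using r R by (simp add: content_cball)
  finally show ?thesis unfolding B_def .
qed

text \<open>Integral shifts of the scaled coordinate pass through the floor, and both floors are
  multiples of the period. So the two shifts agree modulo the period, and both are below it.\<close>

lemma cells_translates_disjoint:
  fixes x y :: "'a::euclidean_space"
  assumes x: "x \<in> cells e a p q" and y: "y \<in> cells e a p q"
    and f: "\<And>b. b \<in> Basis \<Longrightarrow> f b < period e p q b" and g: "\<And>b. b \<in> Basis \<Longrightarrow> g b < period e p q b"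
    and eq: "(\<Sum>b\<in>Basis. (real (f b) / 2 ^ a) *\<^sub>R b) + x = (\<Sum>b\<in>Basis. (real (g b) / 2 ^ a) *\<^sub>R b) + y"
    and b: "b \<in> Basis"
  shows "f b = g b"
proof -
  have "((\<Sum>b\<in>Basis. (real (f b) / 2 ^ a) *\<^sub>R b) + x) \<bullet> b = ((\<Sum>b\<in>Basis. (real (g b) / 2 ^ a) *\<^sub>R b) + y) \<bullet> b"
    by (simp only: eq)
  then have "real (f b) / 2 ^ a + x \<bullet> b = real (g b) / 2 ^ a + y \<bullet> b"
    using b by (simp add: inner_add_left inner_sum_left_Basis)
  then have "real (f b) + 2 ^ a * (x \<bullet> b) = real (g b) + 2 ^ a * (y \<bullet> b)" by (simp add: field_simps)
  then have "\<lfloor>of_int (int (f b)) + 2 ^ a * (x \<bullet> b)\<rfloor> = \<lfloor>of_int (int (g b)) + 2 ^ a * (y \<bullet> b)\<rfloor>" by simp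
  then have "int (f b) + \<lfloor>2 ^ a * (x \<bullet> b)\<rfloor> = int (g b) + \<lfloor>2 ^ a * (y \<bullet> b)\<rfloor>" unfolding floor_add_int by simp
  moreover have "int (period e p q b) dvd \<lfloor>2 ^ a * (x \<bullet> b)\<rfloor>" "int (period e p q b) dvd \<lfloor>2 ^ a * (y \<bullet> b)\<rfloor>"
    using x y b unfolding cells_def by auto
  moreover from calculation(1)
  have "int (f b) - int (g b) = \<lfloor>2 ^ a * (y \<bullet> b)\<rfloor> - \<lfloor>2 ^ a * (x \<bullet> b)\<rfloor>" by linarith
  ultimately have "int (period e p q b) dvd int (f b) - int (g b)" by (simp only: dvd_diff)
  then have "int (f b) mod int (period e p q b) = int (g b) mod int (period e p q b)" by (simp add: mod_eq_dvd_iff)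
  then show ?thesis using f[OF b] g[OF b] by simp
qed

text \<open>Translations in one basis direction other than \<open>e\<close> already give
  \<open>2 ^ q\<close> disjoint copies. This is the bound that makes later levels summable, as
  \<open>q\<close> grows with the level while \<open>p\<close> does not have to.\<close>

lemma measure_cells_le:
  fixes e z :: "'a::euclidean_space"
  assumes d: "DIM('a) \<ge> 2" and r: "2 ^ q / 2 ^ a \<le> r"
  shows "measure lebesgue (cells e a p q \<inter> cball z r) \<le> unit_ball_vol (DIM('a)) * (2 * r) ^ DIM('a) / 2 ^ q"
proof -
  have "\<not> (Basis :: 'a set) \<subseteq> {e}" using d card_mono[of "{e}" "Basis :: 'a set"] by auto
  then obtain b :: 'a where b: "b \<in> Basis" "b \<noteq> e" by blast
  have r0: "r \<ge> 0" using r by (smt (verit) divide_nonneg_nonneg zero_le_power)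
  define J where "J = (\<lambda>n. (real n / 2 ^ a) *\<^sub>R b) ` {..<(2::nat) ^ q}"
  have "inj_on (\<lambda>n. (real n / 2 ^ a) *\<^sub>R b) {..<(2::nat) ^ q}" using b by (auto simp: inj_on_def)
  then have cJ: "card J = 2 ^ q" unfolding J_def by (simp add: card_image)
  have "real (card J) * measure lebesgue (cells e a p q \<inter> cball z r) \<le> unit_ball_vol (DIM('a)) * (r + r) ^ DIM('a)"
  proof (rule measure_disjoint_translates)
    fix u assume "u \<in> J"
    then obtain n :: nat where n: "n < 2 ^ q" "u = (real n / 2 ^ a) *\<^sub>R b" unfolding J_def by auto
    have "norm u = real n / 2 ^ a" using n b by simp
    also have "\<dots> \<le> 2 ^ q / 2 ^ a"
    proof (intro divide_right_mono)
      show "real n \<le> 2 ^ q" using n(1) by (metis less_imp_le of_nat_le_iff of_nat_numeral of_nat_power)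
    qed simp
    finally show "norm u \<le> r" using r by simp
  next
    fix u v x y assume u: "u \<in> J" and v: "v \<in> J" and x: "x \<in> cells e a p q" and y: "y \<in> cells e a p q" and eq: "u + x = v + y"
    obtain n :: nat where n: "n < 2 ^ q" "u = (real n / 2 ^ a) *\<^sub>R b" using u unfolding J_def by auto
    obtain m :: nat where m: "m < 2 ^ q" "v = (real m / 2 ^ a) *\<^sub>R b" using v unfolding J_def by auto
    define f where "f k c = (if c = b then k else (0::nat))" for k c
    have *: "(\<Sum>c\<in>Basis. (real (f k c) / 2 ^ a) *\<^sub>R c) = (real k / 2 ^ a) *\<^sub>R b" for k
    proof -
      have "(\<Sum>c\<in>Basis. (real (f k c) / 2 ^ a) *\<^sub>R c) = (\<Sum>c\<in>Basis. if c = b then (real k / 2 ^ a) *\<^sub>R b else 0)"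
        by (intro sum.cong) (auto simp: f_def)
      then show ?thesis using b by simp
    qed
    have "f n b = f m b"
    proof (rule cells_translates_disjoint[OF x y])
      show "f n c < period e p q c" "f m c < period e p q c" for c using n m b unfolding f_def period_def by auto
      show "(\<Sum>c\<in>Basis. (real (f n c) / 2 ^ a) *\<^sub>R c) + x = (\<Sum>c\<in>Basis. (real (f m c) / 2 ^ a) *\<^sub>R c) + y"
        unfolding * using eq n m by simp
    qed (rule b)
    then show "u = v" using n m unfolding f_def by simp
  qed (use r0 in \<open>auto simp: J_def\<close>)
  then show ?thesis unfolding cJ by (simp add: field_simps)
qed

text \<open>Translations in all directions give density 2^-p per dimension; the second summand is
  the length of these translations. For a radius of about \<open>2 ^ p\<close> cubes the bound is
  comparable to the volume of one cube, whatever \<open>p\<close> is.\<close>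

lemma measure_cells_le':
  fixes e z :: "'a::euclidean_space"
  assumes pq: "p \<le> q" and r: "r \<ge> 0"
  shows "measure lebesgue (cells e a p q \<inter> cball z r) \<le>
    unit_ball_vol (DIM('a)) * (r / 2 ^ p + DIM('a) / 2 ^ a) ^ DIM('a)"
proof -
  define v where "v f = (\<Sum>b\<in>Basis. (real (f b) / 2 ^ a) *\<^sub>R b)" for f :: "'a \<Rightarrow> nat"
  define F where "F = (Basis :: 'a set) \<rightarrow>\<^sub>E {..<(2::nat) ^ p}"
  define J where "J = v ` F"
  have vb: "v f \<bullet> b = real (f b) / 2 ^ a" if "b \<in> Basis" for f b
    using that unfolding v_def by (simp add: inner_sum_left_Basis)
  have finF: "finite F" unfolding F_def by (intro finite_PiE) auto
  have "inj_on v F"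
  proof (rule inj_onI)
    fix f g assume fg: "f \<in> F" "g \<in> F" "v f = v g"
    have "f b = g b" if "b \<in> Basis" for b using vb[OF that, of f] vb[OF that, of g] fg(3) by simp
    then show "f = g" using fg unfolding F_def by (intro PiE_ext) auto
  qed
  then have "card J = card F" unfolding J_def by (simp add: card_image)
  also have "card F = (2 ^ p) ^ DIM('a)" unfolding F_def by (simp add: card_PiE)
  finally have cJ: "real (card J) = (2 ^ p) ^ DIM('a)" by simp
  have per: "(2::nat) ^ p \<le> period e p q b" for b using pq unfolding period_def by (simp add: power_increasing)
  have "real (card J) * measure lebesgue (cells e a p q \<inter> cball z r) \<le> unit_ball_vol (DIM('a)) * (r + real DIM('a) * (2 ^ p / 2 ^ a)) ^ DIM('a)"
  proof (rule measure_disjoint_translates)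
    fix u assume "u \<in> J"
    then obtain f where f: "f \<in> F" "u = v f" unfolding J_def by auto
    have "norm u \<le> (\<Sum>b\<in>Basis. norm ((real (f b) / 2 ^ a) *\<^sub>R (b::'a)))" unfolding f v_def by (rule norm_sum)
    also have "\<dots> \<le> (\<Sum>b\<in>(Basis::'a set). 2 ^ p / 2 ^ a)"
    proof (intro sum_mono)
      fix b :: 'a assume b: "b \<in> Basis"
      have "f b < 2 ^ p" using f b unfolding F_def by auto
      then have "real (f b) \<le> 2 ^ p" by (metis less_imp_le of_nat_le_iff of_nat_numeral of_nat_power)
      then show "norm ((real (f b) / 2 ^ a) *\<^sub>R b) \<le> 2 ^ p / 2 ^ a" using b by (simp add: divide_right_mono)
    qed
    finally show "norm u \<le> real DIM('a) * (2 ^ p / 2 ^ a)" by simp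
  next
    fix u w x y assume u: "u \<in> J" and w: "w \<in> J" and x: "x \<in> cells e a p q" and y: "y \<in> cells e a p q" and eq: "u + x = w + y"
    obtain f where f: "f \<in> F" "u = v f" using u unfolding J_def by auto
    obtain g where g: "g \<in> F" "w = v g" using w unfolding J_def by auto
    have "f b = g b" if b: "b \<in> Basis" for b
    proof (rule cells_translates_disjoint[OF x y _ _ _ b])
      show "f c < period e p q c" if "c \<in> Basis" for c
        using f(1) that per[of c] unfolding F_def by (meson PiE_mem lessThan_iff less_le_trans)
      show "g c < period e p q c" if "c \<in> Basis" for c
        using g(1) that per[of c] unfolding F_def by (meson PiE_mem lessThan_iff less_le_trans)
    qed (use eq f g in \<open>simp add: v_def\<close>)
    then show "u = w" using f g unfolding v_def by simp
  qed (use r finF in \<open>auto simp: J_def intro!: mult_nonneg_nonneg divide_nonneg_nonneg\<close>)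
  then have "(2 ^ p) ^ DIM('a) * measure lebesgue (cells e a p q \<inter> cball z r) \<le> unit_ball_vol (DIM('a)) * (r + real DIM('a) * (2 ^ p / 2 ^ a)) ^ DIM('a)"
    unfolding cJ .
  also have "r + real DIM('a) * (2 ^ p / 2 ^ a) = 2 ^ p * (r / 2 ^ p + DIM('a) / 2 ^ a)" by (simp add: field_simps)
  finally have "(2 ^ p) ^ DIM('a) * measure lebesgue (cells e a p q \<inter> cball z r) \<le>
      (2 ^ p) ^ DIM('a) * (unit_ball_vol (DIM('a)) * (r / 2 ^ p + DIM('a) / 2 ^ a) ^ DIM('a))"
    by (simp add: power_mult_distrib mult.left_commute)
  then show ?thesis by (simp add: mult_le_cancel_left_pos)
qed

text \<open>Unlike \<open>infdist y F \<le> r\<close>, this is empty when \<open>F\<close> is.\<close>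

definition near :: "'a::metric_space set \<Rightarrow> real \<Rightarrow> 'a set" where
  "near F r = {y. \<exists>w\<in>F. dist y w \<le> r}"

lemma near_mono: "r \<le> r' \<Longrightarrow> near F r \<subseteq> near F r'"
  unfolding near_def by force

lemma closed_near:
  fixes F :: "'a::euclidean_space set"
  assumes "closed F"
  shows "closed (near F r)"
proof -
  have "near F r = (\<Union>x\<in>cball 0 r. \<Union>y\<in>F. {x + y})"
  proof (intro equalityI subsetI)
    fix y assume "y \<in> near F r"
    then obtain w where "w \<in> F" "dist y w \<le> r" unfolding near_def by auto
    then show "y \<in> (\<Union>x\<in>cball 0 r. \<Union>y\<in>F. {x + y})"
      by (intro UN_I[of "y - w"] UN_I[of w]) (auto simp: dist_norm norm_minus_commute)
  next
    fix y assume "y \<in> (\<Union>x\<in>cball 0 r. \<Union>y\<in>F. {x + y})"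
    then obtain x w where "norm x \<le> r" "w \<in> F" "y = x + w" by auto
    then show "y \<in> near F r" unfolding near_def by (intro CollectI bexI[of _ w]) (auto simp: dist_norm)
  qed
  then show ?thesis using compact_closed_sums[OF compact_cball assms] by simp
qed

text \<open>A connected set that meets both \<open>T\<close> and its complement meets the
  frontier.\<close>

lemma not_near_frontier:
  fixes T :: "'a::euclidean_space set"
  assumes "c \<notin> near (frontier T) r"
  shows "cball c r \<subseteq> T \<or> cball c r \<inter> T = {}"
proof (rule ccontr)
  assume "\<not> ?thesis"
  then have "cball c r \<inter> frontier T \<noteq> {}" by (intro connected_Int_frontier) auto
  then show False using assms unfolding near_def by auto
qed

section \<open>Sets built by a sequence of arrays at finer and finer levels\<close>

definition pattern_cells :: "'a::euclidean_space \<Rightarrow> (nat \<Rightarrow> nat) \<Rightarrow> (nat \<Rightarrow> nat) \<Rightarrow> nat \<Rightarrow> 'a set" where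
  "pattern_cells e a p n = cells e (a n) (p n) (n + p n)"

text \<open>The mesh 2^-a of each level obeys two demands. The periods of the following level fit
  into one of its cubes. The neighbourhood of the frontier of \<open>TT n\<close>, as wide as
  \<open>n\<close> transversal periods, is so small that it hurts few windows even though windows
  are counted by balls of about the size of a cube: the factor
  \<open>(2 ^ (n + p n)) ^ DIM('a)\<close> bounds the number of cubes in a window.\<close>

definition pattern_sequence :: "'a::euclidean_space \<Rightarrow> (nat \<Rightarrow> nat) \<Rightarrow> (nat \<Rightarrow> nat) \<Rightarrow> (nat \<Rightarrow> 'a set) \<Rightarrow> 'a set \<Rightarrow> bool" where
  "pattern_sequence e a p TT T \<longleftrightarrow>
     T \<in> sets lebesgue \<and> (\<forall>n. TT n \<in> sets lebesgue) \<and>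
     (\<forall>n. sym_diff T (TT n) \<subseteq> (\<Union>k\<in>{n..}. pattern_cells e a p k)) \<and>
     (\<forall>n. a n + (Suc n + p (Suc n)) \<le> a (Suc n)) \<and> (\<forall>n. n \<le> a n) \<and>
     (\<forall>n. measure lebesgue (near (frontier (TT n)) (real n * 2 ^ (n + p n) / 2 ^ a n) \<inter> cball 0 (real n))
        \<le> 1 / (2 ^ n * (2 ^ (n + p n)) ^ DIM('a)))"

text \<open>Exchanges adding and removing, for regions in which the set fills more than
  half.\<close>

lemma pattern_sequence_compl:
  "pattern_sequence e a p TT T \<Longrightarrow> pattern_sequence e a p (\<lambda>n. - TT n) (- T)"
proof -
  assume pat: "pattern_sequence e a p TT T"
  have c: "- X \<in> sets lebesgue" if "X \<in> sets lebesgue" for X :: "'a set"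
    using sets.compl_sets[OF that] by (simp add: Compl_eq_Diff_UNIV)
  have s: "sym_diff (- T) (- X) = sym_diff T X" for X by blast
  show ?thesis using pat unfolding pattern_sequence_def frontier_complement s by (blast intro: c)
qed

lemma sum_half_power_le:
  assumes "finite K" "K \<subseteq> {n..}"
  shows "(\<Sum>k\<in>K. (1/2::real) ^ k) \<le> 2 * (1/2) ^ n"
proof -
  obtain m where m: "\<And>k. k \<in> K \<Longrightarrow> k < n + m"
  proof -
    have "\<forall>k\<in>K. k < n + Suc (Max K)" using assms(1) by (auto simp: less_Suc_eq_le trans_le_add2)
    then show thesis using that by blast
  qed
  have "(\<Sum>k\<in>K. (1/2::real) ^ k) \<le> (\<Sum>k\<in>{n..<n+m}. (1/2) ^ k)"
    using m assms by (intro sum_mono2) auto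
  also have "\<dots> \<le> 2 * (1/2) ^ n - 2 * (1/2) ^ (n + m)"
    by (induction m) auto
  also have "\<dots> \<le> 2 * (1/2) ^ n" by simp
  finally show ?thesis .
qed

text \<open>One transversal period of any later array fits into a cube of level
  \<open>n\<close>.\<close>

lemma pattern_step_le:
  assumes "pattern_sequence e a p TT T" "n \<le> k"
  shows "(2::real) ^ (Suc k + p (Suc k)) / 2 ^ a (Suc k) \<le> 1 / 2 ^ a n"
proof -
  have inc: "a n + (Suc n + p (Suc n)) \<le> a (Suc n)" for n using assms(1) unfolding pattern_sequence_def by blast
  have mono: "a n \<le> a k" by (rule lift_Suc_mono_le[OF _ assms(2)]) (use inc le_trans le_add1 in blast)
  have "a n + (Suc k + p (Suc k)) \<le> a (Suc k)" using inc[of k] mono by linarith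
  then have "(2::real) ^ (a n + (Suc k + p (Suc k))) \<le> 2 ^ a (Suc k)" by (intro power_increasing) auto
  then show "(2::real) ^ (Suc k + p (Suc k)) / 2 ^ a (Suc k) \<le> 1 / 2 ^ a n"
    by (simp add: power_add field_simps)
qed

text \<open>At radii above its transversal period, the array of level \<open>k\<close> has density
  of order 2^-k; the geometric series bounds everything that happens from level \<open>n\<close>
  on.\<close>

lemma pattern_tail:
  fixes z e :: "'a::euclidean_space"
  assumes pat: "pattern_sequence e a p TT T" and d: "DIM('a) \<ge> 2"
    and r: "\<And>k. k \<ge> n \<Longrightarrow> 2 ^ (k + p k) / 2 ^ a k \<le> r"
  shows "measure lebesgue (sym_diff T (TT n) \<inter> cball z r) \<le> 2 * (unit_ball_vol (DIM('a)) * (2 * r) ^ DIM('a)) / 2 ^ n"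
proof -
  define c where "c = unit_ball_vol (DIM('a)) * (2 * r) ^ DIM('a)"
  have "0 \<le> 2 ^ (n + p n) / (2::real) ^ a n" by simp
  then have r0: "r \<ge> 0" using r[of n] by linarith
  have c: "c \<ge> 0" unfolding c_def using r0 by simp
  have A: "pattern_cells e a p k \<inter> cball z r \<in> lmeasurable" for k
    unfolding pattern_cells_def using borel_cells lmeasurable_cball
    by (metis fmeasurable_Int_fmeasurable Int_commute sets_completionI_sets sets_lborel)
  have one: "measure lebesgue (pattern_cells e a p k \<inter> cball z r) \<le> c * (1/2) ^ k" if "k \<ge> n" for k
  proof -
    have "measure lebesgue (pattern_cells e a p k \<inter> cball z r) \<le> c / 2 ^ (k + p k)"
      unfolding pattern_cells_def c_def by (rule measure_cells_le[OF d r[OF that]])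
    also have "\<dots> \<le> c / 2 ^ k" using c by (intro divide_left_mono power_increasing) auto
    finally show ?thesis by (simp add: power_divide)
  qed
  have fin: "measure lebesgue (\<Union>k\<in>K. pattern_cells e a p k \<inter> cball z r) \<le> 2 * c / 2 ^ n"
    if K: "K \<subseteq> {n..}" "finite K" for K
  proof -
    have "measure lebesgue (\<Union>k\<in>K. pattern_cells e a p k \<inter> cball z r) \<le> (\<Sum>k\<in>K. measure lebesgue (pattern_cells e a p k \<inter> cball z r))"
      using K A by (intro measure_UNION_le) auto
    also have "\<dots> \<le> (\<Sum>k\<in>K. c * (1/2) ^ k)" by (intro sum_mono one) (use K in auto)
    also have "\<dots> = c * (\<Sum>k\<in>K. (1/2) ^ k)" by (simp add: sum_distrib_left)
    also have "\<dots> \<le> c * (2 * (1/2) ^ n)" using c sum_half_power_le[OF K(2,1)] by (intro mult_left_mono) auto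
    finally show ?thesis by (simp add: power_divide mult.commute)
  qed
  have Um: "(\<Union>k\<in>{n..}. pattern_cells e a p k \<inter> cball z r) \<in> lmeasurable"
    by (rule fmeasurable_UN_bound[where B = "2 * c / 2 ^ n"]) (use A fin in auto)
  have "measure lebesgue (sym_diff T (TT n) \<inter> cball z r) \<le> measure lebesgue (\<Union>k\<in>{n..}. pattern_cells e a p k \<inter> cball z r)"
  proof (rule measure_mono_fmeasurable[OF _ _ Um])
    have "sym_diff T (TT n) \<subseteq> (\<Union>k\<in>{n..}. pattern_cells e a p k)" using pat unfolding pattern_sequence_def by blast
    then show "sym_diff T (TT n) \<inter> cball z r \<subseteq> (\<Union>k\<in>{n..}. pattern_cells e a p k \<inter> cball z r)" by blast
    show "sym_diff T (TT n) \<inter> cball z r \<in> sets lebesgue" using pat unfolding pattern_sequence_def by auto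
  qed
  also have "\<dots> \<le> 2 * c / 2 ^ n"
    by (rule measure_UN_bound) (use A fin c in auto)
  finally show ?thesis unfolding c_def by simp
qed

section \<open>Grids of windows\<close>

text \<open>A window is represented by its corner \<open>z\<close>; the window itself is \<open>half_open_box h z\<close>.\<close>

definition windows :: "('a::euclidean_space \<Rightarrow> nat) \<Rightarrow> ('a \<Rightarrow> real) \<Rightarrow> 'a \<Rightarrow> 'a set" where
  "windows cnt h y = (\<lambda>f. \<Sum>b\<in>Basis. (y \<bullet> b + real (f b) * h b) *\<^sub>R b) ` (PiE Basis (\<lambda>b. {..<cnt b}))"

definition half_open_box :: "('a::euclidean_space \<Rightarrow> real) \<Rightarrow> 'a \<Rightarrow> 'a set" where
  "half_open_box h z = {x. \<forall>b\<in>Basis. z \<bullet> b \<le> x \<bullet> b \<and> x \<bullet> b < z \<bullet> b + h b}"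

lemma mem_windows:
  "z \<in> windows cnt h y \<longleftrightarrow> (\<forall>b\<in>Basis. \<exists>k<cnt b. z \<bullet> b = y \<bullet> b + real k * h b)"
proof
  assume "\<forall>b\<in>Basis. \<exists>k<cnt b. z \<bullet> b = y \<bullet> b + real k * h b"
  then obtain f where f: "\<And>b. b \<in> Basis \<Longrightarrow> f b < cnt b" "\<And>b. b \<in> Basis \<Longrightarrow> z \<bullet> b = y \<bullet> b + real (f b) * h b" by metis
  have "z = (\<Sum>b\<in>Basis. (y \<bullet> b + real (restrict f Basis b) * h b) *\<^sub>R b)"
    by (rule euclidean_eqI) (simp add: inner_sum_left_Basis f)
  then show "z \<in> windows cnt h y" unfolding windows_def using f(1)
    by (intro image_eqI[of _ _ "restrict f Basis"]) auto
qed (auto simp: windows_def inner_sum_left_Basis PiE_def Pi_def)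

lemma finite_windows: "finite (windows cnt h y)"
  unfolding windows_def by (intro finite_imageI finite_PiE) auto

lemma borel_half_open_box [measurable]: "half_open_box h z \<in> sets borel"
proof -
  have "Measurable.pred borel (\<lambda>x. \<forall>b\<in>Basis. z \<bullet> b \<le> x \<bullet> b \<and> x \<bullet> b < z \<bullet> b + h b)"
    by (intro pred_intros_finite) auto
  then show ?thesis unfolding half_open_box_def by (simp add: pred_def)
qed

lemma half_open_box_subset_cbox: "half_open_box h z \<subseteq> cbox z (z + (\<Sum>b\<in>Basis. h b *\<^sub>R b))"
  unfolding half_open_box_def by (auto simp: mem_box inner_add_left inner_sum_left_Basis less_imp_le)

lemma lmeasurable_half_open_box: "half_open_box h z \<in> lmeasurable"
  by (rule fmeasurableI2[OF _ half_open_box_subset_cbox]) auto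

lemma measure_half_open_box_le:
  fixes z :: "'a::euclidean_space"
  assumes "\<And>b. b \<in> Basis \<Longrightarrow> 0 \<le> h b" "\<And>b. b \<in> Basis \<Longrightarrow> h b \<le> H"
  shows "measure lebesgue (half_open_box h z) \<le> H ^ DIM('a)"
proof -
  have "measure lebesgue (half_open_box h z) \<le> measure lebesgue (cbox z (z + (\<Sum>b\<in>Basis. h b *\<^sub>R b)))"
    by (rule measure_mono_fmeasurable[OF half_open_box_subset_cbox]) auto
  also have "\<dots> = (\<Prod>b\<in>(Basis::'a set). h b)"
    using assms(1) by (simp add: measure_completion measure_lborel_cbox_eq inner_add_left inner_sum_left_Basis)
  also have "\<dots> \<le> (\<Prod>b\<in>(Basis::'a set). H)" using assms by (intro prod_mono) auto
  finally show ?thesis by simp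
qed

lemma measure_half_open_box_pos:
  fixes z :: "'a::euclidean_space"
  assumes "\<And>b. b \<in> Basis \<Longrightarrow> 0 < h b"
  shows "measure lebesgue (half_open_box h z) > 0"
proof -
  have "(\<Prod>b\<in>(Basis::'a set). h b) = measure lebesgue (box z (z + (\<Sum>b\<in>Basis. h b *\<^sub>R b)))"
    using assms by (simp add: measure_completion measure_lborel_box_eq inner_add_left inner_sum_left_Basis less_imp_le)
  also have "\<dots> \<le> measure lebesgue (half_open_box h z)"
    by (rule measure_mono_fmeasurable[OF _ _ lmeasurable_half_open_box])
       (auto simp: half_open_box_def mem_box inner_add_left inner_sum_left_Basis less_imp_le)
  finally show ?thesis using prod_pos[of "Basis :: 'a set" h, OF assms] by linarith
qed

lemma measure_half_open_box_cong: "measure lebesgue (half_open_box h z) = measure lebesgue (half_open_box h 0)"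
proof -
  have "half_open_box h z = (+) z ` half_open_box h 0"
  proof (intro equalityI subsetI)
    fix x assume "x \<in> half_open_box h z"
    then show "x \<in> (+) z ` half_open_box h 0"
      by (intro image_eqI[of _ _ "x - z"]) (auto simp: half_open_box_def inner_diff_left)
  qed (auto simp: half_open_box_def inner_add_left)
  then show ?thesis by (simp add: measure_translation)
qed

lemma windows_disjoint:
  assumes h: "\<And>b. b \<in> Basis \<Longrightarrow> h b > 0" and z: "z \<in> windows cnt h y" "z' \<in> windows cnt h y" "z \<noteq> z'"
  obtains b where "b \<in> Basis" "\<bar>z \<bullet> b - z' \<bullet> b\<bar> \<ge> h b"
proof -
  obtain b where b: "b \<in> Basis" "z \<bullet> b \<noteq> z' \<bullet> b" using z(3) euclidean_eqI by blast
  obtain k k' :: nat where k: "z \<bullet> b = y \<bullet> b + real k * h b" "z' \<bullet> b = y \<bullet> b + real k' * h b"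
    using z(1,2) b(1) unfolding mem_windows by blast
  then have "k \<noteq> k'" using b(2) by auto
  then have "\<bar>real k - real k'\<bar> \<ge> 1" by linarith
  then have "\<bar>real k - real k'\<bar> * h b \<ge> 1 * h b" using h[OF b(1)] by (intro mult_right_mono) auto
  moreover have "z \<bullet> b - z' \<bullet> b = (real k - real k') * h b" unfolding k by (simp add: algebra_simps)
  ultimately show thesis using that[OF b(1)] h[OF b(1)] by (simp add: abs_mult)
qed

lemma windows_partition:
  assumes h: "\<And>b. b \<in> Basis \<Longrightarrow> h b > 0" and l: "\<And>b. b \<in> Basis \<Longrightarrow> l b = real (cnt b) * h b"
  shows "(\<Union>z\<in>windows cnt h y. half_open_box h z) = half_open_box l y"
    and "pairwise (\<lambda>z z'. disjnt (half_open_box h z) (half_open_box h z')) (windows cnt h y)"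
    and "measure lebesgue (half_open_box l y) = real (card (windows cnt h y)) * measure lebesgue (half_open_box h 0)"
proof -
  show eq: "(\<Union>z\<in>windows cnt h y. half_open_box h z) = half_open_box l y"
  proof (intro equalityI subsetI)
    fix x assume "x \<in> (\<Union>z\<in>windows cnt h y. half_open_box h z)"
    then obtain z where z: "z \<in> windows cnt h y" "x \<in> half_open_box h z" by auto
    have "y \<bullet> b \<le> x \<bullet> b \<and> x \<bullet> b < y \<bullet> b + l b" if b: "b \<in> Basis" for b
    proof -
      obtain k where k: "k < cnt b" "z \<bullet> b = y \<bullet> b + real k * h b" using z(1) b unfolding mem_windows by blast
      have "real (Suc k) * h b \<le> real (cnt b) * h b" using k(1) h[OF b] by (intro mult_right_mono) auto
      then have "real k * h b + h b \<le> l b" unfolding l[OF b] by (simp add: algebra_simps)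
      moreover have "real k * h b \<ge> 0" using h[OF b] by simp
      moreover have "z \<bullet> b \<le> x \<bullet> b" "x \<bullet> b < z \<bullet> b + h b" using z(2) b unfolding half_open_box_def by auto
      ultimately show ?thesis using k(2) by linarith
    qed
    then show "x \<in> half_open_box l y" unfolding half_open_box_def by blast
  next
    fix x assume x: "x \<in> half_open_box l y"
    define k where "k b = nat \<lfloor>(x \<bullet> b - y \<bullet> b) / h b\<rfloor>" for b
    define z where "z = (\<Sum>b\<in>Basis. (y \<bullet> b + real (k b) * h b) *\<^sub>R b)"
    have zb: "z \<bullet> b = y \<bullet> b + real (k b) * h b" if "b \<in> Basis" for b
      unfolding z_def using that by (simp add: inner_sum_left_Basis)
    have kb: "real (k b) * h b \<le> x \<bullet> b - y \<bullet> b" "x \<bullet> b - y \<bullet> b < (real (k b) + 1) * h b" "k b < cnt b" if b: "b \<in> Basis" for b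
    proof -
      have xb: "0 \<le> x \<bullet> b - y \<bullet> b" "x \<bullet> b - y \<bullet> b < real (cnt b) * h b"
        using x b l[OF b] unfolding half_open_box_def by fastforce+
      have q: "(x \<bullet> b - y \<bullet> b) / h b \<ge> 0" using xb(1) h[OF b] by simp
      then have rk: "real (k b) = of_int \<lfloor>(x \<bullet> b - y \<bullet> b) / h b\<rfloor>" unfolding k_def by simp
      have k1: "real (k b) \<le> (x \<bullet> b - y \<bullet> b) / h b" "(x \<bullet> b - y \<bullet> b) / h b < real (k b) + 1" unfolding rk by linarith+
      show "real (k b) * h b \<le> x \<bullet> b - y \<bullet> b" "x \<bullet> b - y \<bullet> b < (real (k b) + 1) * h b"
        using k1 h[OF b] by (simp_all add: field_simps)
      then have "real (k b) * h b < real (cnt b) * h b" using xb(2) by linarith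
      then show "k b < cnt b" using h[OF b] by simp
    qed
    have "z \<in> windows cnt h y" unfolding mem_windows using zb kb(3) by blast
    moreover have "x \<in> half_open_box h z"
      unfolding half_open_box_def
    proof (intro CollectI ballI)
      fix b :: 'a assume b: "b \<in> Basis"
      show "z \<bullet> b \<le> x \<bullet> b \<and> x \<bullet> b < z \<bullet> b + h b"
        using kb(1,2)[OF b] zb[OF b] by (simp add: distrib_right)
    qed
    ultimately show "x \<in> (\<Union>z\<in>windows cnt h y. half_open_box h z)" by blast
  qed
  show disj: "pairwise (\<lambda>z z'. disjnt (half_open_box h z) (half_open_box h z')) (windows cnt h y)"
    unfolding pairwise_def
  proof (intro ballI impI)
    fix z z' assume z: "z \<in> windows cnt h y" "z' \<in> windows cnt h y" "z \<noteq> z'"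
    obtain b where "b \<in> Basis" "\<bar>z \<bullet> b - z' \<bullet> b\<bar> \<ge> h b" using windows_disjoint[OF h z] by blast
    then show "disjnt (half_open_box h z) (half_open_box h z')"
      unfolding disjnt_iff half_open_box_def by force
  qed
  have "measure lebesgue (half_open_box l y) = (\<Sum>z\<in>windows cnt h y. measure lebesgue (half_open_box h z))"
    unfolding eq[symmetric] by (rule measure_UNION'[OF finite_windows lmeasurable_half_open_box disj])
  also have "\<dots> = (\<Sum>z\<in>windows cnt h y. measure lebesgue (half_open_box h 0))"
    by (intro sum.cong refl measure_half_open_box_cong)
  finally show "measure lebesgue (half_open_box l y) = real (card (windows cnt h y)) * measure lebesgue (half_open_box h 0)"
    by simp
qed

text \<open>A discrete Fubini argument: the grid is the product of a cross-section, the windows with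
  \<open>cnt e\<close> replaced by 1, and of lines along \<open>e\<close>. An average bound on every
  line is thus one on the whole grid.\<close>

lemma windows_lines:
  fixes g :: "'a::euclidean_space \<Rightarrow> real"
  assumes e: "e \<in> Basis" and h: "\<And>b. b \<in> Basis \<Longrightarrow> h b > 0" and cnt: "cnt e > 0"
    and line: "\<And>z. z \<in> windows (cnt(e := 1)) h y \<Longrightarrow> (\<Sum>w<cnt e. g (z + (real w * h e) *\<^sub>R e)) \<le> real (cnt e) * B"
  shows "(\<Sum>z\<in>windows cnt h y. g z) \<le> real (card (windows cnt h y)) * B"
proof -
  define W0 where "W0 = windows (cnt(e := 1)) h y"
  have in0: "z \<bullet> e = y \<bullet> e" if "z \<in> W0" for z
    using that e unfolding W0_def mem_windows by fastforce
  have ie: "(z + t *\<^sub>R e) \<bullet> b = z \<bullet> b + (if b = e then t else 0)" if "b \<in> Basis" for z t b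
    using that e by (simp add: inner_add_left inner_Basis)
  have bij: "bij_betw (\<lambda>(z, w). z + (real w * h e) *\<^sub>R e) (W0 \<times> {..<cnt e}) (windows cnt h y)"
    unfolding bij_betw_def
  proof (intro conjI inj_onI)
    fix p p' assume p: "p \<in> W0 \<times> {..<cnt e}" "p' \<in> W0 \<times> {..<cnt e}"
      "(case p of (z, w) \<Rightarrow> z + (real w * h e) *\<^sub>R e) = (case p' of (z, w) \<Rightarrow> z + (real w * h e) *\<^sub>R e)"
    obtain z w z' w' where pp: "p = (z, w)" "p' = (z', w')" by fastforce
    have eq: "z + (real w * h e) *\<^sub>R e = z' + (real w' * h e) *\<^sub>R e" using p(3) pp by simp
    then have "(z + (real w * h e) *\<^sub>R e) \<bullet> e = (z' + (real w' * h e) *\<^sub>R e) \<bullet> e" by simp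
    then have "real w * h e = real w' * h e" using in0[of z] in0[of z'] p pp unfolding ie[OF e] by auto
    then have "w = w'" using h[OF e] by simp
    then show "p = p'" using eq pp by simp
  next
    show "(\<lambda>(z, w). z + (real w * h e) *\<^sub>R e) ` (W0 \<times> {..<cnt e}) = windows cnt h y"
    proof (intro equalityI subsetI)
      fix x assume "x \<in> (\<lambda>(z, w). z + (real w * h e) *\<^sub>R e) ` (W0 \<times> {..<cnt e})"
      then obtain z w where zw: "z \<in> W0" "w < cnt e" "x = z + (real w * h e) *\<^sub>R e" by auto
      show "x \<in> windows cnt h y" unfolding mem_windows
      proof
        fix b :: 'a assume b: "b \<in> Basis"
        show "\<exists>k<cnt b. x \<bullet> b = y \<bullet> b + real k * h b"
        proof (cases "b = e")
          case True
          then show ?thesis using zw in0[OF zw(1)] ie[OF b] by (intro exI[of _ w]) auto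
        next
          case False
          obtain k where "k < (cnt(e := 1)) b" "z \<bullet> b = y \<bullet> b + real k * h b"
            using zw(1) b unfolding W0_def mem_windows by blast
          then show ?thesis using False ie[OF b] unfolding zw(3) by auto
        qed
      qed
    next
      fix x assume x: "x \<in> windows cnt h y"
      then obtain w where w: "w < cnt e" "x \<bullet> e = y \<bullet> e + real w * h e" using e unfolding mem_windows by blast
      define z where "z = x + (- (real w * h e)) *\<^sub>R e"
      have "z \<in> W0" unfolding W0_def mem_windows
      proof
        fix b :: 'a assume b: "b \<in> Basis"
        show "\<exists>k<(cnt(e := 1)) b. z \<bullet> b = y \<bullet> b + real k * h b"
        proof (cases "b = e")
          case True
          then show ?thesis using w ie[OF b, of x "- (real w * h e)"] unfolding z_def by (intro exI[of _ 0]) auto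
        next
          case False
          obtain k where "k < cnt b" "x \<bullet> b = y \<bullet> b + real k * h b" using x b unfolding mem_windows by blast
          then show ?thesis using False ie[OF b, of x "- (real w * h e)"] unfolding z_def by auto
        qed
      qed
      moreover have "x = z + (real w * h e) *\<^sub>R e" unfolding z_def by simp
      ultimately show "x \<in> (\<lambda>(z, w). z + (real w * h e) *\<^sub>R e) ` (W0 \<times> {..<cnt e})" using w(1) by force
    qed
  qed
  have "(\<Sum>z\<in>windows cnt h y. g z) = (\<Sum>p\<in>W0 \<times> {..<cnt e}. g (case p of (z, w) \<Rightarrow> z + (real w * h e) *\<^sub>R e))"
    by (rule sum.reindex_bij_betw[OF bij, symmetric])
  also have "\<dots> = (\<Sum>z\<in>W0. \<Sum>w<cnt e. g (z + (real w * h e) *\<^sub>R e))"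
    by (subst sum.cartesian_product) (auto intro!: sum.cong)
  also have "\<dots> \<le> (\<Sum>z\<in>W0. real (cnt e) * B)" by (intro sum_mono line) (simp add: W0_def)
  also have "\<dots> = real (card (W0 \<times> {..<cnt e})) * B" by (simp add: card_cartesian_product)
  also have "card (W0 \<times> {..<cnt e}) = card (windows cnt h y)" by (rule bij_betw_same_card[OF bij])
  finally show ?thesis .
qed

text \<open>Markov's inequality for counting.\<close>

lemma card_large_le:
  fixes g :: "'b \<Rightarrow> real"
  assumes "finite W" "\<And>z. z \<in> W \<Longrightarrow> g z \<ge> 0" "(\<Sum>z\<in>W. g z) \<le> B"
  shows "real (card {z\<in>W. g z > k}) * k \<le> B"
proof -
  have "real (card {z\<in>W. g z > k}) * k = (\<Sum>z\<in>{z\<in>W. g z > k}. k)" by simp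
  also have "\<dots> \<le> (\<Sum>z\<in>{z\<in>W. g z > k}. g z)" by (intro sum_mono) auto
  also have "\<dots> \<le> (\<Sum>z\<in>W. g z)" using assms by (intro sum_mono2) auto
  finally show ?thesis using assms(3) by simp
qed

lemma sum_blocks:
  fixes f :: "nat \<Rightarrow> 'b::comm_monoid_add"
  shows "(\<Sum>w<c. \<Sum>k<P. f (w * P + k)) = (\<Sum>l<c * P. f l)"
proof (induction c)
  case (Suc c)
  have "(\<Sum>l<n + P. f l) = (\<Sum>l<n. f l) + (\<Sum>k<P. f (n + k))" for n
    by (induction P) (auto simp: add.assoc)
  from this[of "c * P"] show ?case using Suc by (simp add: add.commute)
qed simp

lemma norm_le_sum_coords:
  fixes x :: "'a::euclidean_space"
  assumes "\<And>b. b \<in> Basis \<Longrightarrow> \<bar>x \<bullet> b\<bar> \<le> B"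
  shows "norm x \<le> real DIM('a) * B"
proof -
  have "norm x \<le> (\<Sum>b\<in>Basis. \<bar>x \<bullet> b\<bar>)" by (rule norm_le_l1)
  also have "\<dots> \<le> (\<Sum>b\<in>(Basis::'a set). B)" by (intro sum_mono assms)
  finally show ?thesis by simp
qed

text \<open>Bad windows are counted. At most a tenth have slopes away from \<open>U\<close> at some
  net point, at most a tenth have a corner whose image on some sheet is near the frontier of
  \<open>TT n\<close>, and at most seven tenths have their corner in \<open>TT n\<close>: a half for
  \<open>T\<close> itself, a tenth for later levels and a tenth for windows cut by the frontier. So
  one window remains.\<close>

lemma good_window:
  fixes e x0 y :: "'a::euclidean_space" and \<xi> :: "nat \<Rightarrow> 'a \<Rightarrow> 'a"
  assumes e: "e \<in> Basis" and d: "DIM('a) \<ge> 2" and J: "finite J" and M: "M \<ge> 1"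
    and V: "finite V" "V \<subseteq> cball 0 1"
    and low: "\<And>i x y. i \<in> J \<Longrightarrow> x \<in> W \<Longrightarrow> y \<in> W \<Longrightarrow> norm (x - y) \<le> M * norm (\<xi> i x - \<xi> i y)"
    and bd: "\<And>i x. i \<in> J \<Longrightarrow> x \<in> W \<Longrightarrow> norm (\<xi> i x) \<le> B"
    and \<rho>: "\<rho> > 0"
    and inW: "\<And>x t. x \<in> ball x0 \<rho> \<Longrightarrow> 0 \<le> t \<Longrightarrow> t \<le> 1 / 2 ^ j \<Longrightarrow> x + t *\<^sub>R e \<in> W"
    and slopes: "\<And>x a. x \<in> ball x0 \<rho> \<Longrightarrow> a \<ge> j \<Longrightarrow>
      (\<Sum>l<2 ^ (a - j). \<Sum>i\<in>I. (norm (2 ^ a *\<^sub>R (\<xi> i (x + (real (Suc l) / 2 ^ a) *\<^sub>R e) - \<xi> i (x + (real l / 2 ^ a) *\<^sub>R e)) - U i))\<^sup>2)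
        \<le> 2 ^ (a - j) * \<kappa>"
    and \<kappa>: "\<kappa>1 > 0" "10 * real (card V) * 2 ^ p0 * \<kappa> \<le> \<kappa>1"
    and y: "\<And>b. b \<in> Basis \<Longrightarrow> 2 ^ j0 * (y \<bullet> b) \<in> \<int>" "j \<le> j0" "cball y (DIM('a) / 2 ^ j0) \<subseteq> ball x0 (\<rho> / 2)"
    and N: "N = half_open_box (\<lambda>b. if b = e then 1 / 2 ^ j else 1 / 2 ^ j0) y"
    and pat: "pattern_sequence e a p TT T"
    and inf: "\<exists>\<^sub>\<infinity>n. p n = p0 \<and> Q n"
    and half: "measure lebesgue (T \<inter> N) \<le> measure lebesgue N / 2"
  obtains n z where "n \<ge> n0" "p n = p0" "Q n"
    "\<And>b. b \<in> Basis \<Longrightarrow> \<exists>k::int. 2 ^ a n * (z \<bullet> b) = of_int (int (period e p0 (n + p0) b) * k)"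
    "z \<notin> TT n"
    "\<And>i. i \<in> J \<Longrightarrow> \<xi> i z \<notin> near (frontier (TT n)) (real n * 2 ^ (n + p0) / 2 ^ a n / 2)"
    "\<And>v. v \<in> V \<Longrightarrow> (\<Sum>k<2 ^ p0. \<Sum>i\<in>I. (norm (2 ^ a n *\<^sub>R
       (\<xi> i (z + (1 / 2 / 2 ^ a n) *\<^sub>R (One + v) + (real (Suc k) / 2 ^ a n) *\<^sub>R e)
        - \<xi> i (z + (1 / 2 / 2 ^ a n) *\<^sub>R (One + v) + (real k / 2 ^ a n) *\<^sub>R e)) - U i))\<^sup>2) \<le> \<kappa>1"
    "\<And>x k. norm (x - z) \<le> (DIM('a) + 2) / 2 ^ a n \<Longrightarrow> k \<le> 2 ^ p0 \<Longrightarrow> x + (real k / 2 ^ a n) *\<^sub>R e \<in> W"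
proof -
  define D where "D = DIM('a)"
  define \<omega> where "\<omega> = unit_ball_vol (real D)"
  have \<omega>: "\<omega> > 0" unfolding \<omega>_def by simp
  define \<mu> where "\<mu> = measure lebesgue N"
  have \<mu>: "\<mu> > 0" unfolding \<mu>_def N by (rule measure_half_open_box_pos) auto
  have Nlm: "N \<in> lmeasurable" unfolding N by (rule lmeasurable_half_open_box)
  obtain R0 where R0: "N \<subseteq> cball 0 R0" "R0 \<ge> 1"
  proof -
    have "bounded N" unfolding N using half_open_box_subset_cbox bounded_cbox bounded_subset by blast
    then obtain R where "\<forall>x\<in>N. norm x \<le> R" unfolding bounded_iff by blast
    then have "N \<subseteq> cball 0 (max R 1)" by (auto simp: le_max_iff_disj)
    then show thesis using that[of "max R 1"] by auto
  qed
  \<comment> \<open>In this order: the volume near the frontier, the volume of later levels, the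
    size of a cube compared with the room around the box, and the count of corners with images near
    the frontier.\<close>
  define \<delta> where "\<delta> = min (min (\<mu> / 10) (\<mu> / (10 * (2 * (\<omega> * (2 * R0) ^ D)))))
     (min (\<rho> / (8 * real D + 16)) (\<mu> * \<omega> / (10 * real (card J + 1) * (2 * M) ^ D)))"
  have R0D: "2 * (\<omega> * (2 * R0) ^ D) > 0" using \<omega> R0 by simp
  have cJ: "10 * real (card J + 1) * (2 * M) ^ D > 0" using M by simp
  have \<delta>: "\<delta> > 0" unfolding \<delta>_def using \<mu> \<omega> R0D cJ \<rho> by (simp add: zero_less_divide_iff)
  obtain m1 where m1: "(1/2) ^ m1 < \<delta>" using real_arch_pow_inv[OF \<delta>, of "1/2"] by auto
  \<comment> \<open>Everything of interest lies in the ball of radius \<open>n\<close>, where the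
    frontier condition speaks; \<open>n\<close> periods exceed the diameter of a window; and the
    grid of level \<open>n\<close> refines the one on which \<open>y\<close> lies.\<close>
  obtain m2 :: nat where m2: "R0 + \<bar>B\<bar> + 1 + real j0 + 1 + 2 * real D < real m2" using reals_Archimedean2 by blast
  obtain n where n: "n \<ge> max n0 (max m1 m2)" "p n = p0" "Q n"
    using inf unfolding INFM_nat_le by blast
  have nbig: "R0 + \<bar>B\<bar> + 1 + real j0 + 1 + 2 * real D < real n" using m2 n(1) by (metis less_le_trans max.bounded_iff of_nat_le_iff)
  have "(1/2::real) ^ n \<le> (1/2) ^ m1" using n(1) by (intro power_decreasing) auto
  then have nd: "1 / 2 ^ n < \<delta>" using m1 by (simp add: power_divide)
  define A where "A = a n"
  define q where "q = n + p0"
  have An: "n \<le> A" unfolding A_def using pat unfolding pattern_sequence_def by blast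
  have n1: "n > 0" "real j0 + 1 < real n" using nbig R0(2) by auto
  obtain n' where n': "n = Suc n'" using n1(1) by (cases n) auto
  have "a n' + (Suc n' + p (Suc n')) \<le> a (Suc n')" "n' \<le> a n'" using pat unfolding pattern_sequence_def by blast+
  then have Aq: "j0 + q \<le> A" using n(2) n1(2) unfolding n' A_def q_def by linarith
  have Ap: "j + p0 \<le> A" using Aq y(2) unfolding q_def by linarith
  define \<theta> where "\<theta> = 1 / (2::real) ^ A"
  have \<theta>: "\<theta> > 0" unfolding \<theta>_def by simp
  have "\<theta> \<le> 1 / 2 ^ n" unfolding \<theta>_def using An by (intro divide_left_mono power_increasing) auto
  then have \<theta>\<delta>: "\<theta> < \<delta>" using nd by linarith
  then have "\<theta> < \<rho> / (8 * real D + 16)" unfolding \<delta>_def by linarith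
  then have \<theta>\<rho>: "(4 * real D + 8) * \<theta> < \<rho> / 2" by (subst (asm) pos_less_divide_eq) (auto simp: algebra_simps)
  \<comment> \<open>A window is one full period of the array; \<open>cnt\<close> counts the windows
    in each direction of the box, whose sides are \<open>l\<close>.\<close>
  define h where "h b = real (period e p0 q b) * \<theta>" for b
  define cnt where "cnt b = (if b = e then (2::nat) ^ (A - j - p0) else 2 ^ (A - j0 - q))" for b
  define l where "l b = (if b = e then 1 / 2 ^ j else 1 / (2::real) ^ j0)" for b
  have h: "h b > 0" for b unfolding h_def period_def using \<theta> by simp
  have l: "l b = real (cnt b) * h b" for b
  proof (cases "b = e")
    case True
    have "(2::real) ^ A = 2 ^ (A - j - p0) * 2 ^ p0 * 2 ^ j" using Ap by (simp flip: power_add)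
    then show ?thesis using True unfolding l_def cnt_def h_def \<theta>_def period_def by simp
  next
    case False
    have "(2::real) ^ A = 2 ^ (A - j0 - q) * 2 ^ q * 2 ^ j0" using Aq by (simp flip: power_add)
    then show ?thesis using False unfolding l_def cnt_def h_def \<theta>_def period_def by simp
  qed
  have cnt0: "cnt b > 0" for b unfolding cnt_def by simp
  define \<W> where "\<W> = windows cnt h y"
  have finW: "finite \<W>" unfolding \<W>_def by (rule finite_windows)
  have Nl: "N = half_open_box l y" unfolding N l_def ..
  note part = windows_partition[of h l cnt y, OF h l, folded \<W>_def Nl]
  define vol where "vol = measure lebesgue (half_open_box h (0::'a))"
  have \<mu>vol: "\<mu> = real (card \<W>) * vol" unfolding \<mu>_def vol_def by (rule part(3))
  have vol0: "vol > 0" unfolding vol_def by (rule measure_half_open_box_pos) (rule h)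
  have cW: "card \<W> > 0" using \<mu> \<mu>vol vol0 by (cases "card \<W> = 0") auto
  have hQ: "h b \<le> 2 ^ q * \<theta>" for b
    unfolding h_def period_def q_def using \<theta> by (auto intro!: mult_right_mono power_increasing)
  have hP: "2 ^ p0 * \<theta> \<le> h b" for b
    unfolding h_def period_def q_def using \<theta> by (auto intro!: mult_right_mono power_increasing)
  have volQ: "vol \<le> (2 ^ q * \<theta>) ^ D" unfolding vol_def D_def
    by (rule measure_half_open_box_le) (use h hQ in \<open>auto simp: less_imp_le\<close>)
  have he: "h e = 2 ^ p0 * \<theta>" unfolding h_def period_def by simp
  have cnte: "cnt e * 2 ^ p0 = 2 ^ (A - j)" unfolding cnt_def using Ap by (simp flip: power_add)
  have base: "z \<in> ball x0 (\<rho> / 2)" if zw: "z \<in> windows (cnt(e := 1)) h y" for z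
  proof -
    have "norm (y - z) \<le> real DIM('a) * (1 / 2 ^ j0)"
    proof (rule norm_le_sum_coords)
      fix b :: 'a assume b: "b \<in> Basis"
      obtain k where k: "k < (cnt(e := 1)) b" "z \<bullet> b = y \<bullet> b + real k * h b" using zw b unfolding mem_windows by blast
      have "real k * h b \<le> 1 / 2 ^ j0"
      proof (cases "b = e")
        case False
        have "real k * h b \<le> real (cnt b) * h b" using k(1) False h[of b] by (intro mult_right_mono) auto
        then show ?thesis using l[of b] False unfolding l_def by simp
      qed (use k in simp)
      moreover have "real k * h b \<ge> 0" using h[of b] by simp
      ultimately show "\<bar>(y - z) \<bullet> b\<bar> \<le> 1 / 2 ^ j0" using k(2) by (simp add: inner_diff_left)
    qed
    then have "z \<in> cball y (DIM('a) / 2 ^ j0)" by (simp add: dist_norm)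
    then show ?thesis using y(3) by blast
  qed
  have split: "\<exists>z' w. z' \<in> windows (cnt(e := 1)) h y \<and> w < cnt e \<and> z = z' + (real w * h e) *\<^sub>R e" if zw: "z \<in> \<W>" for z
  proof -
    obtain w where w: "w < cnt e" "z \<bullet> e = y \<bullet> e + real w * h e" using zw e unfolding \<W>_def mem_windows by blast
    have "z - (real w * h e) *\<^sub>R e \<in> windows (cnt(e := 1)) h y" unfolding mem_windows
    proof
      fix b :: 'a assume b: "b \<in> Basis"
      show "\<exists>k<(cnt(e := 1)) b. (z - (real w * h e) *\<^sub>R e) \<bullet> b = y \<bullet> b + real k * h b"
      proof (cases "b = e")
        case True
        then show ?thesis using w e by (auto simp: inner_diff_left)
      next
        case False
        obtain k where "k < cnt b" "z \<bullet> b = y \<bullet> b + real k * h b" using zw b unfolding \<W>_def mem_windows by blast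
        then show ?thesis using False e b by (auto simp: inner_diff_left inner_Basis)
      qed
    qed
    then show ?thesis using w(1) by (metis diff_add_cancel)
  qed
  have inside: "x + (real k * \<theta>) *\<^sub>R e \<in> W" if z: "z \<in> \<W>" and x: "norm (x - z) \<le> (real D + 2) * \<theta>" and k: "k \<le> 2 ^ p0" for x z k
  proof -
    obtain z' w where zw: "z' \<in> windows (cnt(e := 1)) h y" "w < cnt e" "z = z' + (real w * h e) *\<^sub>R e" using split[OF z] by blast
    define x' where "x' = x - (real w * h e) *\<^sub>R e"
    have "norm (x' - z') \<le> (real D + 2) * \<theta>" using x unfolding x'_def zw(3) by (simp add: algebra_simps)
    also have "\<dots> \<le> (4 * real D + 8) * \<theta>" using \<theta> by (intro mult_right_mono) auto
    also have "\<dots> < \<rho> / 2" by (rule \<theta>\<rho>)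
    finally have "dist z' x' < \<rho> / 2" by (simp add: dist_norm norm_minus_commute)
    then have x'b: "x' \<in> ball x0 \<rho>" using base[OF zw(1)] dist_triangle[of x0 x' z'] by simp
    have "(real w * h e + real k * \<theta>) = real (w * 2 ^ p0 + k) * \<theta>" unfolding he by (simp add: algebra_simps)
    also have "w * 2 ^ p0 + k \<le> 2 ^ (A - j)"
    proof -
      have "w * 2 ^ p0 + k \<le> (w + 1) * 2 ^ p0" using k by simp
      also have "\<dots> \<le> cnt e * 2 ^ p0" using zw(2) by (intro mult_right_mono) auto
      finally show ?thesis unfolding cnte .
    qed
    then have "real (w * 2 ^ p0 + k) * \<theta> \<le> real (2 ^ (A - j)) * \<theta>" using \<theta> by (intro mult_right_mono) (simp only: of_nat_le_iff, simp)
    also have "\<dots> = 1 / 2 ^ j"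
    proof -
      have "(2::real) ^ A = 2 ^ (A - j) * 2 ^ j" using Ap by (simp flip: power_add)
      then show ?thesis unfolding \<theta>_def by simp
    qed
    finally have t: "real w * h e + real k * \<theta> \<le> 1 / 2 ^ j" .
    have "x' + (real w * h e + real k * \<theta>) *\<^sub>R e \<in> W"
      by (rule inW[OF x'b _ t]) (use h \<theta> in \<open>simp add: less_imp_le\<close>)
    then show ?thesis unfolding x'_def by (simp add: algebra_simps)
  qed
  have WW: "z \<in> W" if "z \<in> \<W>" for z using inside[OF that, of z 0] \<theta> by simp
  define F where "F = frontier (TT n)"
  define r where "r = real n * 2 ^ q / 2 ^ A"
  have r\<theta>: "r = real n * 2 ^ q * \<theta>" unfolding r_def \<theta>_def by simp
  have nearF: "measure lebesgue (near F r \<inter> cball 0 (real n)) \<le> 1 / (2 ^ n * (2 ^ q) ^ D)"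
    using pat n(2) unfolding pattern_sequence_def F_def r_def q_def A_def D_def by blast
  have nearlm: "near F s \<inter> cball 0 (real n) \<in> lmeasurable" for s
    by (intro lmeasurable_compact closed_Int_compact closed_near) (auto simp: F_def)
  have fewnear: "1 / (2 ^ n * (2 ^ q) ^ D) \<le> 1 / (2::real) ^ n"
    by (intro divide_left_mono) (auto simp: mult_le_cancel_left1)

  define gs where "gs v z = (\<Sum>k<2 ^ p0. \<Sum>i\<in>I. (norm (2 ^ A *\<^sub>R
       (\<xi> i (z + (\<theta> / 2) *\<^sub>R (One + v) + (real (Suc k) / 2 ^ A) *\<^sub>R e)
        - \<xi> i (z + (\<theta> / 2) *\<^sub>R (One + v) + (real k / 2 ^ A) *\<^sub>R e)) - U i))\<^sup>2)" for v z
  \<comment> \<open>The slope estimate holds on average along each line through a point near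
    \<open>x0\<close>. A shift by half a cube plus a net vector keeps the base point there.\<close>
  have gs: "(\<Sum>z\<in>\<W>. gs v z) \<le> real (card \<W>) * (2 ^ p0 * \<kappa>)" if v: "v \<in> V" for v
    unfolding \<W>_def
  proof (rule windows_lines[OF e h cnt0])
    fix z assume z: "z \<in> windows (cnt(e := 1)) h y"
    define x where "x = z + (\<theta> / 2) *\<^sub>R (One + v)"
    define f where "f k = (\<Sum>i\<in>I. (norm (2 ^ A *\<^sub>R (\<xi> i (x + (real (Suc k) / 2 ^ A) *\<^sub>R e) - \<xi> i (x + (real k / 2 ^ A) *\<^sub>R e)) - U i))\<^sup>2)" for k
    have "norm (One :: 'a) \<le> real DIM('a) * 1" by (rule norm_le_sum_coords) simp
    then have "norm (One + v) \<le> real D + 1" using v V(2) norm_triangle_ineq[of One v] by (force simp: D_def)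
    then have "norm (x - z) \<le> (\<theta> / 2) * (real D + 1)" unfolding x_def using \<theta> by simp
    also have "\<dots> \<le> (4 * real D + 8) * \<theta>" using \<theta> by (simp add: algebra_simps)
    also have "\<dots> < \<rho> / 2" by (rule \<theta>\<rho>)
    finally have "x \<in> ball x0 \<rho>" using base[OF z] dist_triangle[of x0 x z] by (simp add: dist_norm norm_minus_commute)
    then have sl: "(\<Sum>l<2 ^ (A - j). f l) \<le> 2 ^ (A - j) * \<kappa>" unfolding f_def using Ap by (intro slopes) auto
    have shift: "x + (real w * h e) *\<^sub>R e + (real k / 2 ^ A) *\<^sub>R e = x + (real (w * 2 ^ p0 + k) / 2 ^ A) *\<^sub>R e" for w k
    proof -
      have "real w * h e + real k / 2 ^ A = real (w * 2 ^ p0 + k) / 2 ^ A" unfolding he \<theta>_def by (simp add: add_divide_distrib)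
      then show ?thesis by (simp only: add.assoc scaleR_left_distrib[symmetric])
    qed
    have "gs v (z + (real w * h e) *\<^sub>R e) = (\<Sum>k<2 ^ p0. f (w * 2 ^ p0 + k))" for w
    proof -
      have c: "z + (real w * h e) *\<^sub>R e + (\<theta> / 2) *\<^sub>R (One + v) + (real k / 2 ^ A) *\<^sub>R e = x + (real (w * 2 ^ p0 + k) / 2 ^ A) *\<^sub>R e" for k
      proof -
        have "z + (real w * h e) *\<^sub>R e + (\<theta> / 2) *\<^sub>R (One + v) + (real k / 2 ^ A) *\<^sub>R e = x + (real w * h e) *\<^sub>R e + (real k / 2 ^ A) *\<^sub>R e"
          unfolding x_def by (simp add: algebra_simps)
        then show ?thesis using shift[of w k] by simp
      qed
      show ?thesis unfolding gs_def f_def c by simp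
    qed
    then have "(\<Sum>w<cnt e. gs v (z + (real w * h e) *\<^sub>R e)) = (\<Sum>l<cnt e * 2 ^ p0. f l)" by (simp add: sum_blocks)
    also have "\<dots> \<le> real (2 ^ (A - j)) * \<kappa>" using sl unfolding cnte by simp
    also have "\<dots> = real (cnt e) * (2 ^ p0 * \<kappa>)" unfolding cnte[symmetric] by simp
    finally show "(\<Sum>w<cnt e. gs v (z + (real w * h e) *\<^sub>R e)) \<le> real (cnt e) * (2 ^ p0 * \<kappa>)" .
  qed
  define B1 where "B1 v = {z\<in>\<W>. gs v z > \<kappa>1}" for v
  have b1: "real (card (\<Union>v\<in>V. B1 v)) \<le> real (card \<W>) / 10"
  proof -
    have "real (card (B1 v)) * \<kappa>1 \<le> real (card \<W>) * (2 ^ p0 * \<kappa>)" if "v \<in> V" for v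
      unfolding B1_def by (rule card_large_le[OF finW _ gs[OF that]]) (auto simp: gs_def intro!: sum_nonneg)
    then have "(\<Sum>v\<in>V. real (card (B1 v)) * \<kappa>1) \<le> (\<Sum>v\<in>V. real (card \<W>) * (2 ^ p0 * \<kappa>))" by (intro sum_mono) auto
    then have s: "(\<Sum>v\<in>V. real (card (B1 v))) * \<kappa>1 \<le> real (card V) * (real (card \<W>) * (2 ^ p0 * \<kappa>))"
      by (simp add: sum_distrib_right)
    have "real (card (\<Union>v\<in>V. B1 v)) \<le> (\<Sum>v\<in>V. real (card (B1 v)))"
      using card_UN_le[OF V(1), of B1] by (simp flip: of_nat_sum)
    then have "real (card (\<Union>v\<in>V. B1 v)) * \<kappa>1 \<le> (\<Sum>v\<in>V. real (card (B1 v))) * \<kappa>1" using \<kappa>(1) by (intro mult_right_mono) auto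
    also have "\<dots> \<le> real (card \<W>) * (10 * real (card V) * 2 ^ p0 * \<kappa>) / 10" using s by (simp add: algebra_simps)
    also have "\<dots> \<le> real (card \<W>) * \<kappa>1 / 10" using \<kappa>(2) by (intro divide_right_mono mult_left_mono) auto
    finally show ?thesis using \<kappa>(1) by simp
  qed
  define B2 where "B2 i = {z\<in>\<W>. \<xi> i z \<in> near F (r / 2)}" for i
  have b2: "real (card (B2 i)) \<le> real (card \<W>) / (10 * real (card J + 1))" if i: "i \<in> J" for i
  proof -
    \<comment> \<open>Half the least distance of the images of two corners, so that the balls around
      these images are disjoint.\<close>
    define s where "s = 2 ^ p0 * \<theta> / (2 * M)"
    have s: "s > 0" unfolding s_def using \<theta> M by simp
    have sr: "s \<le> r / 2"
    proof -
      have "s \<le> 2 ^ p0 * \<theta> / 2" unfolding s_def using M \<theta> by (intro divide_left_mono) auto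
      also have "\<dots> \<le> real n * 2 ^ q * \<theta> / 2"
      proof -
        have "(2::real) ^ p0 \<le> 2 ^ q" unfolding q_def by (intro power_increasing) auto
        also have "\<dots> \<le> real n * 2 ^ q" using n1(1) by simp
        finally show ?thesis using \<theta> by (intro divide_right_mono mult_right_mono) auto
      qed
      finally show ?thesis unfolding r\<theta> .
    qed
    have s1: "s \<le> 1"
    proof -
      have "2 ^ p0 * \<theta> \<le> 1" unfolding \<theta>_def using Ap by (simp add: power_increasing)
      then show ?thesis unfolding s_def using M \<theta> by (simp add: divide_le_eq)
    qed
    have "real (card (B2 i)) * (\<omega> * s ^ D) = (\<Sum>z\<in>B2 i. measure lebesgue (ball (\<xi> i z) s))"
      using s by (simp add: content_ball \<omega>_def D_def)
    also have "\<dots> = measure lebesgue (\<Union>z\<in>B2 i. ball (\<xi> i z) s)"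
    proof (rule measure_UNION'[symmetric])
      show "pairwise (\<lambda>z z'. disjnt (ball (\<xi> i z) s) (ball (\<xi> i z') s)) (B2 i)"
        unfolding pairwise_def
      proof (intro ballI impI)
        fix z z' assume z: "z \<in> B2 i" "z' \<in> B2 i" "z \<noteq> z'"
        then have zW: "z \<in> \<W>" "z' \<in> \<W>" unfolding B2_def by auto
        obtain b where b: "b \<in> Basis" "\<bar>z \<bullet> b - z' \<bullet> b\<bar> \<ge> h b" using windows_disjoint[of h, OF h zW[unfolded \<W>_def] z(3)] by blast
        have "2 ^ p0 * \<theta> \<le> \<bar>(z - z') \<bullet> b\<bar>" using b hP[of b] by (simp add: inner_diff_left)
        also have "\<dots> \<le> norm (z - z')" using Basis_le_norm[OF b(1)] .
        also have "\<dots> \<le> M * norm (\<xi> i z - \<xi> i z')" by (rule low[OF i]) (use zW WW in auto)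
        finally have "2 * s \<le> dist (\<xi> i z) (\<xi> i z')" unfolding s_def dist_norm using M by (simp add: field_simps)
        then show "disjnt (ball (\<xi> i z) s) (ball (\<xi> i z') s)"
          using dist_triangle_half_l unfolding disjnt_iff by (metis disjoint_ballI[of s s "\<xi> i z" "\<xi> i z'"] mult_2 disjoint_iff)
      qed
      show "finite (B2 i)" using finW unfolding B2_def by simp
    qed auto
    also have "\<dots> \<le> measure lebesgue (near F r \<inter> cball 0 (real n))"
    proof (rule measure_mono_fmeasurable[OF _ _ nearlm])
      show "(\<Union>z\<in>B2 i. ball (\<xi> i z) s) \<subseteq> near F r \<inter> cball 0 (real n)"
      proof
        fix u assume "u \<in> (\<Union>z\<in>B2 i. ball (\<xi> i z) s)"
        then obtain z where z: "z \<in> B2 i" "dist (\<xi> i z) u < s" by auto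
        obtain w where w: "w \<in> F" "dist (\<xi> i z) w \<le> r / 2" using z(1) unfolding B2_def near_def by blast
        have "dist u w \<le> r" using z(2) w(2) sr dist_triangle[of u w "\<xi> i z"] by (simp add: dist_commute)
        then have "u \<in> near F r" using w(1) unfolding near_def by blast
        moreover have "norm (\<xi> i z) \<le> B" using bd[OF i] WW z(1) unfolding B2_def by blast
        then have "norm u \<le> real n" using z(2) s1 nbig R0(2) norm_triangle_ineq2[of u "\<xi> i z"] by (simp add: dist_norm norm_minus_commute)
        ultimately show "u \<in> near F r \<inter> cball 0 (real n)" by simp
      qed
    qed (use finW in \<open>auto simp: B2_def intro!: sets.finite_UN\<close>)
    also have "\<dots> \<le> 1 / (2 ^ n * (2 ^ q) ^ D)" by (rule nearF)
    finally have le1: "real (card (B2 i)) * (\<omega> * s ^ D) \<le> 1 / (2 ^ n * (2 ^ q) ^ D)" .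
    \<comment> \<open>The balls may be much smaller than a window, by up to \<open>2 ^ q\<close> in
      each direction; the factor \<open>(2 ^ q) ^ D\<close> in the frontier condition pays for
      exactly this.\<close>
    have "\<mu> \<le> real (card \<W>) * (2 ^ q * \<theta>) ^ D" unfolding \<mu>vol using volQ by (intro mult_left_mono) auto
    then have le2: "\<mu> / (2 ^ q) ^ D \<le> real (card \<W>) * \<theta> ^ D" by (simp add: power_mult_distrib field_simps)
    have "(\<theta> / (2 * M)) ^ D \<le> s ^ D" unfolding s_def using \<theta> M by (intro power_mono) (auto simp: field_simps)
    then have "real (card (B2 i)) * (\<omega> * (\<theta> / (2 * M)) ^ D) \<le> 1 / (2 ^ n * (2 ^ q) ^ D)"
      using le1 \<omega> by (meson mult_left_mono of_nat_0_le_iff less_imp_le order_trans)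
    then have "(real (card (B2 i)) * (\<omega> * (\<theta> / (2 * M)) ^ D)) * \<mu> \<le> (1 / 2 ^ n) * (\<mu> / (2 ^ q) ^ D)"
      using \<mu> mult_right_mono[of _ _ \<mu>] by fastforce
    also have "\<dots> \<le> \<delta> * (real (card \<W>) * \<theta> ^ D)" using le2 nd \<delta> \<mu> by (intro mult_mono) auto
    also have "\<dots> \<le> (\<mu> * \<omega> / (10 * real (card J + 1) * (2 * M) ^ D)) * (real (card \<W>) * \<theta> ^ D)"
      using \<theta> by (intro mult_right_mono) (auto simp: \<delta>_def)
    finally have "real (card (B2 i)) * (\<omega> * \<mu> * \<theta> ^ D / (2 * M) ^ D) \<le> (real (card \<W>) / (10 * real (card J + 1))) * (\<omega> * \<mu> * \<theta> ^ D / (2 * M) ^ D)"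
      by (simp add: power_divide algebra_simps)
    moreover have "\<omega> * \<mu> * \<theta> ^ D / (2 * M) ^ D > 0" using \<omega> \<mu> \<theta> M by simp
    ultimately show ?thesis by (simp only: mult_le_cancel_right_pos)
  qed
  have b2': "real (card (\<Union>i\<in>J. B2 i)) \<le> real (card \<W>) / 10"
  proof -
    have "real (card (\<Union>i\<in>J. B2 i)) \<le> (\<Sum>i\<in>J. real (card (B2 i)))"
      using card_UN_le[OF J, of B2] by (simp flip: of_nat_sum)
    also have "\<dots> \<le> (\<Sum>i\<in>J. real (card \<W>) / (10 * real (card J + 1)))" by (intro sum_mono b2)
    also have "\<dots> \<le> real (card \<W>) / 10" by (simp add: field_simps)
    finally show ?thesis .
  qed
  define B3 where "B3 = {z\<in>\<W>. z \<in> TT n}"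
  have b3: "real (card B3) \<le> 7 / 10 * real (card \<W>)"
  proof -
    have lmT: "T \<in> sets lebesgue" "TT n \<in> sets lebesgue" using pat unfolding pattern_sequence_def by auto
    \<comment> \<open>The diameter of a window is at most \<open>r\<close>. So a point of the window
      that is not within \<open>r\<close> of the frontier lies in \<open>TT n\<close> together with
      the corner.\<close>
    have sub: "half_open_box h z \<subseteq> (T \<inter> N) \<union> (sym_diff T (TT n) \<inter> cball 0 R0) \<union> (near F r \<inter> cball 0 (real n))" if z: "z \<in> B3" for z
    proof
      fix x assume x: "x \<in> half_open_box h z"
      have zW: "z \<in> \<W>" "z \<in> TT n" using z unfolding B3_def by auto
      have xN: "x \<in> N" using part(1) zW(1) x by blast
      have "norm (z - x) \<le> real DIM('a) * (2 ^ q * \<theta>)"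
      proof (rule norm_le_sum_coords)
        fix b :: 'a assume b: "b \<in> Basis"
        have "z \<bullet> b \<le> x \<bullet> b" "x \<bullet> b < z \<bullet> b + h b" using x b unfolding half_open_box_def by auto
        then show "\<bar>(z - x) \<bullet> b\<bar> \<le> 2 ^ q * \<theta>" using hQ[of b] by (simp add: inner_diff_left)
      qed
      also have "\<dots> \<le> r" unfolding r\<theta> using nbig R0(2) \<theta> by (auto simp: D_def mult.assoc[symmetric] intro!: mult_right_mono)
      finally have zx: "z \<in> cball x r" by (simp add: dist_norm norm_minus_commute)
      show "x \<in> (T \<inter> N) \<union> (sym_diff T (TT n) \<inter> cball 0 R0) \<union> (near F r \<inter> cball 0 (real n))"
      proof (cases "x \<in> near F r")
        case True
        have "norm x \<le> R0" using xN R0(1) by auto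
        moreover have "real j0 \<ge> 0" "real D \<ge> 0" "\<bar>B\<bar> \<ge> 0" by auto
        ultimately have "norm x \<le> real n" using nbig by linarith
        then show ?thesis using True by simp
      next
        case False
        then have "cball x r \<subseteq> TT n" using not_near_frontier[of x "TT n" r] zx zW(2) unfolding F_def by blast
        then have "x \<in> TT n" using zx by (meson centre_in_cball dist_triangle mem_cball order_trans zero_le_dist subsetD)
        then show ?thesis using xN R0(1) by blast
      qed
    qed
    have m1: "T \<inter> N \<in> lmeasurable" using Nlm lmT by (metis fmeasurable_Int_fmeasurable Int_commute)
    have "sym_diff T (TT n) \<in> sets lebesgue" using lmT by auto
    then have m2: "sym_diff T (TT n) \<inter> cball 0 R0 \<in> lmeasurable" by (metis fmeasurable_Int_fmeasurable Int_commute lmeasurable_cball)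
    have tail: "measure lebesgue (sym_diff T (TT n) \<inter> cball 0 R0) \<le> 2 * (\<omega> * (2 * R0) ^ D) / 2 ^ n"
      unfolding \<omega>_def D_def
    proof (rule pattern_tail[OF pat d])
      fix k assume k: "k \<ge> n"
      then obtain k' where k': "k = Suc k'" using n1(1) by (cases k) auto
      have "2 ^ (k + p k) / (2::real) ^ a k \<le> 1 / 2 ^ a 0" unfolding k' by (rule pattern_step_le[OF pat]) simp
      also have "\<dots> \<le> 1" by simp
      finally show "2 ^ (k + p k) / 2 ^ a k \<le> R0" using R0(2) by linarith
    qed
    have "2 * (\<omega> * (2 * R0) ^ D) / 2 ^ n = 2 * (\<omega> * (2 * R0) ^ D) * (1 / 2 ^ n)" by simp
    also have "\<dots> \<le> 2 * (\<omega> * (2 * R0) ^ D) * (\<mu> / (10 * (2 * (\<omega> * (2 * R0) ^ D))))"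
      using nd R0D unfolding \<delta>_def by (intro mult_left_mono) auto
    also have "\<dots> = \<mu> / 10"
    proof -
      have "c * (\<mu> / (10 * c)) = \<mu> / 10" if "c > 0" for c :: real using that by simp
      from this[OF R0D] show ?thesis .
    qed
    finally have tail': "measure lebesgue (sym_diff T (TT n) \<inter> cball 0 R0) \<le> \<mu> / 10" using tail by linarith
    have near': "measure lebesgue (near F r \<inter> cball 0 (real n)) \<le> \<mu> / 10"
      using nearF fewnear nd unfolding \<delta>_def by linarith
    have "(\<Sum>z\<in>B3. measure lebesgue (half_open_box h z)) = (\<Sum>z\<in>B3. vol)"
      unfolding vol_def by (intro sum.cong refl measure_half_open_box_cong)
    then have "real (card B3) * vol = (\<Sum>z\<in>B3. measure lebesgue (half_open_box h z))" by simp
    also have "\<dots> = measure lebesgue (\<Union>z\<in>B3. half_open_box h z)"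
    proof (rule measure_UNION'[symmetric])
      show "pairwise (\<lambda>z z'. disjnt (half_open_box h z) (half_open_box h z')) B3"
        by (rule pairwise_subset[OF part(2)]) (auto simp: B3_def)
      show "finite B3" using finW unfolding B3_def by simp
    qed (rule lmeasurable_half_open_box)
    also have "\<dots> \<le> measure lebesgue ((T \<inter> N) \<union> (sym_diff T (TT n) \<inter> cball 0 R0) \<union> (near F r \<inter> cball 0 (real n)))"
    proof (rule measure_mono_fmeasurable)
      show "(\<Union>z\<in>B3. half_open_box h z) \<in> sets lebesgue"
        using finW lmeasurable_half_open_box by (intro sets.finite_UN) (auto simp: B3_def fmeasurableD)
    qed (use sub m1 m2 nearlm in \<open>auto intro!: fmeasurable.Un\<close>)
    also have "\<dots> \<le> measure lebesgue (T \<inter> N) + measure lebesgue (sym_diff T (TT n) \<inter> cball 0 R0) + measure lebesgue (near F r \<inter> cball 0 (real n))"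
    proof -
      have s: "T \<inter> N \<in> sets lebesgue" "sym_diff T (TT n) \<inter> cball 0 R0 \<in> sets lebesgue" "near F r \<inter> cball 0 (real n) \<in> sets lebesgue"
        by (rule fmeasurableD[OF m1], rule fmeasurableD[OF m2], rule fmeasurableD[OF nearlm])
      show ?thesis
        using measure_Un_le[OF sets.Un[OF s(1,2)] s(3)] measure_Un_le[OF s(1,2)] by linarith
    qed
    also have "\<dots> \<le> \<mu> / 2 + \<mu> / 10 + \<mu> / 10" using half tail' near' unfolding \<mu>_def by linarith
    also have "\<dots> = (7 / 10 * real (card \<W>)) * vol" unfolding \<mu>vol by simp
    finally show ?thesis using vol0 by (simp only: mult_le_cancel_right_pos)
  qed
  have "\<exists>z\<in>\<W>. z \<notin> (\<Union>v\<in>V. B1 v) \<union> (\<Union>i\<in>J. B2 i) \<union> B3"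
  proof (rule ccontr)
    assume "\<not> ?thesis"
    then have "\<W> \<subseteq> (\<Union>v\<in>V. B1 v) \<union> (\<Union>i\<in>J. B2 i) \<union> B3" by blast
    moreover have "finite ((\<Union>v\<in>V. B1 v) \<union> (\<Union>i\<in>J. B2 i) \<union> B3)"
      by (rule finite_subset[OF _ finW]) (auto simp: B1_def B2_def B3_def)
    ultimately have "card \<W> \<le> card ((\<Union>v\<in>V. B1 v) \<union> (\<Union>i\<in>J. B2 i) \<union> B3)" by (rule card_mono[rotated])
    also have "\<dots> \<le> card (\<Union>v\<in>V. B1 v) + card (\<Union>i\<in>J. B2 i) + card B3"
      by (intro order_trans[OF card_Un_le] add_mono card_Un_le order_refl)
    finally have "real (card \<W>) \<le> real (card (\<Union>v\<in>V. B1 v)) + real (card (\<Union>i\<in>J. B2 i)) + real (card B3)"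
      by (simp flip: of_nat_add)
    then show False using b1 b2' b3 cW by linarith
  qed
  then obtain z where z: "z \<in> \<W>" "\<And>v. v \<in> V \<Longrightarrow> z \<notin> B1 v" "\<And>i. i \<in> J \<Longrightarrow> z \<notin> B2 i" "z \<notin> B3" by blast
  show thesis
  proof (rule that[of n z])
    show "n \<ge> n0" "p n = p0" "Q n" using n by auto
    show "z \<notin> TT n" using z(1,4) unfolding B3_def by blast
    show "\<xi> i z \<notin> near (frontier (TT n)) (real n * 2 ^ (n + p0) / 2 ^ a n / 2)" if "i \<in> J" for i
      using z(1) z(3)[OF that] unfolding B2_def F_def r_def q_def A_def by blast
    show "(\<Sum>k<2 ^ p0. \<Sum>i\<in>I. (norm (2 ^ a n *\<^sub>R
       (\<xi> i (z + (1 / 2 / 2 ^ a n) *\<^sub>R (One + v) + (real (Suc k) / 2 ^ a n) *\<^sub>R e)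
        - \<xi> i (z + (1 / 2 / 2 ^ a n) *\<^sub>R (One + v) + (real k / 2 ^ a n) *\<^sub>R e)) - U i))\<^sup>2) \<le> \<kappa>1" if "v \<in> V" for v
    proof -
      have th: "1 / 2 / 2 ^ a n = \<theta> / 2" unfolding \<theta>_def A_def by simp
      have "gs v z \<le> \<kappa>1" using z(1) z(2)[OF that] unfolding B1_def by auto
      then show ?thesis unfolding gs_def th unfolding A_def .
    qed
    show "x + (real k / 2 ^ a n) *\<^sub>R e \<in> W" if "norm (x - z) \<le> (DIM('a) + 2) / 2 ^ a n" "k \<le> 2 ^ p0" for x k
      using inside[OF z(1), of x k] that unfolding \<theta>_def A_def D_def by (simp add: add.commute)
    show "\<exists>k::int. 2 ^ a n * (z \<bullet> b) = of_int (int (period e p0 (n + p0) b) * k)" if b: "b \<in> Basis" for b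
    proof -
      obtain k where k: "z \<bullet> b = y \<bullet> b + real k * h b" using z(1) b unfolding \<W>_def mem_windows by blast
      obtain u :: int where u: "2 ^ j0 * (y \<bullet> b) = of_int u" using y(1)[OF b] by (auto elim: Ints_cases)
      \<comment> \<open>As \<open>A\<close> exceeds \<open>j0\<close> by at least the exponent of
        the period, the dyadic point \<open>y\<close> is a multiple of the period in units of the
        cube, and so are all corners. The first cube of every window therefore belongs to the
        array.\<close>
      define m where "m = (if b = e then A - j0 - p0 else A - j0 - q)"
      have per: "(2::real) ^ A = real (period e p0 q b) * 2 ^ m * 2 ^ j0"
        using Aq unfolding period_def m_def q_def by (auto simp flip: power_add)
      have "2 ^ A * (z \<bullet> b) = 2 ^ A * (y \<bullet> b) + real k * real (period e p0 q b)"
        unfolding k h_def \<theta>_def by (simp add: field_simps)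
      also have "2 ^ A * (y \<bullet> b) = real (period e p0 q b) * 2 ^ m * of_int u" unfolding per u[symmetric] by simp
      finally have "2 ^ A * (z \<bullet> b) = of_int (int (period e p0 q b) * (2 ^ m * u + int k))"
        by (simp add: algebra_simps)
      then show ?thesis unfolding A_def q_def by blast
    qed
  qed
qed

section \<open>The contradiction for a balanced family of sheets\<close>

lemma measure_Int_sym_diff_le:
  assumes A: "A \<in> sets lebesgue" "B \<in> sets lebesgue" and X: "X \<in> lmeasurable" "X \<subseteq> Z" and Z: "Z \<in> lmeasurable"
  shows "\<bar>measure lebesgue (A \<inter> X) - measure lebesgue (B \<inter> X)\<bar> \<le> measure lebesgue (sym_diff A B \<inter> Z)"
proof -
  have lm: "Y \<inter> X \<in> lmeasurable" if "Y \<in> sets lebesgue" for Y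
    using that X(1) by (metis fmeasurable_Int_fmeasurable Int_commute)
  have sd: "sym_diff A B \<in> sets lebesgue" using A by auto
  then have lz: "sym_diff A B \<inter> Z \<in> lmeasurable" using Z by (metis fmeasurable_Int_fmeasurable Int_commute)
  have "measure lebesgue (Y \<inter> X) \<le> measure lebesgue (Y' \<inter> X) + measure lebesgue (sym_diff A B \<inter> Z)"
    if Y: "Y \<in> sets lebesgue" "Y' \<in> sets lebesgue" "sym_diff Y Y' = sym_diff A B" for Y Y'
  proof -
    have "measure lebesgue (Y \<inter> X) \<le> measure lebesgue ((Y' \<inter> X) \<union> (sym_diff A B \<inter> Z))"
    proof (rule measure_mono_fmeasurable)
      show "Y \<inter> X \<subseteq> Y' \<inter> X \<union> sym_diff A B \<inter> Z" using Y(3) X(2) by blast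
      show "Y \<inter> X \<in> sets lebesgue" using lm[OF Y(1)] by (rule fmeasurableD)
      show "Y' \<inter> X \<union> sym_diff A B \<inter> Z \<in> lmeasurable" using lm[OF Y(2)] lz by (rule fmeasurable.Un)
    qed
    also have "\<dots> \<le> measure lebesgue (Y' \<inter> X) + measure lebesgue (sym_diff A B \<inter> Z)"
      using lm[OF Y(2)] lz by (intro measure_Un_le fmeasurableD)
    finally show ?thesis .
  qed
  from this[OF A refl] this[OF A(2,1) Un_commute] show ?thesis by linarith
qed

text \<open>The quadratic deviation of the steps bounds, by the Cauchy-Schwarz inequality, the total
  deviation, and thus the error of every partial displacement.\<close>

lemma norm_slope_sum_le:
  fixes f :: "nat \<Rightarrow> 'a::real_normed_vector"
  assumes k: "k \<le> P" and sq: "(\<Sum>l<P. (norm (c *\<^sub>R (f (Suc l) - f l) - U))\<^sup>2) \<le> \<kappa>" and c: "c > 0"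
    and \<kappa>: "real P * \<kappa> \<le> \<epsilon>\<^sup>2" and \<epsilon>: "\<epsilon> \<ge> 0"
  shows "norm (f k - f 0 - (real k / c) *\<^sub>R U) \<le> \<epsilon> / c"
proof -
  define t where "t l = norm (c *\<^sub>R (f (Suc l) - f l) - U)" for l
  have "(\<Sum>l<P. t l)\<^sup>2 \<le> (\<Sum>l<P. (t l)\<^sup>2) * real (card {..<P})" by (rule sum_squared_le_sum_of_squares)
  also have "\<dots> \<le> \<kappa> * real P" using sq unfolding t_def by (simp add: mult_right_mono)
  also have "\<dots> \<le> \<epsilon>\<^sup>2" using \<kappa> by (simp add: mult.commute)
  finally have t: "(\<Sum>l<P. t l) \<le> \<epsilon>" using \<epsilon> by (rule power2_le_imp_le)
  have tel: "(\<Sum>l<m. c *\<^sub>R (f (Suc l) - f l) - U) = c *\<^sub>R (f m - f 0) - real m *\<^sub>R U" for m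
    by (induction m) (auto simp: algebra_simps)
  have "c *\<^sub>R (f k - f 0 - (real k / c) *\<^sub>R U) = (\<Sum>l<k. c *\<^sub>R (f (Suc l) - f l) - U)"
    using c unfolding tel by (simp add: scaleR_diff_right)
  then have "c * norm (f k - f 0 - (real k / c) *\<^sub>R U) = norm (\<Sum>l<k. c *\<^sub>R (f (Suc l) - f l) - U)"
    using c by (metis abs_of_pos norm_scaleR)
  also have "\<dots> \<le> (\<Sum>l<k. t l)" unfolding t_def by (rule norm_sum)
  also have "\<dots> \<le> (\<Sum>l<P. t l)" using k by (intro sum_mono2) (auto simp: t_def)
  finally show ?thesis using t c by (simp add: pos_le_divide_eq mult.commute)
qed

text \<open>The box of windows has to start at a dyadic point, so that the windows of all
  sufficiently fine levels are aligned with the arrays.\<close>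

lemma dyadic_corner:
  fixes x0 :: "'a::euclidean_space"
  assumes "\<rho> > 0"
  obtains j0 y where "j \<le> j0" "\<And>b. b \<in> Basis \<Longrightarrow> 2 ^ j0 * (y \<bullet> b) \<in> \<int>" "cball y (DIM('a) / 2 ^ j0) \<subseteq> ball x0 \<rho>"
proof -
  obtain m where m: "(1/2) ^ m < \<rho> / (2 * real DIM('a))" using real_arch_pow_inv[of "\<rho> / (2 * real DIM('a))" "1/2"] assms by auto
  define j0 where "j0 = max j m"
  have "(1/2::real) ^ j0 \<le> (1/2) ^ m" unfolding j0_def by (intro power_decreasing) auto
  then have "1 / 2 ^ j0 < \<rho> / (2 * real DIM('a))" using m by (simp add: power_divide)
  then have small: "2 * (DIM('a) / 2 ^ j0) < \<rho>" by (simp add: pos_less_divide_eq mult.commute)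
  define y where "y = (\<Sum>b\<in>Basis. (of_int \<lfloor>2 ^ j0 * (x0 \<bullet> b)\<rfloor> / 2 ^ j0) *\<^sub>R b)"
  have yb: "y \<bullet> b = of_int \<lfloor>2 ^ j0 * (x0 \<bullet> b)\<rfloor> / 2 ^ j0" if "b \<in> Basis" for b
    unfolding y_def using that by (simp add: inner_sum_left_Basis)
  have "norm (x0 - y) \<le> real DIM('a) * (1 / 2 ^ j0)"
  proof (rule norm_le_sum_coords)
    fix b :: 'a assume b: "b \<in> Basis"
    have "(x0 - y) \<bullet> b = (2 ^ j0 * (x0 \<bullet> b) - of_int \<lfloor>2 ^ j0 * (x0 \<bullet> b)\<rfloor>) / 2 ^ j0"
      using yb[OF b] by (simp add: inner_diff_left field_simps)
    also have "\<bar>\<dots>\<bar> \<le> 1 / 2 ^ j0"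
    proof -
      have "\<bar>2 ^ j0 * (x0 \<bullet> b) - of_int \<lfloor>2 ^ j0 * (x0 \<bullet> b)\<rfloor>\<bar> \<le> 1" by linarith
      then show ?thesis by (simp add: abs_divide divide_right_mono)
    qed
    finally show "\<bar>(x0 - y) \<bullet> b\<bar> \<le> 1 / 2 ^ j0" .
  qed
  then have xy: "dist x0 y \<le> DIM('a) / 2 ^ j0" by (simp add: dist_norm)
  have "cball y (DIM('a) / 2 ^ j0) \<subseteq> ball x0 \<rho>"
  proof
    fix u assume "u \<in> cball y (DIM('a) / 2 ^ j0)"
    then have "dist y u \<le> DIM('a) / 2 ^ j0" by simp
    then show "u \<in> ball x0 \<rho>" using xy small dist_triangle[of x0 u y] unfolding mem_ball by linarith
  qed
  then show thesis using that[of j0 y] yb by (simp add: j0_def)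
qed

lemma cball_subset_cells:
  fixes z :: "'a::euclidean_space"
  assumes "\<And>b. b \<in> Basis \<Longrightarrow> \<exists>k::int. 2 ^ a * (z \<bullet> b) = of_int (int (period e p q b) * k)"
  shows "cball (z + (1 / 2 / 2 ^ a) *\<^sub>R One) (1 / 2 ^ a / 4) \<subseteq> cells e a p q"
proof
  fix x assume x: "x \<in> cball (z + (1 / 2 / 2 ^ a) *\<^sub>R One) (1 / 2 ^ a / 4)"
  show "x \<in> cells e a p q" unfolding cells_def
  proof (intro CollectI ballI)
    fix b :: 'a assume b: "b \<in> Basis"
    obtain k :: int where k: "2 ^ a * (z \<bullet> b) = of_int (int (period e p q b) * k)" using assms[OF b] by blast
    have "\<bar>(x - (z + (1 / 2 / 2 ^ a) *\<^sub>R One)) \<bullet> b\<bar> \<le> 1 / 2 ^ a / 4"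
      using Basis_le_norm[OF b, of "x - (z + (1 / 2 / 2 ^ a) *\<^sub>R One)"] x by (simp add: dist_norm norm_minus_commute)
    then have "\<bar>x \<bullet> b - z \<bullet> b - 1 / 2 / 2 ^ a\<bar> \<le> 1 / 2 ^ a / 4"
      using b by (simp add: inner_diff_left inner_add_left algebra_simps)
    then have "2 ^ a * \<bar>x \<bullet> b - z \<bullet> b - 1 / 2 / 2 ^ a\<bar> \<le> 2 ^ a * (1 / 2 ^ a / 4)" by (intro mult_left_mono) auto
    moreover have "2 ^ a * \<bar>x \<bullet> b - z \<bullet> b - 1 / 2 / 2 ^ a\<bar> = \<bar>2 ^ a * (x \<bullet> b - z \<bullet> b - 1 / 2 / 2 ^ a)\<bar>" by (simp add: abs_mult)
    moreover have "2 ^ a * (x \<bullet> b - z \<bullet> b - 1 / 2 / 2 ^ a) = 2 ^ a * (x \<bullet> b) - 2 ^ a * (z \<bullet> b) - 1 / 2" by (simp add: algebra_simps)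
    ultimately have "\<bar>2 ^ a * (x \<bullet> b) - 2 ^ a * (z \<bullet> b) - 1 / 2\<bar> \<le> 1 / 4" by simp
    then have "\<lfloor>2 ^ a * (x \<bullet> b)\<rfloor> = int (period e p q b) * k" unfolding k by linarith
    then show "int (period e p q b) dvd \<lfloor>2 ^ a * (x \<bullet> b)\<rfloor>" by simp
  qed
qed

text \<open>\<open>J\<close> collects the sheets whose images are weighted by \<open>S\<close>; the
  numbers \<open>s i\<close> account for constant densities and for the side of the balance on which
  a sheet stands. On the base sheet \<open>i0\<close>, which is the identity, the position of the
  array is known. This form covers \<open>S\<close> on either side of the limit map.\<close>

lemma no_balanced_sheets:
  fixes e :: "'a::euclidean_space" and \<xi> :: "nat \<Rightarrow> 'a \<Rightarrow> 'a"
  assumes e: "e \<in> Basis" and d: "DIM('a) \<ge> 2"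
    and W: "open W" "convex W" "W \<noteq> {}" "bounded W"
    and I: "finite I" "J \<subseteq> I" "i0 \<in> J" and M: "M \<ge> 1"
    and up: "\<And>i x y. i \<in> I \<Longrightarrow> x \<in> W \<Longrightarrow> y \<in> W \<Longrightarrow> norm (\<xi> i x - \<xi> i y) \<le> M * norm (x - y)"
    and low: "\<And>i x y. i \<in> I \<Longrightarrow> x \<in> W \<Longrightarrow> y \<in> W \<Longrightarrow> norm (x - y) \<le> M * norm (\<xi> i x - \<xi> i y)"
    and id: "\<And>x. x \<in> W \<Longrightarrow> \<xi> i0 x = x"
    and s: "\<And>i. i \<in> I \<Longrightarrow> \<bar>s i\<bar> \<le> (1::real)"
    and bal: "\<And>F. compact F \<Longrightarrow> F \<subseteq> W \<Longrightarrow>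
      (\<Sum>i\<in>I. s i * measure lebesgue (\<xi> i ` F)) + (\<Sum>i\<in>J. measure lebesgue (S \<inter> \<xi> i ` F)) = 0"
    and pat: "pattern_sequence e a p SS S"
    and add: "\<And>k. \<exists>\<^sub>\<infinity>n. p n = k \<and> SS (Suc n) = SS n \<union> pattern_cells e a p n"
    and rem: "\<And>k. \<exists>\<^sub>\<infinity>n. p n = k \<and> SS (Suc n) = SS n - pattern_cells e a p n"
  shows False
proof -
  define D where "D = DIM('a)"
  define \<omega> where "\<omega> = unit_ball_vol (real D)"
  have \<omega>: "\<omega> > 0" unfolding \<omega>_def by simp
  \<comment> \<open>The volume of the array, in units of a cube, in a ball large enough for the
    image of a window. In the bound of \<open>measure_cells_le'\<close> the length of the window
    cancels against the period.\<close>
  define K where "K = \<omega> * (2 * M + real D) ^ D"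
  have K: "K \<ge> 0" unfolding K_def using \<omega> M by simp
  have kI: "card I > 0" using I card_gt_0_iff by blast
  have e1: "norm e = 1" using e by simp
  show False
  proof (rule window_imbalance[OF M kI K, where ?'a = 'a], goal_cases)
    case (1 \<epsilon> \<tau> P0)
    note \<epsilon> = 1(1) and \<tau> = 1(2) and imb = 1(3)
    \<comment> \<open>\<open>2 ^ P0\<close> is at least \<open>P0\<close>; the number of cubes has
      to be a power of two, being a period.\<close>
    define p0 where "p0 = P0"
    define P where "P = (2::nat) ^ p0"
    have P: "P \<ge> P0" unfolding P_def p0_def by (simp add: less_imp_le)
    have P1: "real P \<ge> 1" unfolding P_def by simp
    \<comment> \<open>By the Cauchy-Schwarz inequality over \<open>P\<close> steps this costs half
      of \<epsilon>; the net \<open>V\<close> costs another quarter.\<close>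
    define \<kappa>1 where "\<kappa>1 = (\<epsilon> / 2)\<^sup>2 / real P"
    have \<kappa>1: "\<kappa>1 > 0" "real P * \<kappa>1 \<le> (\<epsilon> / 2)\<^sup>2" unfolding \<kappa>1_def using \<epsilon> P1 by auto
    have eM: "\<epsilon> / (4 * M) > 0" using \<epsilon> M by simp
    obtain V :: "'a set" where V: "finite V" "V \<subseteq> cball 0 1" "cball 0 1 \<subseteq> (\<Union>v\<in>V. ball v (\<epsilon> / (4 * M)))"
    proof -
      have "seq_compact (cball (0::'a) 1)" using compact_cball compact_eq_seq_compact_metric by blast
      from seq_compact_imp_totally_bounded[OF this] show thesis using eM that by blast
    qed
    define \<kappa> where "\<kappa> = \<kappa>1 / (10 * (real (card V) + 1) * 2 ^ p0)"
    have den: "10 * (real (card V) + 1) * 2 ^ p0 > 0" by simp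
    have \<kappa>: "\<kappa> > 0" "10 * (real (card V) + 1) * 2 ^ p0 * \<kappa> = \<kappa>1" unfolding \<kappa>_def using \<kappa>1 den by auto
    have "10 * real (card V) * 2 ^ p0 * \<kappa> \<le> 10 * (real (card V) + 1) * 2 ^ p0 * \<kappa>" using \<kappa>(1) by (intro mult_right_mono) auto
    then have \<kappa>': "10 * real (card V) * 2 ^ p0 * \<kappa> \<le> \<kappa>1" using \<kappa>(2) by linarith
    have M0: "M \<ge> 0" using M by simp
    obtain x0 \<rho> j U where \<rho>: "\<rho> > 0"
      and inW: "\<And>x t. x \<in> ball x0 \<rho> \<Longrightarrow> 0 \<le> t \<Longrightarrow> t \<le> 1 / 2 ^ j \<Longrightarrow> x + t *\<^sub>R e \<in> W"
      and slopes: "\<And>x a. x \<in> ball x0 \<rho> \<Longrightarrow> a \<ge> j \<Longrightarrow>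
        (\<Sum>l<2 ^ (a - j). \<Sum>i\<in>I. (norm (2 ^ a *\<^sub>R (\<xi> i (x + (real (Suc l) / 2 ^ a) *\<^sub>R e) - \<xi> i (x + (real l / 2 ^ a) *\<^sub>R e)) - U i))\<^sup>2)
          \<le> 2 ^ (a - j) * \<kappa>"
    proof (rule near_maximal_slopes[OF W(1,3,2) I(1) M0 e1 _ \<kappa>(1), of \<xi>], goal_cases)
      case (1 i x y)
      show ?case by (rule up[OF 1(2-4)])
    next
      case (2 x0 \<rho> j U)
      show ?case by (rule 2(1)[OF 2(2-4)])
    qed
    obtain j0 y where y: "j \<le> j0" "\<And>b. b \<in> Basis \<Longrightarrow> 2 ^ j0 * (y \<bullet> b) \<in> \<int>" "cball y (DIM('a) / 2 ^ j0) \<subseteq> ball x0 (\<rho> / 2)"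
      using dyadic_corner[of "\<rho> / 2" j x0] \<rho> by auto
    define N where "N = half_open_box (\<lambda>b. if b = e then 1 / 2 ^ j else 1 / 2 ^ j0) y"
    have Nlm: "N \<in> lmeasurable" unfolding N_def by (rule lmeasurable_half_open_box)
    obtain w0 where w0: "w0 \<in> W" using W by auto
    obtain R where R: "\<And>x. x \<in> W \<Longrightarrow> norm x \<le> R" using W(4) unfolding bounded_iff by blast
    define B where "B = (\<Sum>i\<in>I. norm (\<xi> i w0)) + M * (2 * R)"
    have bd: "norm (\<xi> i x) \<le> B" if "i \<in> I" "x \<in> W" for i x
    proof -
      have "norm (\<xi> i x) \<le> norm (\<xi> i w0) + norm (\<xi> i x - \<xi> i w0)" by (rule norm_triangle_sub)
      also have "norm (\<xi> i w0) \<le> (\<Sum>i\<in>I. norm (\<xi> i w0))" using that I by (intro member_le_sum) auto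
      also have "norm (\<xi> i x - \<xi> i w0) \<le> M * (2 * R)"
        using up[OF that w0] R[OF that(2)] R[OF w0] M norm_triangle_ineq4[of x w0]
        by (intro order_trans[OF up[OF that w0]] mult_left_mono) auto
      finally show ?thesis unfolding B_def by simp
    qed
    \<comment> \<open>Stated for a set and weights of its own, since it is applied to
      \<open>S\<close> or to its complement; the bound 2 on the weights leaves room for the
      latter.\<close>
    have core: False
      if pat: "pattern_sequence e a p TT T"
        and inf: "\<exists>\<^sub>\<infinity>n. p n = p0 \<and> TT (Suc n) = TT n \<union> pattern_cells e a p n"
        and s': "\<And>i. i \<in> I \<Longrightarrow> \<bar>s' i\<bar> \<le> (2::real)"
        and bal': "\<And>F. compact F \<Longrightarrow> F \<subseteq> W \<Longrightarrow>
          (\<Sum>i\<in>I. s' i * measure lebesgue (\<xi> i ` F)) + (\<Sum>i\<in>J. measure lebesgue (T \<inter> \<xi> i ` F)) = 0"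
        and half: "measure lebesgue (T \<inter> N) \<le> measure lebesgue N / 2" for TT T s'
    proof -
      \<comment> \<open>\<open>m1\<close> makes the levels after \<open>n\<close> negligible against
        \<tau>; \<open>m2\<close> makes \<open>n\<close> periods exceed twice the size of the
        regions \<open>Z i\<close> below, measured from the image of the corner.\<close>
      obtain m1 where m1: "(1/2) ^ m1 < \<tau> / (\<omega> * (2 * (M * (real P + 1))) ^ D)"
        using real_arch_pow_inv[of "\<tau> / (\<omega> * (2 * (M * (real P + 1))) ^ D)" "1/2"] \<tau> \<omega> M P1 by auto
      obtain m2 :: nat where m2: "2 * (2 * M + M * real D) < real m2" using reals_Archimedean2 by blast
      have finJ: "finite J" using I finite_subset by blast
      obtain n z where n: "n \<ge> max m1 m2" "p n = p0" "TT (Suc n) = TT n \<union> pattern_cells e a p n"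
        and zper: "\<And>b. b \<in> Basis \<Longrightarrow> \<exists>k::int. 2 ^ a n * (z \<bullet> b) = of_int (int (period e p0 (n + p0) b) * k)"
        and zT: "z \<notin> TT n"
        and zF: "\<And>i. i \<in> J \<Longrightarrow> \<xi> i z \<notin> near (frontier (TT n)) (real n * 2 ^ (n + p0) / 2 ^ a n / 2)"
        and zS: "\<And>v. v \<in> V \<Longrightarrow> (\<Sum>k<2 ^ p0. \<Sum>i\<in>I. (norm (2 ^ a n *\<^sub>R
           (\<xi> i (z + (1 / 2 / 2 ^ a n) *\<^sub>R (One + v) + (real (Suc k) / 2 ^ a n) *\<^sub>R e)
            - \<xi> i (z + (1 / 2 / 2 ^ a n) *\<^sub>R (One + v) + (real k / 2 ^ a n) *\<^sub>R e)) - U i))\<^sup>2) \<le> \<kappa>1"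
        and zW: "\<And>x k. norm (x - z) \<le> (DIM('a) + 2) / 2 ^ a n \<Longrightarrow> k \<le> 2 ^ p0 \<Longrightarrow> x + (real k / 2 ^ a n) *\<^sub>R e \<in> W"
      proof (rule good_window[OF e d finJ M V(1,2) _ _ \<rho> _ _ \<kappa>1(1) \<kappa>' _ y(1,3) N_def pat inf half, where ?n0.0 = "max m1 m2" and \<xi> = \<xi> and W = W and I = I and U = U and B = B], goal_cases)
        case (1 i x y)
        show ?case by (rule low[OF subsetD[OF I(2) 1(2)] 1(3,4)])
      next
        case (2 i x)
        show ?case by (rule bd[OF subsetD[OF I(2) 2(2)] 2(3)])
      next
        case (3 x t)
        show ?case by (rule inW[OF 3(2-4)])
      next
        case (4 x a)
        show ?case by (rule slopes[OF 4(2,3)])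
      next
        case (5 b)
        show ?case by (rule y(2)[OF 5(2)])
      next
        case (6 n z)
        show ?case by (rule 6(1)[OF 6(2-9)])
      qed
      define \<theta> where "\<theta> = 1 / (2::real) ^ a n"
      have \<theta>: "\<theta> > 0" unfolding \<theta>_def by simp
      have c2: "1 / 2 / 2 ^ a n = \<theta> / 2" "real k / 2 ^ a n = real k * \<theta>" for k unfolding \<theta>_def by auto
      define c where "c = z + (\<theta> / 2) *\<^sub>R One"
      have "norm (One :: 'a) \<le> real DIM('a) * 1" by (rule norm_le_sum_coords) simp
      then have One: "norm (One :: 'a) \<le> real D" by (simp add: D_def)
      have cz: "norm (c - z) \<le> (\<theta> / 2) * real D" unfolding c_def using One \<theta> by simp
      have WW: "x + (real k * \<theta>) *\<^sub>R e \<in> W" if x: "norm (x - c) \<le> \<theta>" and k: "k \<le> P" for x k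
      proof -
        have "norm (x - z) \<le> norm (x - c) + norm (c - z)" using norm_triangle_ineq[of "x - c" "c - z"] by simp
        also have "\<dots> \<le> \<theta> + (\<theta> / 2) * real D" using x cz by linarith
        also have "\<dots> \<le> (real D + 2) * \<theta>" using \<theta> by (simp add: algebra_simps)
        also have "\<dots> = (DIM('a) + 2) / 2 ^ a n" unfolding \<theta>_def D_def by (simp add: add.commute)
        finally show ?thesis using zW[of x k] k unfolding c2(2) P_def by simp
      qed
      have cW: "c \<in> W" using WW[of c 0] \<theta> by simp
      have zW': "z \<in> W" using zW[of z 0] by simp
      \<comment> \<open>Bounds the image of the test balls of the whole window on any sheet,
        measured from the image of the centre of the first cube.\<close>
      define r where "r = M * (real P + 1) * \<theta>"
      have r\<theta>: "r \<ge> \<theta>"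
      proof -
        have "1 * 1 \<le> M * (real P + 1)" using M P1 by (intro mult_mono) auto
        then show ?thesis unfolding r_def using mult_right_mono[of 1 "M * (real P + 1)" \<theta>] \<theta> by simp
      qed
      define Z where "Z i = cball (\<xi> i c) r" for i
      \<comment> \<open>The image of the corner is farther from the frontier of \<open>TT n\<close>
        than any point of \<open>Z i\<close> is from that image. So the older set either contains
        \<open>Z i\<close> or misses it.\<close>
      have Zc: "\<xi> i z \<in> TT n \<Longrightarrow> Z i \<subseteq> TT n" "\<xi> i z \<notin> TT n \<Longrightarrow> Z i \<inter> TT n = {}" if i: "i \<in> J" for i
      proof -
        have iI: "i \<in> I" using i I by blast
        have "norm (\<xi> i c - \<xi> i z) \<le> M * norm (c - z)" by (rule up[OF iI cW zW'])
        also have "\<dots> \<le> M * ((\<theta> / 2) * real D)" using cz M by (intro mult_left_mono) auto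
        finally have dc: "norm (\<xi> i c - \<xi> i z) \<le> M * ((\<theta> / 2) * real D)" .
        have sm: "r + M * (\<theta> * real D) \<le> real n * 2 ^ (n + p0) / 2 ^ a n / 2"
        proof -
          have "real m2 \<le> real n" using n(1) by simp
          then have "real n \<ge> 2 * (2 * M + M * real D)" using m2 by linarith
          then have "real P * (2 * (2 * M + M * real D)) \<le> 2 ^ (n + p0) * real n"
            using M by (intro mult_mono) (auto simp: P_def)
          moreover have "M * (real P + 1) + M * real D \<le> real P * (2 * M + M * real D)"
          proof -
            have "M * 1 \<le> M * real P" "M * real D * 1 \<le> M * real D * real P" using P1 M by (intro mult_left_mono; simp)+
            then show ?thesis by (simp add: algebra_simps)
          qed
          ultimately have "M * (real P + 1) + M * real D \<le> 2 ^ (n + p0) * real n / 2"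
            by (simp add: algebra_simps)
          then have "(M * (real P + 1) + M * real D) * \<theta> \<le> (2 ^ (n + p0) * real n / 2) * \<theta>"
            using \<theta> by (intro mult_right_mono) auto
          moreover have "r + M * (\<theta> * real D) = (M * (real P + 1) + M * real D) * \<theta>"
            unfolding r_def by (simp add: algebra_simps)
          moreover have "real n * 2 ^ (n + p0) / 2 ^ a n / 2 = (2 ^ (n + p0) * real n / 2) * \<theta>"
            by (simp add: \<theta>_def mult.commute)
          ultimately show ?thesis by linarith
        qed
        have "M * ((\<theta> / 2) * real D) \<le> M * (\<theta> * real D)" using M \<theta> by (intro mult_left_mono mult_right_mono) auto
        then have dc': "dist (\<xi> i z) (\<xi> i c) \<le> M * (\<theta> * real D)" using dc by (simp add: dist_norm norm_minus_commute)
        have "Z i \<subseteq> cball (\<xi> i z) (real n * 2 ^ (n + p0) / 2 ^ a n / 2)"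
        proof
          fix u assume "u \<in> Z i"
          then show "u \<in> cball (\<xi> i z) (real n * 2 ^ (n + p0) / 2 ^ a n / 2)"
            using dc' sm dist_triangle[of "\<xi> i z" u "\<xi> i c"] unfolding Z_def by simp
        qed
        moreover have "\<xi> i z \<in> cball (\<xi> i z) (real n * 2 ^ (n + p0) / 2 ^ a n / 2)" by simp
        ultimately show "\<xi> i z \<in> TT n \<Longrightarrow> Z i \<subseteq> TT n" "\<xi> i z \<notin> TT n \<Longrightarrow> Z i \<inter> TT n = {}"
          using not_near_frontier[OF zF[OF i]] by blast+
      qed
      have Zin: "\<xi> i ` cball (c + (real k * \<theta>) *\<^sub>R e) (\<theta>/4) \<subseteq> Z i" if i: "i \<in> J" and k: "k < P" for i k
      proof (rule image_subsetI)
        fix x assume x: "x \<in> cball (c + (real k * \<theta>) *\<^sub>R e) (\<theta>/4)"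
        have nx: "norm (x - (real k * \<theta>) *\<^sub>R e - c) \<le> \<theta> / 4" using x by (simp add: dist_norm norm_minus_commute algebra_simps)
        then have "x - (real k * \<theta>) *\<^sub>R e + (real k * \<theta>) *\<^sub>R e \<in> W" using \<theta> k by (intro WW) auto
        then have xW: "x \<in> W" by simp
        have "norm (c - x) \<le> norm ((real k * \<theta>) *\<^sub>R e) + norm (x - (real k * \<theta>) *\<^sub>R e - c)"
          using norm_triangle_ineq4[of "- ((real k * \<theta>) *\<^sub>R e)" "x - (real k * \<theta>) *\<^sub>R e - c"] by simp
        also have "\<dots> \<le> real k * \<theta> + \<theta> / 4" using nx e1 \<theta> by simp
        also have "\<dots> \<le> (real P + 1) * \<theta>"
        proof -
          have "real k * \<theta> \<le> real P * \<theta>" using k \<theta> by (intro mult_right_mono) auto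
          moreover have "(real P + 1) * \<theta> = real P * \<theta> + \<theta>" by (simp add: algebra_simps)
          ultimately show ?thesis using \<theta> by linarith
        qed
        finally have nc: "norm (c - x) \<le> (real P + 1) * \<theta>" .
        have "norm (\<xi> i c - \<xi> i x) \<le> M * norm (c - x)" using i I by (intro up cW xW) blast
        also have "\<dots> \<le> M * ((real P + 1) * \<theta>)" using nc M by (intro mult_left_mono) auto
        finally show "\<xi> i x \<in> Z i" unfolding Z_def r_def by (simp add: dist_norm mult.assoc)
      qed
      have TTm: "TT (Suc n) \<in> sets lebesgue" "T \<in> sets lebesgue" using pat unfolding pattern_sequence_def by blast+
      \<comment> \<open>Arrays after level \<open>n\<close> have periods at most \<theta>, hence at
        most \<open>r\<close>, so their density bounds apply already in balls of radius
        \<open>r\<close>.\<close>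
      have tail: "measure lebesgue (sym_diff T (TT (Suc n)) \<inter> cball u r) \<le> \<tau> * \<theta> ^ DIM('a)" for u
      proof -
        have "measure lebesgue (sym_diff T (TT (Suc n)) \<inter> cball u r) \<le> 2 * (unit_ball_vol (DIM('a)) * (2 * r) ^ DIM('a)) / 2 ^ Suc n"
        proof (rule pattern_tail[OF pat d])
          fix k assume k: "k \<ge> Suc n"
          then obtain k' where k': "k = Suc k'" "n \<le> k'" by (cases k) auto
          have "2 ^ (k + p k) / (2::real) ^ a k \<le> 1 / 2 ^ a n" unfolding k'(1) by (rule pattern_step_le[OF pat k'(2)])
          then show "2 ^ (k + p k) / 2 ^ a k \<le> r" using r\<theta> unfolding \<theta>_def by linarith
        qed
        also have "\<dots> = (\<omega> * (2 * (M * (real P + 1))) ^ D) * (1/2) ^ n * \<theta> ^ D"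
          unfolding \<omega>_def r_def D_def by (simp add: power_mult_distrib power_divide)
        also have "\<dots> \<le> (\<omega> * (2 * (M * (real P + 1))) ^ D) * (\<tau> / (\<omega> * (2 * (M * (real P + 1))) ^ D)) * \<theta> ^ D"
        proof -
          have "(1/2::real) ^ n \<le> (1/2) ^ m1" using n(1) by (intro power_decreasing) auto
          then have "(1/2) ^ n \<le> \<tau> / (\<omega> * (2 * (M * (real P + 1))) ^ D)" using m1 by linarith
          then show ?thesis using \<omega> M \<theta> by (intro mult_right_mono mult_left_mono) auto
        qed
        also have "\<dots> = \<tau> * \<theta> ^ D"
        proof -
          have "\<omega> * (2 * (M * (real P + 1))) ^ D > 0" using \<omega> M by simp
          moreover have "c * (\<tau> / c) = \<tau>" if "c > 0" for c :: real using that by simp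
          ultimately show ?thesis by (simp only:)
        qed
        finally show ?thesis unfolding D_def .
      qed
      define A where "A = pattern_cells e a p n"
      have Ab: "A \<in> sets lebesgue" unfolding A_def pattern_cells_def using borel_cells by (simp add: sets_completionI_sets)
      define st where "st i \<longleftrightarrow> \<xi> i z \<in> TT n" for i
      show False
      proof (rule imb[where \<theta> = \<theta> and P = P and e = e and I = I and J = J and \<Omega> = W and \<xi> = \<xi> and c = c and s = s' and S = T and U = U and Z = Z and st = st and A = A])
        show "card I = card I" ..
        show "cball (c + (real k * \<theta>) *\<^sub>R e) \<theta> \<subseteq> W" if k: "k < P" for k
        proof
          fix x assume "x \<in> cball (c + (real k * \<theta>) *\<^sub>R e) \<theta>"
          then have "norm (x - (real k * \<theta>) *\<^sub>R e - c) \<le> \<theta>" by (simp add: dist_norm norm_minus_commute algebra_simps)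
          then have "x - (real k * \<theta>) *\<^sub>R e + (real k * \<theta>) *\<^sub>R e \<in> W" using k by (intro WW) auto
          then show "x \<in> W" by simp
        qed
        show "norm (\<xi> i (x + (real k * \<theta>) *\<^sub>R e) - \<xi> i x - (real k * \<theta>) *\<^sub>R U i) \<le> \<epsilon> * \<theta>"
          if i: "i \<in> I" and k: "k < P" and x: "x \<in> cball c (\<theta>/2)" for i k x
        proof -
          \<comment> \<open>Slopes are controlled only on lines through net points. A general point
            of the ball is compared with a nearby one by the Lipschitz bound, at its own place and
            \<open>k\<close> cubes further.\<close>
          define u where "u = (2 / \<theta>) *\<^sub>R (x - c)"
          have xu: "x = c + (\<theta> / 2) *\<^sub>R u" unfolding u_def using \<theta> by simp
          have "norm u = 2 / \<theta> * norm (x - c)" unfolding u_def using \<theta> by simp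
          also have "\<dots> \<le> 2 / \<theta> * (\<theta> / 2)" using x \<theta> by (intro mult_left_mono) (auto simp: dist_norm norm_minus_commute)
          finally have "u \<in> cball 0 1" using \<theta> by simp
          then have "u \<in> (\<Union>v\<in>V. ball v (\<epsilon> / (4 * M)))" using V(3) by blast
          then obtain v where v: "v \<in> V" "dist v u < \<epsilon> / (4 * M)" by auto
          define x' where "x' = c + (\<theta> / 2) *\<^sub>R v"
          define f where "f l = \<xi> i (x' + (real l * \<theta>) *\<^sub>R e)" for l
          have vn: "norm v \<le> 1" using v(1) V(2) by auto
          have x'c: "norm (x' - c) \<le> \<theta>" unfolding x'_def using vn \<theta> mult_left_mono[of "norm v" 1 \<theta>] by simp
          have xc: "norm (x - c) \<le> \<theta>" using x \<theta> by (simp add: dist_norm norm_minus_commute)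
          have eq: "z + (1 / 2 / 2 ^ a n) *\<^sub>R (One + v) = x'" unfolding c2 x'_def c_def by (simp add: algebra_simps)
          have "(\<Sum>l<P. (norm (2 ^ a n *\<^sub>R (f (Suc l) - f l) - U i))\<^sup>2) \<le>
            (\<Sum>l<P. \<Sum>i\<in>I. (norm (2 ^ a n *\<^sub>R (\<xi> i (x' + (real (Suc l) * \<theta>) *\<^sub>R e) - \<xi> i (x' + (real l * \<theta>) *\<^sub>R e)) - U i))\<^sup>2)"
          proof (rule sum_mono)
            fix l
            show "(norm (2 ^ a n *\<^sub>R (f (Suc l) - f l) - U i))\<^sup>2 \<le> (\<Sum>i\<in>I. (norm (2 ^ a n *\<^sub>R (\<xi> i (x' + (real (Suc l) * \<theta>) *\<^sub>R e) - \<xi> i (x' + (real l * \<theta>) *\<^sub>R e)) - U i))\<^sup>2)"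
              unfolding f_def using member_le_sum[OF i _ I(1), of "\<lambda>i. (norm (2 ^ a n *\<^sub>R (\<xi> i (x' + (real (Suc l) * \<theta>) *\<^sub>R e) - \<xi> i (x' + (real l * \<theta>) *\<^sub>R e)) - U i))\<^sup>2"] by simp
          qed
          also have "\<dots> \<le> \<kappa>1" using zS[OF v(1)] unfolding eq c2(2) P_def .
          finally have sq: "(\<Sum>l<P. (norm (2 ^ a n *\<^sub>R (f (Suc l) - f l) - U i))\<^sup>2) \<le> \<kappa>1" .
          have "norm (f k - f 0 - (real k / 2 ^ a n) *\<^sub>R U i) \<le> (\<epsilon> / 2) / 2 ^ a n"
            by (rule norm_slope_sum_le[OF _ sq _ \<kappa>1(2)]) (use k \<epsilon> in auto)
          then have n1: "norm (\<xi> i (x' + (real k * \<theta>) *\<^sub>R e) - \<xi> i x' - (real k * \<theta>) *\<^sub>R U i) \<le> (\<epsilon> / 2) * \<theta>"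
            unfolding f_def c2(2) by (simp add: \<theta>_def)
          have "norm (x - x') = \<theta> / 2 * norm (u - v)" unfolding xu x'_def using \<theta> by (simp flip: scaleR_diff_right)
          also have "\<dots> \<le> \<theta> / 2 * (\<epsilon> / (4 * M))" using v(2) \<theta> by (intro mult_left_mono) (auto simp: dist_norm norm_minus_commute)
          finally have "M * norm (x - x') \<le> M * (\<theta> / 2 * (\<epsilon> / (4 * M)))" using M by (intro mult_left_mono) auto
          also have "\<dots> = \<epsilon> * \<theta> / 8" using M by simp
          finally have Mx: "M * norm (x - x') \<le> \<epsilon> * \<theta> / 8" .
          have W1: "x \<in> W" "x' \<in> W" using WW[OF xc, of 0] WW[OF x'c, of 0] by auto
          have W2: "x + (real k * \<theta>) *\<^sub>R e \<in> W" "x' + (real k * \<theta>) *\<^sub>R e \<in> W" using WW[OF xc, of k] WW[OF x'c, of k] k by auto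
          have n2: "norm (\<xi> i (x + (real k * \<theta>) *\<^sub>R e) - \<xi> i (x' + (real k * \<theta>) *\<^sub>R e)) \<le> \<epsilon> * \<theta> / 8"
            using up[OF i W2] Mx by simp
          have n3: "norm (\<xi> i x - \<xi> i x') \<le> \<epsilon> * \<theta> / 8" using up[OF i W1] Mx by simp
          have "\<xi> i (x + (real k * \<theta>) *\<^sub>R e) - \<xi> i x - (real k * \<theta>) *\<^sub>R U i =
            (\<xi> i (x' + (real k * \<theta>) *\<^sub>R e) - \<xi> i x' - (real k * \<theta>) *\<^sub>R U i) +
            (\<xi> i (x + (real k * \<theta>) *\<^sub>R e) - \<xi> i (x' + (real k * \<theta>) *\<^sub>R e)) - (\<xi> i x - \<xi> i x')" by simp
          also have "norm \<dots> \<le> (\<epsilon> / 2) * \<theta> + \<epsilon> * \<theta> / 8 + \<epsilon> * \<theta> / 8"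
            by (intro order_trans[OF norm_triangle_ineq4] add_mono order_trans[OF norm_triangle_ineq] n1 n2 n3)
          also have "\<dots> \<le> \<epsilon> * \<theta>" using \<epsilon> \<theta> by simp
          finally show ?thesis .
        qed
        show "\<bar>measure lebesgue (T \<inter> X) - (if st i then measure lebesgue X else measure lebesgue (A \<inter> X))\<bar> \<le> \<tau> * \<theta> ^ DIM('a)"
          if i: "i \<in> J" and X: "X \<in> lmeasurable" "X \<subseteq> Z i" for i X
        proof -
          have "(if st i then measure lebesgue X else measure lebesgue (A \<inter> X)) = measure lebesgue (TT (Suc n) \<inter> X)"
          proof (cases "st i")
            case True
            then have "TT (Suc n) \<inter> X = X" using X(2) n(3) Zc(1)[OF i] unfolding st_def by blast
            then show ?thesis using True by simp
          next
            case False
            then have "Z i \<inter> TT n = {}" using Zc(2)[OF i] unfolding st_def by blast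
            then have "TT (Suc n) \<inter> X = A \<inter> X" using X(2) n(3) unfolding A_def by blast
            then show ?thesis using False by simp
          qed
          then have "\<bar>measure lebesgue (T \<inter> X) - (if st i then measure lebesgue X else measure lebesgue (A \<inter> X))\<bar> \<le> measure lebesgue (sym_diff T (TT (Suc n)) \<inter> Z i)"
            using measure_Int_sym_diff_le[OF TTm(2,1) X] unfolding Z_def by simp
          then show ?thesis using tail unfolding Z_def by (meson order_trans)
        qed
        show "\<not> st i0"
          unfolding st_def using id[OF zW'] zT by simp
        show "cball c (\<theta>/4) \<subseteq> A"
          using cball_subset_cells[OF zper] unfolding A_def pattern_cells_def n(2) c_def c2(1)[symmetric] by (simp only: \<theta>_def)
        show "Z i \<in> lmeasurable \<and> measure lebesgue (A \<inter> Z i) \<le> K * \<theta> ^ DIM('a)" if "i \<in> J" for i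
        proof
          show "Z i \<in> lmeasurable" unfolding Z_def by simp
          have "measure lebesgue (A \<inter> Z i) \<le> \<omega> * (r / 2 ^ p0 + real D / 2 ^ a n) ^ D"
            unfolding A_def Z_def pattern_cells_def n(2) \<omega>_def D_def by (rule measure_cells_le') (use r\<theta> \<theta> in auto)
          also have "\<dots> \<le> \<omega> * ((2 * M + real D) * \<theta>) ^ D"
          proof (intro mult_left_mono power_mono)
            have "M * (real P + 1) \<le> M * (2 * real P)" using M P1 by (intro mult_left_mono) auto
            then have "M * (real P + 1) * \<theta> \<le> M * (2 * real P) * \<theta>" using \<theta> by (intro mult_right_mono) auto
            then have "r / real P \<le> M * (2 * real P) * \<theta> / real P" unfolding r_def by (intro divide_right_mono) auto
            also have "\<dots> = 2 * M * \<theta>" using P1 by simp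
            finally show "r / 2 ^ p0 + real D / 2 ^ a n \<le> (2 * M + real D) * \<theta>" unfolding P_def \<theta>_def by (simp add: add_divide_distrib algebra_simps)
          qed (use \<omega> r\<theta> \<theta> in auto)
          also have "\<dots> = K * \<theta> ^ DIM('a)" unfolding K_def D_def by (simp add: power_mult_distrib)
          finally show "measure lebesgue (A \<inter> Z i) \<le> K * \<theta> ^ DIM('a)" .
        qed
      qed (use \<theta> P e1 I up low id s' bal' Ab Zin in auto)
    qed
    show False
    proof (cases "measure lebesgue (S \<inter> N) \<le> measure lebesgue N / 2")
      case True
      show False
      proof (rule core[OF pat add _ bal True])
        show "\<bar>s i\<bar> \<le> 2" if "i \<in> I" for i using s[OF that] by simp
      qed
    next
      case False
      \<comment> \<open>On the complement the mass is the volume minus the mass of \<open>S\<close>.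
        The balance is therefore negated, and each weighted sheet loses its volume once
        more.\<close>
      define s' where "s' i = - s i - (if i \<in> J then 1 else 0)" for i
      have Sm: "S \<in> sets lebesgue" using pat unfolding pattern_sequence_def by blast
      have comp: "measure lebesgue (- S \<inter> X) = measure lebesgue X - measure lebesgue (S \<inter> X)" if "X \<in> lmeasurable" for X
      proof -
        have "S \<inter> X \<in> lmeasurable" using that Sm by (metis fmeasurable_Int_fmeasurable Int_commute)
        moreover have "- S \<inter> X = X - S \<inter> X" by blast
        ultimately show ?thesis using measurable_measure_Diff[of X lebesgue "S \<inter> X"] that by (simp add: fmeasurableD)
      qed
      show False
      proof (rule core[OF pattern_sequence_compl[OF pat]])
        show "\<exists>\<^sub>\<infinity>n. p n = p0 \<and> - SS (Suc n) = - SS n \<union> pattern_cells e a p n"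
          by (rule INFM_mono[OF rem[of p0]]) auto
        show "\<bar>s' i\<bar> \<le> 2" if "i \<in> I" for i using s[OF that] unfolding s'_def by auto
        show "measure lebesgue (- S \<inter> N) \<le> measure lebesgue N / 2" using comp[OF Nlm] False by simp
        fix F assume F: "compact F" "F \<subseteq> W"
        have lm: "\<xi> i ` F \<in> lmeasurable" if "i \<in> I" for i
        proof -
          have "M-lipschitz_on F (\<xi> i)" using up[OF that] F M by (intro lipschitz_onI) (auto simp: dist_norm subset_iff)
          then show ?thesis by (intro lmeasurable_compact compact_continuous_image F lipschitz_on_continuous_on)
        qed
        have "(\<Sum>i\<in>I. s' i * measure lebesgue (\<xi> i ` F)) = - (\<Sum>i\<in>I. s i * measure lebesgue (\<xi> i ` F)) - (\<Sum>i\<in>I. if i \<in> J then measure lebesgue (\<xi> i ` F) else 0)"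
          unfolding sum_negf[symmetric] sum_subtractf[symmetric] s'_def by (intro sum.cong) (auto simp: algebra_simps)
        also have "(\<Sum>i\<in>I. if i \<in> J then measure lebesgue (\<xi> i ` F) else 0) = (\<Sum>i\<in>J. measure lebesgue (\<xi> i ` F))"
          using I by (simp add: sum.If_cases Int_absorb1)
        finally have 1: "(\<Sum>i\<in>I. s' i * measure lebesgue (\<xi> i ` F)) = - (\<Sum>i\<in>I. s i * measure lebesgue (\<xi> i ` F)) - (\<Sum>i\<in>J. measure lebesgue (\<xi> i ` F))" .
        have 2: "(\<Sum>i\<in>J. measure lebesgue (- S \<inter> \<xi> i ` F)) = (\<Sum>i\<in>J. measure lebesgue (\<xi> i ` F)) - (\<Sum>i\<in>J. measure lebesgue (S \<inter> \<xi> i ` F))"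
          unfolding sum_subtractf[symmetric] using I(2) lm by (intro sum.cong refl comp) blast
        show "(\<Sum>i\<in>I. s' i * measure lebesgue (\<xi> i ` F)) + (\<Sum>i\<in>J. measure lebesgue (- S \<inter> \<xi> i ` F)) = 0"
          using 1 2 bal[OF F] by linarith
      qed
    qed
  qed
qed

section \<open>Construction of the pattern\<close>

text \<open>Encoded through floors, so that refinement and Boolean operations are immediate and
  rounding to the grid preserves membership. The latter lets lattice points reproduce such a set
  exactly.\<close>

definition dyadic :: "nat \<Rightarrow> 'a::euclidean_space set \<Rightarrow> bool" where
  "dyadic l T \<longleftrightarrow> (\<forall>x y. (\<forall>b\<in>Basis. \<lfloor>2 ^ l * (x \<bullet> b)\<rfloor> = \<lfloor>2 ^ l * (y \<bullet> b)\<rfloor>) \<longrightarrow> (x \<in> T \<longleftrightarrow> y \<in> T))"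

lemma dyadic_mono:
  assumes "dyadic l T" "l \<le> m"
  shows "dyadic m T"
proof -
  have *: "\<lfloor>2 ^ l * t\<rfloor> = \<lfloor>2 ^ m * t\<rfloor> div 2 ^ (m - l)" for t :: real
  proof -
    have "(2::real) ^ m = 2 ^ l * 2 ^ (m - l)" using assms(2) by (simp flip: power_add)
    then have "2 ^ l * t = 2 ^ m * t / of_int (2 ^ (m - l))" by simp
    then show ?thesis by (simp only: floor_divide_real_eq_div[OF zero_le_power[OF zero_le_numeral]])
  qed
  show ?thesis using assms(1) unfolding dyadic_def * by metis
qed

lemma dyadic_cells: "dyadic a (cells e a p q)"
  unfolding dyadic_def cells_def by auto

lemma dyadic_Un: "dyadic l S \<Longrightarrow> dyadic l T \<Longrightarrow> dyadic l (S \<union> T)"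
  and dyadic_Diff: "dyadic l S \<Longrightarrow> dyadic l T \<Longrightarrow> dyadic l (S - T)"
  unfolding dyadic_def by blast+

text \<open>A frontier point has some coordinate on the grid of mesh 2^-l, and such points fill only
  countably many hyperplanes.\<close>

lemma negligible_frontier_dyadic:
  fixes T :: "'a::euclidean_space set"
  assumes "dyadic l T"
  shows "negligible (frontier T)"
proof -
  have "frontier T \<subseteq> (\<Union>b\<in>Basis. \<Union>k::int. {x. x \<bullet> b = of_int k / 2 ^ l})"
  proof
    fix x assume x: "x \<in> frontier T"
    show "x \<in> (\<Union>b\<in>Basis. \<Union>k::int. {x. x \<bullet> b = of_int k / 2 ^ l})"
    proof (rule ccontr)
      assume no: "x \<notin> (\<Union>b\<in>Basis. \<Union>k::int. {x. x \<bullet> b = of_int k / 2 ^ l})"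
      define k where "k b = \<lfloor>2 ^ l * (x \<bullet> b)\<rfloor>" for b
      define U where "U = (\<Inter>b\<in>Basis. {y::'a. of_int (k b) < 2 ^ l * (y \<bullet> b)} \<inter> {y. 2 ^ l * (y \<bullet> b) < of_int (k b) + 1})"
      have U: "open U" unfolding U_def
        by (intro open_INT finite_Basis ballI open_Int open_Collect_less continuous_intros)
      have "of_int (k b) < 2 ^ l * (x \<bullet> b)" "2 ^ l * (x \<bullet> b) < of_int (k b) + 1" if "b \<in> Basis" for b
      proof -
        have "of_int (k b) \<le> 2 ^ l * (x \<bullet> b)" unfolding k_def by linarith
        moreover have "x \<bullet> b \<noteq> of_int (k b) / 2 ^ l" using no that by auto
        then have "of_int (k b) \<noteq> 2 ^ l * (x \<bullet> b)" by (auto simp: field_simps)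
        ultimately show "of_int (k b) < 2 ^ l * (x \<bullet> b)" by simp
        show "2 ^ l * (x \<bullet> b) < of_int (k b) + 1" unfolding k_def by linarith
      qed
      then have xU: "x \<in> U" unfolding U_def by auto
      have same: "y \<in> T \<longleftrightarrow> x \<in> T" if y: "y \<in> U" for y
      proof -
        have "\<lfloor>2 ^ l * (y \<bullet> b)\<rfloor> = \<lfloor>2 ^ l * (x \<bullet> b)\<rfloor>" if "b \<in> Basis" for b
        proof -
          have "of_int (k b) < 2 ^ l * (y \<bullet> b)" "2 ^ l * (y \<bullet> b) < of_int (k b) + 1" using y that unfolding U_def by auto
          then have "\<lfloor>2 ^ l * (y \<bullet> b)\<rfloor> = k b" by linarith
          then show ?thesis unfolding k_def .
        qed
        then show ?thesis using assms unfolding dyadic_def by blast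
      qed
      obtain r where r: "r > 0" "ball x r \<subseteq> U" using U xU open_contains_ball by metis
      obtain y1 where "y1 \<in> T" "dist x y1 < r" using x r(1) unfolding frontier_straddle by blast
      moreover obtain y2 where "y2 \<notin> T" "dist x y2 < r" using x r(1) unfolding frontier_straddle by blast
      moreover have "y1 \<in> U" "y2 \<in> U" using calculation r(2) by (auto simp: subset_iff)
      ultimately show False using same[of y1] same[of y2] by simp
    qed
  qed
  moreover have "negligible (\<Union>b\<in>Basis. \<Union>k::int. {x::'a. x \<bullet> b = of_int k / 2 ^ l})"
  proof (rule negligible_Union)
    show "finite ((\<lambda>b. \<Union>k::int. {x::'a. x \<bullet> b = of_int k / 2 ^ l}) ` Basis)" by simp
    fix t assume "t \<in> (\<lambda>b. \<Union>k::int. {x::'a. x \<bullet> b = of_int k / 2 ^ l}) ` Basis"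
    then obtain b :: 'a where b: "b \<in> Basis" "t = (\<Union>k::int. {x::'a. x \<bullet> b = of_int k / 2 ^ l})" by blast
    show "negligible t" unfolding b(2)
      by (rule negligible_countable_Union) (auto intro: negligible_standard_hyperplane[OF b(1)])
  qed
  ultimately show ?thesis by (rule negligible_subset[rotated])
qed

lemma lebesgue_sets_dyadic:
  fixes T :: "'a::euclidean_space set"
  assumes "dyadic l T"
  shows "T \<in> sets lebesgue"
proof -
  have "negligible (T \<inter> frontier T)" by (rule negligible_subset[OF negligible_frontier_dyadic[OF assms]]) blast
  then have "T \<inter> frontier T \<in> sets lebesgue" by (rule negligible_imp_sets)
  moreover have "interior T \<in> sets lebesgue" by (simp add: borel_open sets_completionI_sets)
  ultimately have "interior T \<union> (T \<inter> frontier T) \<in> sets lebesgue" by (intro sets.Un)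
  also have "interior T \<union> (T \<inter> frontier T) = T"
    using interior_subset[of T] closure_subset[of T] unfolding frontier_def by blast
  finally show ?thesis .
qed

text \<open>The closed neighbourhoods inside a ball decrease to a subset of \<open>F\<close>;
  measure is continuous from above.\<close>

lemma small_near:
  fixes F :: "'a::euclidean_space set"
  assumes F: "closed F" "negligible F" and \<delta>: "\<delta> > 0"
  obtains r where "r > 0" "measure lebesgue (near F r \<inter> cball 0 R) \<le> \<delta>"
proof -
  define B where "B k = near F (1 / real (Suc k)) \<inter> cball 0 R" for k
  have lm: "B k \<in> lmeasurable" for k unfolding B_def
    by (intro lmeasurable_compact closed_Int_compact closed_near F) auto
  have "(\<lambda>k. measure lebesgue (B k)) \<longlonglongrightarrow> measure lebesgue (\<Inter>k. B k)"
  proof (rule Lim_measure_decseq)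
    show "range B \<subseteq> sets lebesgue" using lm by (auto simp: fmeasurableD)
    show "decseq B" unfolding decseq_def B_def
    proof (intro allI impI Int_mono order_refl near_mono)
      fix m n :: nat assume "m \<le> n" then show "1 / real (Suc n) \<le> 1 / real (Suc m)" by (intro divide_left_mono) auto
    qed
    show "emeasure lebesgue (B i) \<noteq> \<infinity>" for i
      using fmeasurableD2[OF lm[of i]] by (simp only: infinity_ennreal_def) simp
  qed
  moreover have "(\<Inter>k. B k) \<subseteq> F"
  proof
    fix y assume y: "y \<in> (\<Inter>k. B k)"
    have "\<exists>w\<in>F. dist w y < ep" if ep: "ep > 0" for ep
    proof -
      obtain k where k: "1 / real (Suc k) < ep" using nat_approx_posE[OF ep] by metis
      have "y \<in> near F (1 / real (Suc k))" using y unfolding B_def by blast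
      then obtain w where "w \<in> F" "dist y w \<le> 1 / real (Suc k)" unfolding near_def by blast
      then show ?thesis using k by (intro bexI[of _ w]) (auto simp: dist_commute)
    qed
    then show "y \<in> F" using closed_approachable[OF F(1), of y] by simp
  qed
  then have "negligible (\<Inter>k. B k)" by (rule negligible_subset[OF F(2)])
  then have "measure lebesgue (\<Inter>k. B k) = 0" by (rule negligible_imp_measure0)
  ultimately have "(\<lambda>k. measure lebesgue (B k)) \<longlonglongrightarrow> 0" by simp
  then have "\<forall>\<^sub>F k in sequentially. measure lebesgue (B k) < \<delta>" using \<delta> by (rule order_tendstoD)
  then obtain k where "measure lebesgue (B k) < \<delta>" unfolding eventually_sequentially by blast
  then show thesis using that[of "1 / real (Suc k)"] unfolding B_def by simp
qed

text \<open>The set \<open>SS n\<close> is fixed by the earlier levels and has a null frontier, so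
  afterwards \<open>a n\<close> can be taken large enough for the frontier condition. The array of
  that level has the same mesh, which keeps \<open>SS (Suc n)\<close> dyadic and lets the recursion
  continue.\<close>

lemma pattern_sequence_exists:
  fixes e :: "'a::euclidean_space"
  obtains a p SS S where "pattern_sequence e a p SS S"
    "\<And>k. \<exists>\<^sub>\<infinity>n. p n = k \<and> SS (Suc n) = SS n \<union> pattern_cells e a p n"
    "\<And>k. \<exists>\<^sub>\<infinity>n. p n = k \<and> SS (Suc n) = SS n - pattern_cells e a p n"
    "\<And>n. dyadic (a n) (SS n)"
proof -
  \<comment> \<open>Halving leaves the parity of \<open>n\<close> free, and the first component of
    the decoded pair takes every value infinitely often. So each exponent recurs infinitely often
    both at even levels, which add, and at odd levels, which remove.\<close>
  define p where "p n = fst (prod_decode (n div 2))" for n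
  define nxt where "nxt n a T = (if even n then T \<union> cells e a (p n) (n + p n) else T - cells e a (p n) (n + p n))" for n a and T :: "'a set"
  define small where "small n a T \<longleftrightarrow> measure lebesgue (near (frontier T) (real n * 2 ^ (n + p n) / 2 ^ a) \<inter> cball 0 (real n))
        \<le> 1 / (2 ^ n * (2 ^ (n + p n)) ^ DIM('a))" for n a and T :: "'a set"
  define good where "good n s \<longleftrightarrow> dyadic (fst s) (snd s) \<and> n \<le> fst s \<and> small n (fst s) (snd s)" for n and s :: "nat \<times> 'a set"
  define stp where "stp n s s' \<longleftrightarrow> snd s' = nxt n (fst s) (snd s) \<and> fst s + (Suc n + p (Suc n)) \<le> fst s'" for n and s s' :: "nat \<times> 'a set"
  have ex: "\<exists>a\<ge>l. dyadic a T \<and> n \<le> a \<and> small n a T" if T: "dyadic l T" for l n and T :: "'a set"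
  proof -
    define \<delta> where "\<delta> = 1 / ((2::real) ^ n * (2 ^ (n + p n)) ^ DIM('a))"
    have "\<delta> > 0" unfolding \<delta>_def by simp
    then obtain r where r: "r > 0" "measure lebesgue (near (frontier T) r \<inter> cball 0 (real n)) \<le> \<delta>"
      using small_near[OF frontier_closed negligible_frontier_dyadic[OF T], of \<delta> "real n"] by blast
    obtain m where m: "real n * 2 ^ (n + p n) / r < 2 ^ m" using real_arch_pow[of 2 "real n * 2 ^ (n + p n) / r"] by auto
    define a where "a = max l (max n m)"
    have "(2::real) ^ m \<le> 2 ^ a" unfolding a_def by (intro power_increasing) auto
    then have "real n * 2 ^ (n + p n) / r \<le> 2 ^ a" using m by linarith
    then have le: "real n * 2 ^ (n + p n) / 2 ^ a \<le> r" using r(1) by (simp add: field_simps)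
    have "measure lebesgue (near (frontier T) (real n * 2 ^ (n + p n) / 2 ^ a) \<inter> cball 0 (real n)) \<le> measure lebesgue (near (frontier T) r \<inter> cball 0 (real n))"
    proof (rule measure_mono_fmeasurable)
      show "near (frontier T) (real n * 2 ^ (n + p n) / 2 ^ a) \<inter> cball 0 (real n) \<subseteq> near (frontier T) r \<inter> cball 0 (real n)"
        using near_mono[OF le] by blast
      show "near (frontier T) r \<inter> cball 0 (real n) \<in> lmeasurable" for r
        by (intro lmeasurable_compact closed_Int_compact closed_near) auto
      then show "near (frontier T) (real n * 2 ^ (n + p n) / 2 ^ a) \<inter> cball 0 (real n) \<in> sets lebesgue" by (rule fmeasurableD)
    qed
    then have "small n a T" unfolding small_def using r(2) \<delta>_def by linarith
    moreover have "l \<le> a" "n \<le> a" unfolding a_def by auto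
    ultimately show ?thesis using dyadic_mono[OF T, of a] by blast
  qed
  have "\<exists>f. \<forall>n. good n (f n) \<and> stp n (f n) (f (Suc n))"
  proof (rule dependent_nat_choice)
    have "dyadic 0 ({} :: 'a set)" unfolding dyadic_def by simp
    then obtain a where "dyadic a ({} :: 'a set)" "0 \<le> a" "small 0 a {}" using ex[of 0 "{}" 0] by blast
    then show "\<exists>s. good 0 s" unfolding good_def by (intro exI[of _ "(a, {})"]) simp
  next
    fix s n assume s: "good n s"
    have "dyadic (fst s) (nxt n (fst s) (snd s))"
      using s unfolding good_def nxt_def by (simp add: dyadic_Un dyadic_Diff dyadic_cells)
    then have "dyadic (fst s + (Suc n + p (Suc n))) (nxt n (fst s) (snd s))" by (rule dyadic_mono) simp
    then obtain a where "a \<ge> fst s + (Suc n + p (Suc n))" "dyadic a (nxt n (fst s) (snd s))" "Suc n \<le> a" "small (Suc n) a (nxt n (fst s) (snd s))"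
      using ex by metis
    then show "\<exists>s'. good (Suc n) s' \<and> stp n s s'" unfolding good_def stp_def
      by (intro exI[of _ "(a, nxt n (fst s) (snd s))"]) simp
  qed
  then obtain f where f: "\<And>n. good n (f n)" "\<And>n. stp n (f n) (f (Suc n))" by blast
  define a SS where "a n = fst (f n)" and "SS n = snd (f n)" for n
  \<comment> \<open>Points outside all arrays from some level on have a constant membership from
    there; for the remaining ones, which form a null set, the limit inferior fixes a value.\<close>
  define S where "S = {x. \<forall>\<^sub>F n in sequentially. x \<in> SS n}"
  have dy: "dyadic (a n) (SS n)" "n \<le> a n" "small n (a n) (SS n)" for n using f(1)[of n] unfolding good_def a_def SS_def by auto
  have st: "SS (Suc n) = nxt n (a n) (SS n)" "a n + (Suc n + p (Suc n)) \<le> a (Suc n)" for n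
    using f(2)[of n] unfolding stp_def a_def SS_def by auto
  have SSm: "SS n \<in> sets lebesgue" for n using lebesgue_sets_dyadic dy(1) by blast
  have const: "x \<in> SS (n + m) \<longleftrightarrow> x \<in> SS n" if "x \<notin> (\<Union>k\<in>{n..}. pattern_cells e a p k)" for x n m
  proof (induction m)
    case (Suc m)
    have "x \<notin> cells e (a (n + m)) (p (n + m)) ((n + m) + p (n + m))" using that unfolding pattern_cells_def by auto
    then have "x \<in> SS (Suc (n + m)) \<longleftrightarrow> x \<in> SS (n + m)" unfolding st(1) nxt_def by auto
    then show ?case using Suc by simp
  qed simp
  have pat: "pattern_sequence e a p SS S"
    unfolding pattern_sequence_def
  proof (intro conjI allI)
    have "S = (\<Union>n. \<Inter>m\<in>{n..}. SS m)" unfolding S_def eventually_sequentially by auto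
    moreover have "(\<Union>n. \<Inter>m\<in>{n..}. SS m) \<in> sets lebesgue" using SSm by (intro sets.countable_UN sets.countable_INT'') auto
    ultimately show "S \<in> sets lebesgue" by simp
    show "sym_diff S (SS n) \<subseteq> (\<Union>k\<in>{n..}. pattern_cells e a p k)" for n
    proof
      fix x assume x: "x \<in> sym_diff S (SS n)"
      show "x \<in> (\<Union>k\<in>{n..}. pattern_cells e a p k)"
      proof (rule ccontr)
        assume no: "x \<notin> (\<Union>k\<in>{n..}. pattern_cells e a p k)"
        have "\<forall>\<^sub>F m in sequentially. x \<in> SS m \<longleftrightarrow> x \<in> SS n"
          unfolding eventually_sequentially using const[OF no] by (metis le_Suc_ex)
        moreover have "(\<forall>\<^sub>F m in sequentially. x \<in> SS m) \<longleftrightarrow> (\<forall>\<^sub>F m in sequentially. x \<in> SS n)"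
          by (rule eventually_cong[OF calculation]) simp
        ultimately have "x \<in> S \<longleftrightarrow> x \<in> SS n" unfolding S_def by simp
        then show False using x by blast
      qed
    qed
    show "measure lebesgue (near (frontier (SS n)) (real n * 2 ^ (n + p n) / 2 ^ a n) \<inter> cball 0 (real n)) \<le> 1 / (2 ^ n * (2 ^ (n + p n)) ^ DIM('a))" for n
      using dy(3) unfolding small_def .
  qed (use SSm st dy in auto)
  have inf: "\<exists>n\<ge>m. p n = k \<and> (even n \<longleftrightarrow> c)" for k m c
  proof -
    define n where "n = 2 * prod_encode (k, m) + (if c then 0 else 1)"
    have "m \<le> prod_encode (k, m)" by (rule le_prod_encode_2)
    then have "n \<ge> m" unfolding n_def by linarith
    moreover have "p n = k" unfolding p_def n_def by simp
    moreover have "even n \<longleftrightarrow> c" unfolding n_def by simp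
    ultimately show ?thesis by blast
  qed
  show thesis
  proof (rule that[OF pat _ _ dy(1)])
    fix k
    show "\<exists>\<^sub>\<infinity>n. p n = k \<and> SS (Suc n) = SS n \<union> pattern_cells e a p n"
      unfolding INFM_nat_le st(1) nxt_def pattern_cells_def using inf[of _ k True] by auto
    show "\<exists>\<^sub>\<infinity>n. p n = k \<and> SS (Suc n) = SS n - pattern_cells e a p n"
      unfolding INFM_nat_le st(1) nxt_def pattern_cells_def
    proof
      fix m
      obtain n where "n \<ge> m" "p n = k" "odd n" using inf[of m k False] by auto
      then show "\<exists>n\<ge>m. p n = k \<and> (if even n then SS n \<union> cells e (a n) (p n) (n + p n) else SS n - cells e (a n) (p n) (n + p n)) = SS n - cells e (a n) (p n) (n + p n)"
        by (intro exI[of _ n]) simp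
    qed
  qed
qed

text \<open>The volumes of the differences in a fixed ball are summable, so the Borel-Cantelli lemma
  applies; then all balls of a countable exhaustion are combined.\<close>

lemma pattern_sequence_AE:
  fixes e :: "'a::euclidean_space"
  assumes pat: "pattern_sequence e a p SS S" and d: "DIM('a) \<ge> 2"
  shows "AE x in lebesgue. \<forall>\<^sub>F n in sequentially. x \<in> SS n \<longleftrightarrow> x \<in> S"
proof -
  have one: "AE x in lebesgue. \<forall>\<^sub>F n in sequentially. x \<in> space lebesgue - (sym_diff S (SS n) \<inter> cball 0 (real R + 1))" for R :: nat
  proof (rule borel_cantelli_AE1)
    have s: "S \<in> sets lebesgue" "SS n \<in> sets lebesgue" for n using pat unfolding pattern_sequence_def by blast+
    have sd: "sym_diff S (SS n) \<in> sets lebesgue" for n using s by auto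
    have lm: "sym_diff S (SS n) \<inter> cball 0 (real R + 1) \<in> lmeasurable" for n
      using sd[of n] by (metis fmeasurable_Int_fmeasurable Int_commute lmeasurable_cball)
    show "sym_diff S (SS n) \<inter> cball 0 (real R + 1) \<in> sets lebesgue" for n using lm by (rule fmeasurableD)
    show "emeasure lebesgue (sym_diff S (SS n) \<inter> cball 0 (real R + 1)) < \<infinity>" for n
      using lm[of n] unfolding fmeasurable_def infinity_ennreal_def by blast
    define C where "C = 2 * (unit_ball_vol (DIM('a)) * (2 * (real R + 1)) ^ DIM('a))"
    have "measure lebesgue (sym_diff S (SS n) \<inter> cball 0 (real R + 1)) \<le> C * (1/2) ^ n" if n: "n \<ge> 1" for n
    proof -
      have "measure lebesgue (sym_diff S (SS n) \<inter> cball 0 (real R + 1)) \<le> C / 2 ^ n"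
        unfolding C_def
      proof (rule pattern_tail[OF pat d])
        fix k assume "k \<ge> n"
        then obtain k' where k': "k = Suc k'" using n by (cases k) auto
        have "2 ^ (k + p k) / (2::real) ^ a k \<le> 1 / 2 ^ a 0" unfolding k' by (rule pattern_step_le[OF pat]) simp
        also have "\<dots> \<le> 1" by simp
        finally show "2 ^ (k + p k) / 2 ^ a k \<le> real R + 1" by linarith
      qed
      then show ?thesis by (simp add: power_divide)
    qed
    then have le: "norm (measure lebesgue (sym_diff S (SS n) \<inter> cball 0 (real R + 1))) \<le> C * (1/2) ^ n" if "n \<ge> 1" for n
      using that by simp
    have "summable (\<lambda>n. C * (1/2::real) ^ n)" by (intro summable_mult summable_geometric) simp
    then show "summable (\<lambda>n. measure lebesgue (sym_diff S (SS n) \<inter> cball 0 (real R + 1)))"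
      by (rule summable_comparison_test') (rule le)
  qed
  have "AE x in lebesgue. \<forall>R::nat. \<forall>\<^sub>F n in sequentially. x \<in> space lebesgue - (sym_diff S (SS n) \<inter> cball 0 (real R + 1))"
    unfolding AE_all_countable using one by blast
  then show ?thesis
  proof (rule AE_mp, intro AE_I2 impI)
    fix x :: 'a assume x: "\<forall>R::nat. \<forall>\<^sub>F n in sequentially. x \<in> space lebesgue - (sym_diff S (SS n) \<inter> cball 0 (real R + 1))"
    obtain R :: nat where "norm x < real R" using reals_Archimedean2 by blast
    then have R: "x \<in> cball 0 (real R + 1)" by simp
    show "\<forall>\<^sub>F n in sequentially. x \<in> SS n \<longleftrightarrow> x \<in> S"
      by (rule eventually_mono[OF x[rule_format, of R]]) (use R in auto)
  qed
qed

section \<open>Rescaled limits of maps between weighted lattices\<close>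

definition lattice :: "'a::euclidean_space set" where
  "lattice = {x. \<forall>b\<in>Basis. x \<bullet> b \<in> \<int>}"

definition floor_point :: "'a::euclidean_space \<Rightarrow> 'a" where
  "floor_point x = (\<Sum>b\<in>Basis. of_int \<lfloor>x \<bullet> b\<rfloor> *\<^sub>R b)"

lemma floor_point_inner: "b \<in> Basis \<Longrightarrow> floor_point x \<bullet> b = of_int \<lfloor>x \<bullet> b\<rfloor>"
  unfolding floor_point_def by (simp add: inner_sum_left_Basis)

lemma floor_point_in_lattice: "floor_point x \<in> lattice"
  unfolding lattice_def by (simp add: floor_point_inner)

lemma floor_point_near: "norm (x - floor_point x) \<le> DIM('a)" for x :: "'a::euclidean_space"
proof -
  have "norm (x - floor_point x) \<le> real DIM('a) * 1"
    by (rule norm_le_sum_coords) (simp add: inner_diff_left floor_point_inner, linarith)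
  then show ?thesis by simp
qed

lemma finite_lattice_cball: "finite (lattice \<inter> cball (0::'a::euclidean_space) r)"
proof -
  have "lattice \<inter> cball (0::'a) r \<subseteq> (\<lambda>f. \<Sum>b\<in>Basis. of_int (f b) *\<^sub>R b) ` (PiE Basis (\<lambda>_. {-\<lceil>r\<rceil>..\<lceil>r\<rceil>}))"
  proof
    fix z :: 'a assume z: "z \<in> lattice \<inter> cball 0 r"
    define f where "f = restrict (\<lambda>b. \<lfloor>z \<bullet> b\<rfloor>) Basis"
    have "z = (\<Sum>b\<in>Basis. of_int (f b) *\<^sub>R b)"
    proof (rule euclidean_eqI)
      fix b :: 'a assume b: "b \<in> Basis"
      then have "z \<bullet> b \<in> \<int>" using z unfolding lattice_def by auto
      then show "z \<bullet> b = (\<Sum>b\<in>Basis. of_int (f b) *\<^sub>R b) \<bullet> b" using b by (auto simp: inner_sum_left_Basis f_def elim: Ints_cases)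
    qed
    moreover have "f \<in> PiE Basis (\<lambda>_. {-\<lceil>r\<rceil>..\<lceil>r\<rceil>})"
    proof (rule PiE_I)
      fix b :: 'a assume b: "b \<in> Basis"
      have "\<bar>z \<bullet> b\<bar> \<le> r" using Basis_le_norm[OF b, of z] z by auto
      then have "- \<lceil>r\<rceil> \<le> \<lfloor>z \<bullet> b\<rfloor>" "\<lfloor>z \<bullet> b\<rfloor> \<le> \<lceil>r\<rceil>" by linarith+
      then show "f b \<in> {-\<lceil>r\<rceil>..\<lceil>r\<rceil>}" using b unfolding f_def by simp
    qed (simp add: f_def)
    ultimately show "z \<in> (\<lambda>f. \<Sum>b\<in>Basis. of_int (f b) *\<^sub>R b) ` (PiE Basis (\<lambda>_. {-\<lceil>r\<rceil>..\<lceil>r\<rceil>}))" by blast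
  qed
  then show ?thesis by (rule finite_subset) (intro finite_imageI finite_PiE, auto)
qed

lemma floor_point_eq_iff:
  assumes z: "z \<in> lattice" and R: "R > 0"
  shows "floor_point (R *\<^sub>R x) = z \<longleftrightarrow> x \<in> half_open_box (\<lambda>_. 1 / R) (z /\<^sub>R R)"
proof -
  have "floor_point (R *\<^sub>R x) = z \<longleftrightarrow> (\<forall>b\<in>Basis. of_int \<lfloor>R * (x \<bullet> b)\<rfloor> = z \<bullet> b)"
    unfolding euclidean_eq_iff[of "floor_point (R *\<^sub>R x)"] by (simp add: floor_point_inner)
  also have "\<dots> \<longleftrightarrow> (\<forall>b\<in>Basis. (z /\<^sub>R R) \<bullet> b \<le> x \<bullet> b \<and> x \<bullet> b < (z /\<^sub>R R) \<bullet> b + 1 / R)"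
  proof (intro ball_cong refl)
    fix b :: 'a assume "b \<in> Basis"
    then obtain k :: int where k: "z \<bullet> b = of_int k" using z unfolding lattice_def by (auto elim: Ints_cases)
    have "(of_int \<lfloor>R * (x \<bullet> b)\<rfloor> = z \<bullet> b) \<longleftrightarrow> (z \<bullet> b \<le> R * (x \<bullet> b) \<and> R * (x \<bullet> b) < z \<bullet> b + 1)"
      unfolding k of_int_eq_iff by (simp add: floor_eq_iff)
    also have "\<dots> \<longleftrightarrow> ((z /\<^sub>R R) \<bullet> b \<le> x \<bullet> b \<and> x \<bullet> b < (z /\<^sub>R R) \<bullet> b + 1 / R)"
      using R by (simp add: field_simps)
    finally show "(of_int \<lfloor>R * (x \<bullet> b)\<rfloor> = z \<bullet> b) \<longleftrightarrow> ((z /\<^sub>R R) \<bullet> b \<le> x \<bullet> b \<and> x \<bullet> b < (z /\<^sub>R R) \<bullet> b + 1 / R)" .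
  qed
  finally show ?thesis unfolding half_open_box_def by simp
qed

text \<open>A lattice sum is, up to the volume of a cell, the integral of a step function. Limits of
  rescaled sums thus become limits of integrals over a fixed space.\<close>

lemma lattice_integral:
  fixes \<phi> :: "'a::euclidean_space \<Rightarrow> real"
  assumes Z: "finite Z" "Z \<subseteq> lattice" and z: "\<And>z. z \<in> lattice \<Longrightarrow> z \<notin> Z \<Longrightarrow> \<phi> z = 0" and R: "R > 0"
  shows "(\<lambda>x. \<phi> (floor_point (R *\<^sub>R x))) \<in> borel_measurable lebesgue"
    and "integral\<^sup>L lebesgue (\<lambda>x. \<phi> (floor_point (R *\<^sub>R x))) = measure lebesgue (half_open_box (\<lambda>_. 1 / R) (0::'a)) * (\<Sum>z\<in>Z. \<phi> z)"
proof -
  define C where "C z = half_open_box (\<lambda>_. 1 / R) (z /\<^sub>R R)" for z :: 'a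
  have C: "C z \<in> lmeasurable" for z unfolding C_def by (rule lmeasurable_half_open_box)
  have eq: "(\<lambda>x. \<phi> (floor_point (R *\<^sub>R x))) = (\<lambda>x. \<Sum>z\<in>Z. \<phi> z * indicator (C z) x)"
  proof
    fix x :: 'a
    have "(\<Sum>z\<in>Z. \<phi> z * indicator (C z) x) = (\<Sum>z\<in>Z. if z = floor_point (R *\<^sub>R x) then \<phi> z else 0)"
      using floor_point_eq_iff[OF subsetD[OF Z(2)] R, of _ x] unfolding C_def by (intro sum.cong refl) (auto simp: indicator_def)
    also have "\<dots> = \<phi> (floor_point (R *\<^sub>R x))" using Z(1) z[OF floor_point_in_lattice] by (auto simp: sum.delta)
    finally show "\<phi> (floor_point (R *\<^sub>R x)) = (\<Sum>z\<in>Z. \<phi> z * indicator (C z) x)" by simp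
  qed
  show "(\<lambda>x. \<phi> (floor_point (R *\<^sub>R x))) \<in> borel_measurable lebesgue"
    unfolding eq using C by (intro borel_measurable_sum borel_measurable_times borel_measurable_const borel_measurable_indicator fmeasurableD)
  have int: "integrable lebesgue (\<lambda>x. \<phi> z * indicator (C z) x)" for z
    using C[of z] by (intro integrable_mult_right integrable_real_indicator) (auto simp: fmeasurable_def)
  have "integral\<^sup>L lebesgue (\<lambda>x. \<phi> (floor_point (R *\<^sub>R x))) = (\<Sum>z\<in>Z. integral\<^sup>L lebesgue (\<lambda>x. \<phi> z * indicator (C z) x))"
    unfolding eq by (rule Bochner_Integration.integral_sum) (rule int)
  also have "\<dots> = (\<Sum>z\<in>Z. \<phi> z * measure lebesgue (C z))" by simp
  also have "\<dots> = (\<Sum>z\<in>Z. \<phi> z * measure lebesgue (half_open_box (\<lambda>_. 1 / R) (0::'a)))"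
    unfolding C_def by (intro sum.cong refl arg_cong2[where f = "(*)"] measure_half_open_box_cong)
  finally show "integral\<^sup>L lebesgue (\<lambda>x. \<phi> (floor_point (R *\<^sub>R x))) = measure lebesgue (half_open_box (\<lambda>_. 1 / R) (0::'a)) * (\<Sum>z\<in>Z. \<phi> z)"
    by (simp only: sum_distrib_right[symmetric] mult.commute)
qed

text \<open>The lattice has density 1, and each point of \<Lambda> adds another one. The half shift
  keeps everything inside half of the lattice, hence separated. The plain lattice is
  \<open>doubled e {}\<close>, so maps in both directions have the same form.\<close>

definition doubled :: "'a::euclidean_space \<Rightarrow> 'a set \<Rightarrow> 'a set" where
  "doubled e \<Lambda> = lattice \<union> (\<lambda>z. z + (1/2) *\<^sub>R e) ` \<Lambda>"

lemma half_shift_not_lattice: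
  assumes "e \<in> Basis" "z \<in> lattice"
  shows "z + (1/2) *\<^sub>R e \<notin> lattice"
proof
  assume "z + (1/2) *\<^sub>R e \<in> lattice"
  then obtain k k' :: int where "z \<bullet> e + 1/2 = of_int k" "z \<bullet> e = of_int k'"
    using assms unfolding lattice_def by (force simp: inner_add_left elim: Ints_cases)
  then have "2 * of_int k = (2 * of_int k' + 1 :: real)" by linarith
  then have "of_int (2 * k) = (of_int (2 * k' + 1) :: real)" by simp
  then have "2 * k = 2 * k' + 1" using of_int_eq_iff by blast
  then show False by presburger
qed

lemma sum_doubled:
  fixes \<psi> :: "'a::euclidean_space \<Rightarrow> real"
  assumes e: "e \<in> Basis" and \<Lambda>: "\<Lambda> \<subseteq> lattice" and Z: "finite Z" "Z \<subseteq> lattice"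
    and z: "\<And>z. z \<in> lattice \<Longrightarrow> z \<notin> Z \<Longrightarrow> \<psi> z = 0" "\<And>z. z \<in> \<Lambda> \<Longrightarrow> z \<notin> Z \<Longrightarrow> \<psi> (z + (1/2) *\<^sub>R e) = 0"
  shows "(\<Sum>z\<in>Z. \<psi> z + indicator \<Lambda> z * \<psi> (z + (1/2) *\<^sub>R e)) = (\<Sum>y\<in>{y\<in>doubled e \<Lambda>. \<psi> y \<noteq> 0}. \<psi> y)"
proof -
  define sh where "sh z = z + (1/2) *\<^sub>R e" for z
  have inj: "inj_on sh A" for A unfolding sh_def by (auto simp: inj_on_def)
  have "(\<Sum>z\<in>Z. \<psi> z + indicator \<Lambda> z * \<psi> (sh z)) = (\<Sum>z\<in>Z. \<psi> z) + (\<Sum>z\<in>Z \<inter> \<Lambda>. \<psi> (sh z))"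
    using Z(1) by (simp add: sum.distrib sum.inter_restrict indicator_def if_distrib[of "\<lambda>t. t * _"] cong: if_cong)
  also have "(\<Sum>z\<in>Z \<inter> \<Lambda>. \<psi> (sh z)) = (\<Sum>y\<in>sh ` (Z \<inter> \<Lambda>). \<psi> y)" by (rule sum.reindex[OF inj, of "\<psi>", unfolded o_def, symmetric])
  also have "(\<Sum>z\<in>Z. \<psi> z) + (\<Sum>y\<in>sh ` (Z \<inter> \<Lambda>). \<psi> y) = (\<Sum>y\<in>Z \<union> sh ` (Z \<inter> \<Lambda>). \<psi> y)"
    using Z half_shift_not_lattice[OF e] by (intro sum.union_disjoint[symmetric]) (auto simp: sh_def)
  also have "\<dots> = (\<Sum>y\<in>{y\<in>doubled e \<Lambda>. \<psi> y \<noteq> 0}. \<psi> y)"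
  proof (rule sum.mono_neutral_right)
    show "finite (Z \<union> sh ` (Z \<inter> \<Lambda>))" using Z(1) by simp
    show "{y\<in>doubled e \<Lambda>. \<psi> y \<noteq> 0} \<subseteq> Z \<union> sh ` (Z \<inter> \<Lambda>)"
      using z unfolding doubled_def sh_def by auto
    show "\<forall>i\<in>Z \<union> sh ` (Z \<inter> \<Lambda>) - {y\<in>doubled e \<Lambda>. \<psi> y \<noteq> 0}. \<psi> i = 0"
      using Z(2) unfolding doubled_def sh_def by auto
  qed
  finally show ?thesis unfolding sh_def .
qed

lemma integral_doubled:
  fixes \<psi> :: "'a::euclidean_space \<Rightarrow> real"
  assumes e: "e \<in> Basis" and \<Lambda>: "\<Lambda> \<subseteq> lattice" and R: "R > 0"
    and bdd: "\<And>y. y \<in> doubled e \<Lambda> \<Longrightarrow> \<psi> y \<noteq> 0 \<Longrightarrow> norm y \<le> B"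
  defines "\<phi> \<equiv> (\<lambda>z. \<psi> z + indicator \<Lambda> z * \<psi> (z + (1/2) *\<^sub>R e))"
  shows "(\<lambda>x. \<phi> (floor_point (R *\<^sub>R x))) \<in> borel_measurable lebesgue"
    and "integral\<^sup>L lebesgue (\<lambda>x. \<phi> (floor_point (R *\<^sub>R x))) =
      measure lebesgue (half_open_box (\<lambda>_. 1 / R) (0::'a)) * (\<Sum>y\<in>{y\<in>doubled e \<Lambda>. \<psi> y \<noteq> 0}. \<psi> y)"
proof -
  define Z where "Z = lattice \<inter> cball (0::'a) (B + 1)"
  have Z: "finite Z" "Z \<subseteq> lattice" unfolding Z_def using finite_lattice_cball by auto
  have z1: "\<psi> z = 0" if "z \<in> lattice" "z \<notin> Z" for z
    using bdd[of z] that unfolding doubled_def Z_def by force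
  have z2: "\<psi> (z + (1/2) *\<^sub>R e) = 0" if "z \<in> \<Lambda>" "z \<notin> Z" for z
  proof (rule ccontr)
    assume "\<not> ?thesis"
    then have "norm (z + (1/2) *\<^sub>R e) \<le> B" using that(1) by (intro bdd) (auto simp: doubled_def)
    then have "norm z \<le> B + 1" using norm_triangle_ineq4[of "z + (1/2) *\<^sub>R e" "(1/2) *\<^sub>R e"] e by simp
    then show False using that \<Lambda> unfolding Z_def by auto
  qed
  have "\<phi> z = 0" if "z \<in> lattice" "z \<notin> Z" for z unfolding \<phi>_def using z1 z2 that by (auto simp: indicator_def)
  note LI = lattice_integral[of Z \<phi>, OF Z this R]
  have S: "(\<Sum>z\<in>Z. \<phi> z) = (\<Sum>y\<in>{y\<in>doubled e \<Lambda>. \<psi> y \<noteq> 0}. \<psi> y)"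
    unfolding \<phi>_def by (rule sum_doubled[OF e \<Lambda> Z]) (fact z1, fact z2)
  show "(\<lambda>x. \<phi> (floor_point (R *\<^sub>R x))) \<in> borel_measurable lebesgue" by (rule LI(1))
  show "integral\<^sup>L lebesgue (\<lambda>x. \<phi> (floor_point (R *\<^sub>R x))) =
      measure lebesgue (half_open_box (\<lambda>_. 1 / R) (0::'a)) * (\<Sum>y\<in>{y\<in>doubled e \<Lambda>. \<psi> y \<noteq> 0}. \<psi> y)"
    by (rule LI(2)[unfolded S])
qed

lemma rescaled_floor_tendsto:
  fixes x :: "'a::euclidean_space"
  assumes R: "filterlim R at_top sequentially"
  shows "(\<lambda>k. floor_point (R k *\<^sub>R x) /\<^sub>R R k) \<longlonglongrightarrow> x"
proof (rule LIM_zero_cancel, rule Lim_null_comparison)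
  have "\<forall>\<^sub>F k in sequentially. R k > 0" using R by (simp add: filterlim_at_top_dense)
  then show "\<forall>\<^sub>F k in sequentially. norm (floor_point (R k *\<^sub>R x) /\<^sub>R R k - x) \<le> DIM('a) / R k"
  proof eventually_elim
    case (elim k)
    have "floor_point (R k *\<^sub>R x) /\<^sub>R R k - x = (floor_point (R k *\<^sub>R x) - R k *\<^sub>R x) /\<^sub>R R k"
      using elim by (simp add: scaleR_diff_right)
    then have "norm (floor_point (R k *\<^sub>R x) /\<^sub>R R k - x) = norm (R k *\<^sub>R x - floor_point (R k *\<^sub>R x)) / R k"
      using elim by (simp add: divide_inverse norm_minus_commute)
    also have "\<dots> \<le> DIM('a) / R k" using elim by (intro divide_right_mono floor_point_near) auto
    finally show ?case .
  qed
  show "(\<lambda>k. DIM('a) / R k) \<longlonglongrightarrow> 0" by (rule real_tendsto_divide_at_top[OF tendsto_const R])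
qed

text \<open>Dominated convergence. The growth bound confines the contributing points to a ball of
  radius proportional to \<open>R k\<close>. The Lipschitz bound gives a point and its half shift
  the same limit, so that doubling turns into the factor 1 plus the indicator of
  \<open>S\<close>.\<close>

lemma limit_integral:
  fixes e :: "'a::euclidean_space" and h H :: "'a \<Rightarrow> 'a" and g :: "'a \<Rightarrow> real"
  assumes e: "e \<in> Basis" and \<Lambda>: "\<Lambda> \<subseteq> lattice" and L: "L \<ge> 0" and C: "C \<ge> 0"
    and lip: "\<And>x y. x \<in> doubled e \<Lambda> \<Longrightarrow> y \<in> doubled e \<Lambda> \<Longrightarrow> norm (h x - h y) \<le> L * norm (x - y)"
    and grow: "\<And>y. y \<in> doubled e \<Lambda> \<Longrightarrow> norm y \<le> C * (1 + norm (h y))"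
    and R: "\<And>k. R k \<ge> 1" "filterlim R at_top sequentially"
    and S: "S \<in> sets lebesgue"
    and AES: "AE x in lebesgue. \<forall>\<^sub>F k in sequentially. floor_point (R k *\<^sub>R x) \<in> \<Lambda> \<longleftrightarrow> x \<in> S"
    and lim: "\<And>x. (\<lambda>k. h (floor_point (R k *\<^sub>R x)) /\<^sub>R R k) \<longlonglongrightarrow> H x"
    and H: "continuous_on UNIV H"
    and g: "continuous_on UNIV g" "\<And>y. 0 \<le> g y" "\<And>y. g y \<le> 1" "\<And>y. g y \<noteq> 0 \<Longrightarrow> norm y \<le> B"
  shows "(\<lambda>k. measure lebesgue (half_open_box (\<lambda>_. 1 / R k) (0::'a)) *
      (\<Sum>y\<in>{y\<in>doubled e \<Lambda>. g (h y /\<^sub>R R k) \<noteq> 0}. g (h y /\<^sub>R R k)))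
    \<longlonglongrightarrow> integral\<^sup>L lebesgue (\<lambda>x. g (H x) + indicator S x * g (H x))"
proof -
  define \<phi> where "\<phi> k z = g (h z /\<^sub>R R k) + indicator \<Lambda> z * g (h (z + (1/2) *\<^sub>R e) /\<^sub>R R k)" for k z
  have Rp: "R k > 0" for k using R(1)[of k] by linarith
  have supp: "norm y \<le> C * (1 + B * R k)" if "y \<in> doubled e \<Lambda>" "g (h y /\<^sub>R R k) \<noteq> 0" for k y
  proof -
    have "norm (h y /\<^sub>R R k) \<le> B" using g(4) that by blast
    then have "norm (h y) \<le> B * R k" using Rp[of k] by (simp add: field_simps)
    then have "C * (1 + norm (h y)) \<le> C * (1 + B * R k)" using C by (intro mult_left_mono) auto
    then show ?thesis using grow[OF that(1)] by linarith
  qed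
  have ID: "(\<lambda>x. \<phi> k (floor_point (R k *\<^sub>R x))) \<in> borel_measurable lebesgue"
    "integral\<^sup>L lebesgue (\<lambda>x. \<phi> k (floor_point (R k *\<^sub>R x))) =
      measure lebesgue (half_open_box (\<lambda>_. 1 / R k) (0::'a)) * (\<Sum>y\<in>{y\<in>doubled e \<Lambda>. g (h y /\<^sub>R R k) \<noteq> 0}. g (h y /\<^sub>R R k))" for k
  proof -
    have b: "\<And>y. y \<in> doubled e \<Lambda> \<Longrightarrow> g (h y /\<^sub>R R k) \<noteq> 0 \<Longrightarrow> norm y \<le> C * (1 + B * R k)" by (rule supp)
    note I = integral_doubled[where \<psi> = "\<lambda>y. g (h y /\<^sub>R R k)", OF e \<Lambda> Rp[of k] b]
    show "(\<lambda>x. \<phi> k (floor_point (R k *\<^sub>R x))) \<in> borel_measurable lebesgue" unfolding \<phi>_def by (rule I(1))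
    show "integral\<^sup>L lebesgue (\<lambda>x. \<phi> k (floor_point (R k *\<^sub>R x))) =
      measure lebesgue (half_open_box (\<lambda>_. 1 / R k) (0::'a)) * (\<Sum>y\<in>{y\<in>doubled e \<Lambda>. g (h y /\<^sub>R R k) \<noteq> 0}. g (h y /\<^sub>R R k))"
      unfolding \<phi>_def by (rule I(2))
  qed
  \<comment> \<open>Outside this radius the rounded point and its half shift are both beyond the
    bound of \<open>supp\<close>. The summands 1 and \<open>DIM('a)\<close> pay for the half shift
    and for rounding, as \<open>R k \<ge> 1\<close>.\<close>
  define B' where "B' = C * (1 + \<bar>B\<bar>) + 1 + real DIM('a)"
  have bound: "norm (\<phi> k (floor_point (R k *\<^sub>R x))) \<le> 2 * indicator (cball 0 B') x" for k x
  proof -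
    define z where "z = floor_point (R k *\<^sub>R x)"
    have zl: "z \<in> lattice" unfolding z_def by (rule floor_point_in_lattice)
    have le2: "norm (\<phi> k z) \<le> 2"
      unfolding \<phi>_def using g(2,3)[of "h z /\<^sub>R R k"] g(2,3)[of "h (z + (1/2) *\<^sub>R e) /\<^sub>R R k"] by (auto simp: indicator_def)
    have "\<phi> k z = 0" if x: "x \<notin> cball 0 B'"
    proof -
      have far: "norm (R k *\<^sub>R x) > B' * R k" using x Rp[of k] by (simp add: mult.commute)
      have nz: "norm z > C * (1 + B * R k) + 1"
      proof -
        have "C * (1 + B * R k) + 1 + real DIM('a) \<le> B' * R k"
        proof -
          have "C * 1 \<le> C * R k" using C R(1) by (intro mult_left_mono) auto
          moreover have "C * (B * R k) \<le> C * (\<bar>B\<bar> * R k)" using C Rp[of k] by (intro mult_left_mono mult_right_mono) auto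
          moreover have "(1 + real DIM('a)) * 1 \<le> (1 + real DIM('a)) * R k" using R(1) by (intro mult_left_mono) auto
          ultimately show ?thesis unfolding B'_def by (simp add: algebra_simps)
        qed
        moreover have "norm (R k *\<^sub>R x) \<le> norm z + real DIM('a)"
          using floor_point_near[of "R k *\<^sub>R x"] norm_triangle_ineq2[of "R k *\<^sub>R x" z] unfolding z_def by linarith
        ultimately show ?thesis using far by linarith
      qed
      have "g (h z /\<^sub>R R k) = 0" using supp[of z k] nz zl unfolding doubled_def by force
      moreover have "g (h (z + (1/2) *\<^sub>R e) /\<^sub>R R k) = 0" if zL: "z \<in> \<Lambda>"
      proof (rule ccontr)
        assume "\<not> ?thesis"
        then have "norm (z + (1/2) *\<^sub>R e) \<le> C * (1 + B * R k)" by (intro supp) (use zL in \<open>auto simp: doubled_def\<close>)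
        then show False using nz norm_triangle_ineq4[of "z + (1/2) *\<^sub>R e" "(1/2) *\<^sub>R e"] e by simp
      qed
      ultimately show ?thesis unfolding \<phi>_def by (auto simp: indicator_def)
    qed
    then show ?thesis using le2 unfolding z_def[symmetric] by (auto simp: indicator_def)
  qed
  have "(\<lambda>k. integral\<^sup>L lebesgue (\<lambda>x. \<phi> k (floor_point (R k *\<^sub>R x)))) \<longlonglongrightarrow> integral\<^sup>L lebesgue (\<lambda>x. g (H x) + indicator S x * g (H x))"
  proof (rule integral_dominated_convergence[where w = "\<lambda>x. 2 * indicator (cball 0 B') x"])
    have "continuous_on UNIV (\<lambda>x. g (H x))" by (rule continuous_on_compose2[OF g(1) H]) simp
    then have "(\<lambda>x. g (H x)) \<in> borel_measurable lebesgue" by (intro measurable_completion) (simp add: borel_measurable_continuous_onI)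
    then show "(\<lambda>x. g (H x) + indicator S x * g (H x)) \<in> borel_measurable lebesgue"
      using S by (intro borel_measurable_add borel_measurable_times borel_measurable_indicator)
    show "(\<lambda>x. \<phi> k (floor_point (R k *\<^sub>R x))) \<in> borel_measurable lebesgue" for k by (rule ID(1))
    show "integrable lebesgue (\<lambda>x. 2 * indicator (cball 0 B') x :: real)"
      using lmeasurable_cball[of 0 B'] by (intro integrable_mult_right integrable_real_indicator) (auto simp: fmeasurable_def)
    show "AE x in lebesgue. norm (\<phi> k (floor_point (R k *\<^sub>R x))) \<le> 2 * indicator (cball 0 B') x" for k
      by (intro AE_I2 bound)
    show "AE x in lebesgue. (\<lambda>k. \<phi> k (floor_point (R k *\<^sub>R x))) \<longlonglongrightarrow> g (H x) + indicator S x * g (H x)"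
      using AES
    proof (rule AE_mp, intro AE_I2 impI)
      fix x assume ev: "\<forall>\<^sub>F k in sequentially. floor_point (R k *\<^sub>R x) \<in> \<Lambda> \<longleftrightarrow> x \<in> S"
      define z where "z k = floor_point (R k *\<^sub>R x)" for k
      have zl: "z k \<in> doubled e \<Lambda>" for k unfolding z_def doubled_def using floor_point_in_lattice by blast
      \<comment> \<open>Off \<Lambda> the value is multiplied by 0; the lattice point itself is
        taken there, so that \<open>u\<close> converges in any case.\<close>
      define u where "u k = (if z k \<in> \<Lambda> then h (z k + (1/2) *\<^sub>R e) /\<^sub>R R k else h (z k) /\<^sub>R R k)" for k
      have gc: "isCont g y" for y using g(1) by (simp add: continuous_on_eq_continuous_at)
      have l1: "(\<lambda>k. h (z k) /\<^sub>R R k) \<longlonglongrightarrow> H x" unfolding z_def by (rule lim)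
      have "(\<lambda>k. u k - h (z k) /\<^sub>R R k) \<longlonglongrightarrow> 0"
      proof (rule Lim_null_comparison)
        show "\<forall>\<^sub>F k in sequentially. norm (u k - h (z k) /\<^sub>R R k) \<le> L / R k"
        proof (intro always_eventually allI)
          fix k
          show "norm (u k - h (z k) /\<^sub>R R k) \<le> L / R k"
          proof (cases "z k \<in> \<Lambda>")
            case True
            then have "norm (h (z k + (1/2) *\<^sub>R e) - h (z k)) \<le> L * norm ((1/2) *\<^sub>R e)"
              using lip[of "z k + (1/2) *\<^sub>R e" "z k"] zl[of k] by (simp add: doubled_def)
            also have "\<dots> \<le> L" using L e by simp
            finally have "norm (h (z k + (1/2) *\<^sub>R e) - h (z k)) / R k \<le> L / R k" using Rp[of k] by (intro divide_right_mono) auto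
            moreover have "u k - h (z k) /\<^sub>R R k = (h (z k + (1/2) *\<^sub>R e) - h (z k)) /\<^sub>R R k"
              unfolding u_def using True by (simp add: scaleR_diff_right)
            moreover have "norm (v /\<^sub>R R k) = norm v / R k" for v :: 'a using Rp[of k] by (simp add: divide_inverse)
            ultimately show ?thesis by (simp only:)
          next
            case False then show ?thesis using L Rp[of k] unfolding u_def by simp
          qed
        qed
        show "(\<lambda>k. L / R k) \<longlonglongrightarrow> 0" by (rule real_tendsto_divide_at_top[OF tendsto_const R(2)])
      qed
      from tendsto_add[OF this l1] have l2: "u \<longlonglongrightarrow> H x" by simp
      have ind: "(\<lambda>k. indicator \<Lambda> (z k) :: real) \<longlonglongrightarrow> indicator S x"
        by (rule tendsto_eventually, rule eventually_mono[OF ev]) (auto simp: z_def indicator_def)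
      have "(\<lambda>k. g (h (z k) /\<^sub>R R k) + indicator \<Lambda> (z k) * g (u k)) \<longlonglongrightarrow> g (H x) + indicator S x * g (H x)"
        by (intro tendsto_add tendsto_mult ind isCont_tendsto_compose[OF gc] l1 l2)
      moreover have "g (h (z k) /\<^sub>R R k) + indicator \<Lambda> (z k) * g (u k) = \<phi> k (z k)" for k
        unfolding \<phi>_def u_def by (auto simp: indicator_def)
      ultimately show "(\<lambda>k. \<phi> k (floor_point (R k *\<^sub>R x))) \<longlonglongrightarrow> g (H x) + indicator S x * g (H x)" unfolding z_def by simp
    qed
  qed
  then show ?thesis unfolding ID(2) .
qed

text \<open>The bumps decrease to the indicator of \<open>F\<close>, which carries identities for
  continuous test functions over to compact sets. The growth of \<open>H\<close> makes the preimages
  of their supports bounded.\<close>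

lemma integral_bump_tendsto:
  fixes H :: "'a::euclidean_space \<Rightarrow> 'a"
  assumes H: "continuous_on UNIV H" and C: "C \<ge> 0" "\<And>x. norm x \<le> C * norm (H x)"
    and F: "compact F" "F \<noteq> {}" and S: "S \<in> sets lebesgue"
  shows "(\<lambda>j. integral\<^sup>L lebesgue (\<lambda>x. max 0 (1 - real (Suc j) * infdist (H x) F) + indicator S x * max 0 (1 - real (Suc j) * infdist (H x) F)))
    \<longlonglongrightarrow> measure lebesgue (H -` F) + measure lebesgue (S \<inter> H -` F)"
    and "H -` F \<in> lmeasurable"
proof -
  have clF: "closed F" using F(1) by (rule compact_imp_closed)
  obtain B where B: "\<And>y. y \<in> F \<Longrightarrow> norm y \<le> B" using compact_imp_bounded[OF F(1)] unfolding bounded_iff by blast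
  have B0: "B \<ge> 0" using B F(2) norm_ge_zero order_trans by blast
  have "H -` F \<subseteq> cball 0 (C * B)"
  proof
    fix x assume "x \<in> H -` F"
    then have "C * norm (H x) \<le> C * B" using B C(1) by (intro mult_left_mono) auto
    then show "x \<in> cball 0 (C * B)" using C(2)[of x] by simp
  qed
  moreover have "closed (H -` F)" using closed_vimage[OF clF H] .
  ultimately have "compact (H -` F)" using bounded_subset[OF bounded_cball] by (simp add: compact_eq_bounded_closed)
  then show lm: "H -` F \<in> lmeasurable" by (rule lmeasurable_compact)
  have lmS: "S \<inter> H -` F \<in> lmeasurable" using lm S by (metis fmeasurable_Int_fmeasurable Int_commute)
  define t where "t j y = max 0 (1 - real (Suc j) * infdist y F)" for j y
  have t01: "0 \<le> t j y" "t j y \<le> 1" for j y unfolding t_def using infdist_nonneg[of y F] by auto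
  have t0: "t j y = 0" if "norm y > B + 1" for j y
  proof -
    have "infdist y F \<ge> 1"
    proof (rule ccontr)
      assume nt: "\<not> ?thesis"
      obtain w where w: "w \<in> F" "infdist y F = dist y w" by (rule infdist_attains_inf[OF clF F(2)])
      then have "norm (y - w) < 1" using nt by (simp add: dist_norm)
      then show False using B[OF w(1)] that norm_triangle_ineq2[of y w] by linarith
    qed
    then have "1 * 1 \<le> real (Suc j) * infdist y F" by (intro mult_mono) auto
    then show ?thesis unfolding t_def by simp
  qed
  have tlim: "(\<lambda>j. t j y) \<longlonglongrightarrow> indicator F y" for y
  proof (cases "y \<in> F")
    case True then show ?thesis unfolding t_def by simp
  next
    case False
    have i: "infdist y F > 0" by (rule infdist_pos_not_in_closed[OF clF F(2) False])
    obtain N :: nat where N: "1 / infdist y F < real N" using reals_Archimedean2 by blast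
    have "t j y = 0" if "j \<ge> N" for j
    proof -
      have "1 / infdist y F \<le> real (Suc j)" using N that by linarith
      then have "1 \<le> real (Suc j) * infdist y F" using i by (simp add: pos_divide_le_eq)
      then show ?thesis unfolding t_def by simp
    qed
    then have "\<forall>\<^sub>F j in sequentially. t j y = 0" unfolding eventually_sequentially by blast
    then show ?thesis using False by (simp add: tendsto_eventually)
  qed
  have "(\<lambda>j. integral\<^sup>L lebesgue (\<lambda>x. t j (H x) + indicator S x * t j (H x))) \<longlonglongrightarrow>
      integral\<^sup>L lebesgue (\<lambda>x. indicator F (H x) + indicator S x * indicator F (H x))"
  proof (rule integral_dominated_convergence[where w = "\<lambda>x. 2 * indicator (cball 0 (C * (B + 1))) x"])
    have Fm: "(\<lambda>x. indicator F (H x) :: real) \<in> borel_measurable lebesgue"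
    proof -
      have "(\<lambda>x. indicator F (H x) :: real) = indicator (H -` F)" by (auto simp: indicator_def)
      then show ?thesis using lm by (simp add: borel_measurable_indicator fmeasurableD)
    qed
    then show "(\<lambda>x. indicator F (H x) + indicator S x * indicator F (H x) :: real) \<in> borel_measurable lebesgue"
      using S by (intro borel_measurable_add borel_measurable_times borel_measurable_indicator)
    fix j
    have "continuous_on UNIV (\<lambda>x. t j (H x))" unfolding t_def by (intro continuous_intros H)
    then have "(\<lambda>x. t j (H x)) \<in> borel_measurable lebesgue" by (intro measurable_completion) (simp add: borel_measurable_continuous_onI)
    then show "(\<lambda>x. t j (H x) + indicator S x * t j (H x)) \<in> borel_measurable lebesgue"
      using S by (intro borel_measurable_add borel_measurable_times borel_measurable_indicator)
    have "norm (t j (H x) + indicator S x * t j (H x)) \<le> 2 * indicator (cball 0 (C * (B + 1))) x" for x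
    proof (cases "x \<in> cball 0 (C * (B + 1))")
      case True
      then show ?thesis using t01[of j "H x"] by (auto simp: indicator_def)
    next
      case False
      have "norm (H x) > B + 1"
      proof (rule ccontr)
        assume "\<not> ?thesis"
        then have "C * norm (H x) \<le> C * (B + 1)" using C(1) by (intro mult_left_mono) auto
        then show False using False C(2)[of x] by simp
      qed
      then show ?thesis using t0 by simp
    qed
    then show "AE x in lebesgue. norm (t j (H x) + indicator S x * t j (H x)) \<le> 2 * indicator (cball 0 (C * (B + 1))) x"
      by (intro AE_I2)
  next
    show "integrable lebesgue (\<lambda>x. 2 * indicator (cball 0 (C * (B + 1))) x :: real)"
      using lmeasurable_cball[of 0 "C * (B + 1)"] by (intro integrable_mult_right integrable_real_indicator) (auto simp: fmeasurable_def)
    show "AE x in lebesgue. (\<lambda>j. t j (H x) + indicator S x * t j (H x)) \<longlonglongrightarrow> indicator F (H x) + indicator S x * indicator F (H x)"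
      by (intro AE_I2 tendsto_intros tlim)
  qed
  also have "integral\<^sup>L lebesgue (\<lambda>x. indicator F (H x) + indicator S x * indicator F (H x) :: real)
     = integral\<^sup>L lebesgue (\<lambda>x. indicator (H -` F) x + indicator (S \<inter> H -` F) x)"
    by (intro Bochner_Integration.integral_cong refl) (auto simp: indicator_def)
  also have "\<dots> = measure lebesgue (H -` F) + measure lebesgue (S \<inter> H -` F)"
    using lm lmS by (subst Bochner_Integration.integral_add) (auto simp: fmeasurable_def intro!: integrable_real_indicator)
  finally show "(\<lambda>j. integral\<^sup>L lebesgue (\<lambda>x. max 0 (1 - real (Suc j) * infdist (H x) F) + indicator S x * max 0 (1 - real (Suc j) * infdist (H x) F)))
    \<longlonglongrightarrow> measure lebesgue (H -` F) + measure lebesgue (S \<inter> H -` F)" unfolding t_def .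
qed

text \<open>A bijection does not change the sum of a test function over the image points. Read over
  the source, the rescaled sums converge to an integral along \<open>H\<close> against the source
  density; read over the target, with the identity in place of \<open>h\<close>, to the integral
  against the target density.\<close>

lemma limit_map:
  fixes e :: "'a::euclidean_space" and h :: "'a \<Rightarrow> 'a"
  assumes e: "e \<in> Basis" and \<Lambda>: "\<Lambda>1 \<subseteq> lattice" "\<Lambda>2 \<subseteq> lattice" and L: "L \<ge> 0" and C: "C \<ge> 0"
    and bij: "bij_betw h (doubled e \<Lambda>1) (doubled e \<Lambda>2)"
    and lip: "\<And>x y. x \<in> doubled e \<Lambda>1 \<Longrightarrow> y \<in> doubled e \<Lambda>1 \<Longrightarrow> norm (h x - h y) \<le> L * norm (x - y)"
    and grow: "\<And>y. y \<in> doubled e \<Lambda>1 \<Longrightarrow> norm y \<le> C * (1 + norm (h y))"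
    and R: "\<And>k. R k \<ge> 1" "filterlim R at_top sequentially"
    and S: "S1 \<in> sets lebesgue" "S2 \<in> sets lebesgue"
    and AE1: "AE x in lebesgue. \<forall>\<^sub>F k in sequentially. floor_point (R k *\<^sub>R x) \<in> \<Lambda>1 \<longleftrightarrow> x \<in> S1"
    and AE2: "AE x in lebesgue. \<forall>\<^sub>F k in sequentially. floor_point (R k *\<^sub>R x) \<in> \<Lambda>2 \<longleftrightarrow> x \<in> S2"
  obtains H where "\<And>x y. norm (H x - H y) \<le> L * norm (x - y)"
    "\<And>F. compact F \<Longrightarrow> H -` F \<in> lmeasurable \<and>
       measure lebesgue (H -` F) + measure lebesgue (S1 \<inter> H -` F) = measure lebesgue F + measure lebesgue (S2 \<inter> F)"
proof -
  define f where "f k x = h (floor_point (R k *\<^sub>R x)) /\<^sub>R R k" for k x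
  have Rp: "R k > 0" for k using R(1)[of k] by linarith
  have fl: "floor_point x \<in> doubled e \<Lambda>1" for x unfolding doubled_def using floor_point_in_lattice by blast
  have flip: "norm (f k x - f k y) \<le> L * norm (x - y) + 2 * L * DIM('a) / R k" for k x y
  proof -
    have "norm (floor_point (R k *\<^sub>R x) - floor_point (R k *\<^sub>R y)) \<le> norm (R k *\<^sub>R x - R k *\<^sub>R y) + 2 * DIM('a)"
    proof -
      have "floor_point (R k *\<^sub>R x) - floor_point (R k *\<^sub>R y) = (R k *\<^sub>R x - R k *\<^sub>R y) - (R k *\<^sub>R x - floor_point (R k *\<^sub>R x)) + (R k *\<^sub>R y - floor_point (R k *\<^sub>R y))" by simp
      also have "norm \<dots> \<le> norm (R k *\<^sub>R x - R k *\<^sub>R y) + DIM('a) + DIM('a)"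
        by (intro order_trans[OF norm_triangle_ineq] add_mono order_trans[OF norm_triangle_ineq4] floor_point_near order_refl)
      finally show ?thesis by simp
    qed
    also have "norm (R k *\<^sub>R x - R k *\<^sub>R y) = R k * norm (x - y)" using Rp[of k] by (simp flip: scaleR_diff_right)
    finally have "L * norm (floor_point (R k *\<^sub>R x) - floor_point (R k *\<^sub>R y)) \<le> L * (R k * norm (x - y) + 2 * DIM('a))"
      using L by (intro mult_left_mono) auto
    then have "norm (h (floor_point (R k *\<^sub>R x)) - h (floor_point (R k *\<^sub>R y))) \<le> L * (R k * norm (x - y) + 2 * DIM('a))"
      using lip[OF fl fl, of "R k *\<^sub>R x" "R k *\<^sub>R y"] by linarith
    then have "norm (h (floor_point (R k *\<^sub>R x)) - h (floor_point (R k *\<^sub>R y))) / R k \<le> L * (R k * norm (x - y) + 2 * DIM('a)) / R k"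
      using Rp[of k] by (intro divide_right_mono) auto
    also have "\<dots> = L * norm (x - y) + 2 * L * DIM('a) / R k" using Rp[of k] by (simp add: field_simps)
    also have "norm (h (floor_point (R k *\<^sub>R x)) - h (floor_point (R k *\<^sub>R y))) / R k = norm (f k x - f k y)"
      unfolding f_def using Rp[of k] by (simp add: divide_inverse mult.commute flip: scaleR_diff_right)
    finally show ?thesis by (simp only:)
  qed
  have eps: "(\<lambda>k. 2 * L * DIM('a) / R k) \<longlonglongrightarrow> 0" by (rule real_tendsto_divide_at_top[OF tendsto_const R(2)])
  have f0: "norm (f k 0) \<le> norm (h 0)" for k
  proof -
    have "floor_point (0::'a) = 0" unfolding floor_point_def by simp
    then have "norm (f k 0) = norm (h 0) / R k" unfolding f_def using Rp[of k] by (simp add: divide_inverse mult.commute)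
    also have "\<dots> \<le> norm (h 0) / 1" using R(1)[of k] by (intro divide_left_mono) auto
    finally show ?thesis by simp
  qed
  obtain r H where r: "strict_mono (r :: nat \<Rightarrow> nat)" and lim: "\<And>x. (\<lambda>k. f (r k) x) \<longlonglongrightarrow> H x"
    and Hlip: "\<And>x y. norm (H x - H y) \<le> L * norm (x - y)"
    by (rule asymptotically_lipschitz_subsequence[OF L flip eps f0]) blast
  define R' where "R' k = R (r k)" for k
  have R': "R' k \<ge> 1" "R' k > 0" for k unfolding R'_def using R(1) Rp by auto
  have fr: "filterlim r at_top sequentially" by (rule filterlim_subseq[OF r])
  have R't: "filterlim R' at_top sequentially" unfolding R'_def by (rule filterlim_compose[OF R(2) fr])
  have sub: "AE x in lebesgue. \<forall>\<^sub>F k in sequentially. floor_point (R' k *\<^sub>R x) \<in> \<Lambda> \<longleftrightarrow> x \<in> S"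
    if "AE x in lebesgue. \<forall>\<^sub>F k in sequentially. floor_point (R k *\<^sub>R x) \<in> \<Lambda> \<longleftrightarrow> x \<in> S" for \<Lambda> S :: "'a set"
    using that
  proof (rule AE_mp, intro AE_I2 impI)
    fix x assume "\<forall>\<^sub>F k in sequentially. floor_point (R k *\<^sub>R x) \<in> \<Lambda> \<longleftrightarrow> x \<in> S"
    then show "\<forall>\<^sub>F k in sequentially. floor_point (R' k *\<^sub>R x) \<in> \<Lambda> \<longleftrightarrow> x \<in> S"
      unfolding R'_def by (rule eventually_compose_filterlim[OF _ fr])
  qed
  have lim': "(\<lambda>k. h (floor_point (R' k *\<^sub>R x)) /\<^sub>R R' k) \<longlonglongrightarrow> H x" for x using lim[of x] unfolding f_def R'_def .
  have "L-lipschitz_on UNIV H" using L Hlip by (intro lipschitz_onI) (auto simp: dist_norm)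
  then have Hc: "continuous_on UNIV H" by (rule lipschitz_on_continuous_on)
  \<comment> \<open>The additive constant of the growth bound vanishes under rescaling. What remains
    of the inverse is that preimages of bounded sets are bounded.\<close>
  have Hgrow: "norm x \<le> C * norm (H x)" for x
  proof (rule LIMSEQ_le)
    show "(\<lambda>k. norm (floor_point (R' k *\<^sub>R x) /\<^sub>R R' k)) \<longlonglongrightarrow> norm x"
      by (intro tendsto_norm rescaled_floor_tendsto R't)
    have "(\<lambda>k. C * (1 / R' k + norm (h (floor_point (R' k *\<^sub>R x)) /\<^sub>R R' k))) \<longlonglongrightarrow> C * (0 + norm (H x))"
      by (intro tendsto_mult tendsto_const tendsto_add tendsto_norm lim' real_tendsto_divide_at_top[OF tendsto_const R't])
    then show "(\<lambda>k. C * (1 / R' k + norm (h (floor_point (R' k *\<^sub>R x)) /\<^sub>R R' k))) \<longlonglongrightarrow> C * norm (H x)" by simp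
    have "norm (floor_point (R' k *\<^sub>R x) /\<^sub>R R' k) \<le> C * (1 / R' k + norm (h (floor_point (R' k *\<^sub>R x)) /\<^sub>R R' k))" for k
    proof -
      have "norm (floor_point (R' k *\<^sub>R x)) / R' k \<le> C * (1 + norm (h (floor_point (R' k *\<^sub>R x)))) / R' k"
        using grow[OF fl] R'(2)[of k] by (intro divide_right_mono) auto
      then show ?thesis using R'(2)[of k] by (simp add: divide_inverse algebra_simps)
    qed
    then show "\<exists>N. \<forall>k\<ge>N. norm (floor_point (R' k *\<^sub>R x) /\<^sub>R R' k) \<le> C * (1 / R' k + norm (h (floor_point (R' k *\<^sub>R x)) /\<^sub>R R' k))" by blast
  qed
  have Int: "integral\<^sup>L lebesgue (\<lambda>x. g (H x) + indicator S1 x * g (H x)) = integral\<^sup>L lebesgue (\<lambda>x. g x + indicator S2 x * g x)"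
    if g: "continuous_on UNIV g" "\<And>y. 0 \<le> g y" "\<And>y. g y \<le> 1" "\<And>y. g y \<noteq> 0 \<Longrightarrow> norm y \<le> B" for g :: "'a \<Rightarrow> real" and B
  proof -
    have 1: "(\<lambda>k. measure lebesgue (half_open_box (\<lambda>_. 1 / R' k) (0::'a)) *
        (\<Sum>y\<in>{y\<in>doubled e \<Lambda>1. g (h y /\<^sub>R R' k) \<noteq> 0}. g (h y /\<^sub>R R' k)))
      \<longlonglongrightarrow> integral\<^sup>L lebesgue (\<lambda>x. g (H x) + indicator S1 x * g (H x))"
      by (rule limit_integral[OF e \<Lambda>(1) L C lip grow R'(1) R't S(1) sub[OF AE1] lim' Hc g])
    have 2: "(\<lambda>k. measure lebesgue (half_open_box (\<lambda>_. 1 / R' k) (0::'a)) *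
        (\<Sum>y\<in>{y\<in>doubled e \<Lambda>2. g (y /\<^sub>R R' k) \<noteq> 0}. g (y /\<^sub>R R' k)))
      \<longlonglongrightarrow> integral\<^sup>L lebesgue (\<lambda>x. g x + indicator S2 x * g x)"
      by (rule limit_integral[where h = "\<lambda>y. y" and H = "\<lambda>x. x" and L = 1 and C = 1, OF e \<Lambda>(2) _ _ _ _ R'(1) R't S(2) sub[OF AE2] rescaled_floor_tendsto[OF R't] continuous_on_id g]) auto
    have "(\<Sum>y\<in>{y\<in>doubled e \<Lambda>1. g (h y /\<^sub>R R' k) \<noteq> 0}. g (h y /\<^sub>R R' k)) = (\<Sum>y\<in>{y\<in>doubled e \<Lambda>2. g (y /\<^sub>R R' k) \<noteq> 0}. g (y /\<^sub>R R' k))" for k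
    proof (rule sum.reindex_bij_betw)
      show "bij_betw h {y\<in>doubled e \<Lambda>1. g (h y /\<^sub>R R' k) \<noteq> 0} {y\<in>doubled e \<Lambda>2. g (y /\<^sub>R R' k) \<noteq> 0}"
        unfolding bij_betw_def
      proof
        show "inj_on h {y\<in>doubled e \<Lambda>1. g (h y /\<^sub>R R' k) \<noteq> 0}"
          using bij unfolding bij_betw_def by (auto intro: inj_on_subset)
        have "h ` doubled e \<Lambda>1 = doubled e \<Lambda>2" using bij unfolding bij_betw_def by simp
        then show "h ` {y\<in>doubled e \<Lambda>1. g (h y /\<^sub>R R' k) \<noteq> 0} = {y\<in>doubled e \<Lambda>2. g (y /\<^sub>R R' k) \<noteq> 0}" by auto
      qed
    qed
    then show ?thesis using LIMSEQ_unique[OF 1] 2 by simp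
  qed
  show thesis
  proof (rule that[OF Hlip])
    fix F :: "'a set" assume F: "compact F"
    show "H -` F \<in> lmeasurable \<and> measure lebesgue (H -` F) + measure lebesgue (S1 \<inter> H -` F) = measure lebesgue F + measure lebesgue (S2 \<inter> F)"
    proof (cases "F = {}")
      case False
      obtain B where B: "\<And>y. y \<in> F \<Longrightarrow> norm y \<le> B" using compact_imp_bounded[OF F] unfolding bounded_iff by blast
      note b1 = integral_bump_tendsto[OF Hc C Hgrow F False S(1)]
      have b2: "(\<lambda>j. integral\<^sup>L lebesgue (\<lambda>x. max 0 (1 - real (Suc j) * infdist x F) + indicator S2 x * max 0 (1 - real (Suc j) * infdist x F)))
        \<longlonglongrightarrow> measure lebesgue F + measure lebesgue (S2 \<inter> F)"
        using integral_bump_tendsto(1)[of "\<lambda>x. x" 1 F S2] F False S(2) by (simp add: continuous_on_id vimage_def)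
      have "integral\<^sup>L lebesgue (\<lambda>x. max 0 (1 - real (Suc j) * infdist (H x) F) + indicator S1 x * max 0 (1 - real (Suc j) * infdist (H x) F))
        = integral\<^sup>L lebesgue (\<lambda>x. max 0 (1 - real (Suc j) * infdist x F) + indicator S2 x * max 0 (1 - real (Suc j) * infdist x F))" for j
      proof (rule Int[of "\<lambda>y. max 0 (1 - real (Suc j) * infdist y F)" "B + 1"])
        show "continuous_on UNIV (\<lambda>y. max 0 (1 - real (Suc j) * infdist y F))" by (intro continuous_intros)
        show "norm y \<le> B + 1" if y: "max 0 (1 - real (Suc j) * infdist y F) \<noteq> 0" for y
        proof -
          have "real (Suc j) * infdist y F < 1" using y by (auto simp: max_def split: if_splits)
          moreover have "1 * infdist y F \<le> real (Suc j) * infdist y F" by (intro mult_right_mono infdist_nonneg) auto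
          ultimately have "infdist y F < 1" by linarith
          obtain w where w: "w \<in> F" "infdist y F = dist y w" by (rule infdist_attains_inf[OF compact_imp_closed[OF F] False])
          then have "norm (y - w) < 1" using \<open>infdist y F < 1\<close> by (simp add: dist_norm)
          then show ?thesis using B[OF w(1)] norm_triangle_ineq2[of y w] by linarith
        qed
      qed (auto simp: infdist_nonneg)
      then show ?thesis using LIMSEQ_unique[OF b1(1)] b2 b1(2) by simp
    qed simp
  qed
qed

text \<open>Disjoint balls of radius \<open>s / 2\<close> around the points all lie in the preimage
  of a ball of radius \<open>s * (1 + L)\<close>, whose volume is at most twice that of the ball.
  The ratio of the radii is \<open>2 * (1 + L)\<close>, which explains the number.\<close>

lemma packing_bound_of_measure:
  fixes H :: "'a::euclidean_space \<Rightarrow> 'a"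
  assumes L: "L \<ge> 0" and lip: "\<And>x y. norm (H x - H y) \<le> L * norm (x - y)"
    and pre: "\<And>F. compact F \<Longrightarrow> H -` F \<in> lmeasurable \<and> measure lebesgue (H -` F) \<le> 2 * measure lebesgue F"
  shows "packing_bound (nat \<lceil>2 * (2 * (1 + L)) ^ DIM('a)\<rceil>) H"
  unfolding packing_bound_def
proof (intro allI impI)
  fix s :: real and y :: 'a and X assume s: "s > 0" and X: "finite X"
    and sep: "\<forall>x\<in>X. \<forall>x'\<in>X. x \<noteq> x' \<longrightarrow> dist x x' > s" and HX: "H ` X \<subseteq> cball y s"
  define \<omega> where "\<omega> = unit_ball_vol (real DIM('a))"
  have \<omega>: "\<omega> > 0" unfolding \<omega>_def by simp
  define F where "F = cball y (s * (1 + L))"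
  have F: "H -` F \<in> lmeasurable" "measure lebesgue (H -` F) \<le> 2 * measure lebesgue F" using pre[of F] unfolding F_def by auto
  have "real (card X) * (\<omega> * (s / 2) ^ DIM('a)) = (\<Sum>x\<in>X. measure lebesgue (ball x (s / 2)))"
    using s by (simp add: content_ball \<omega>_def)
  also have "\<dots> = measure lebesgue (\<Union>x\<in>X. ball x (s / 2))"
  proof (rule measure_UNION'[symmetric, OF X])
    show "pairwise (\<lambda>x x'. disjnt (ball x (s / 2)) (ball x' (s / 2))) X"
      unfolding pairwise_def
    proof (intro ballI impI)
      fix x x' assume "x \<in> X" "x' \<in> X" "x \<noteq> x'"
      then have "dist x x' > s" using sep by blast
      then show "disjnt (ball x (s / 2)) (ball x' (s / 2))" unfolding disjnt_def by (intro disjoint_ballI) simp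
    qed
  qed simp
  also have "\<dots> \<le> measure lebesgue (H -` F)"
  proof (rule measure_mono_fmeasurable[OF _ _ F(1)])
    show "(\<Union>x\<in>X. ball x (s / 2)) \<subseteq> H -` F"
    proof
      fix u assume "u \<in> (\<Union>x\<in>X. ball x (s / 2))"
      then obtain x where x: "x \<in> X" "dist x u < s / 2" by auto
      have "dist (H x) (H u) \<le> L * dist x u" using lip by (simp add: dist_norm)
      also have "\<dots> \<le> L * s" using x L s by (intro mult_left_mono) auto
      finally have "dist (H x) (H u) \<le> L * s" .
      moreover have "dist y (H x) \<le> s" using HX x(1) by auto
      ultimately have "dist y (H u) \<le> s * (1 + L)" using dist_triangle[of y "H u" "H x"] by (simp add: algebra_simps)
      then show "u \<in> H -` F" unfolding F_def by simp
    qed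
  qed (use X in \<open>auto intro!: sets.finite_UN\<close>)
  also have "\<dots> \<le> 2 * measure lebesgue F" by (rule F(2))
  also have "\<dots> = 2 * (\<omega> * (s * (1 + L)) ^ DIM('a))" unfolding F_def using s L by (simp add: content_cball \<omega>_def)
  also have "s * (1 + L) = (2 * (1 + L)) * (s / 2)" by (simp add: field_simps)
  also have "((2 * (1 + L)) * (s / 2)) ^ DIM('a) = (2 * (1 + L)) ^ DIM('a) * (s / 2) ^ DIM('a)" by (rule power_mult_distrib)
  finally have "real (card X) * (\<omega> * (s / 2) ^ DIM('a)) \<le> (2 * (2 * (1 + L)) ^ DIM('a)) * (\<omega> * (s / 2) ^ DIM('a))"
    by (simp only: mult.assoc mult.left_commute)
  moreover have "\<omega> * (s / 2) ^ DIM('a) > 0" using \<omega> s by simp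
  ultimately have "real (card X) \<le> 2 * (2 * (1 + L)) ^ DIM('a)" by (simp only: mult_le_cancel_right_pos)
  then show "card X \<le> nat \<lceil>2 * (2 * (1 + L)) ^ DIM('a)\<rceil>" by linarith
qed

text \<open>Densities between 1 and 2 on both sides give preimages at most twice as large, hence a
  packing bound, hence sheets. Over the ball below the sheets the balance is a finite sum, which
  only has to be parametrised so that one sheet weighted by \<open>S\<close> is the
  identity.\<close>

lemma no_balanced_map:
  fixes H :: "'a::euclidean_space \<Rightarrow> 'a"
  assumes e: "e \<in> Basis" and d: "DIM('a) \<ge> 2" and L: "L \<ge> 0"
    and lip: "\<And>x y. norm (H x - H y) \<le> L * norm (x - y)"
    and pat: "pattern_sequence e a p SS S"
    and add: "\<And>k. \<exists>\<^sub>\<infinity>n. p n = k \<and> SS (Suc n) = SS n \<union> pattern_cells e a p n"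
    and rem: "\<And>k. \<exists>\<^sub>\<infinity>n. p n = k \<and> SS (Suc n) = SS n - pattern_cells e a p n"
    and bal: "\<And>F. compact F \<Longrightarrow> H -` F \<in> lmeasurable \<and>
       measure lebesgue (H -` F) + measure lebesgue (S1 \<inter> H -` F) = measure lebesgue F + measure lebesgue (S2 \<inter> F)"
    and S12: "S1 = S \<and> S2 = {} \<or> S1 = {} \<and> S2 = S"
  shows False
proof -
  have Sm: "S \<in> sets lebesgue" using pat unfolding pattern_sequence_def by blast
  then have S2m: "S2 \<in> sets lebesgue" using S12 by auto
  have "H -` F \<in> lmeasurable \<and> measure lebesgue (H -` F) \<le> 2 * measure lebesgue F" if F: "compact F" for F
  proof -
    have "measure lebesgue (S2 \<inter> F) \<le> measure lebesgue F"
      using S2m lmeasurable_compact[OF F] by (intro measure_mono_fmeasurable sets.Int) (auto simp: fmeasurableD)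
    then show ?thesis using bal[OF F] measure_nonneg[of lebesgue "S1 \<inter> H -` F"] by linarith
  qed
  then obtain N where pk: "packing_bound N H" using packing_bound_of_measure[OF L lip] by blast
  obtain y0 r0 m \<phi> where r0: "r0 > 0" and m: "m \<ge> (1::nat)"
    and \<phi>lip: "\<And>i y y'. i < m \<Longrightarrow> y \<in> ball y0 r0 \<Longrightarrow> y' \<in> ball y0 r0 \<Longrightarrow> norm (\<phi> i y - \<phi> i y') \<le> (real N + 1) * norm (y - y')"
    and H\<phi>: "\<And>i y. i < m \<Longrightarrow> y \<in> ball y0 r0 \<Longrightarrow> H (\<phi> i y) = y"
    and all: "\<And>u. H u \<in> ball y0 r0 \<Longrightarrow> \<exists>i<m. u = \<phi> i (H u)"
    and disj: "\<And>i j y. i < m \<Longrightarrow> j < m \<Longrightarrow> i \<noteq> j \<Longrightarrow> y \<in> ball y0 r0 \<Longrightarrow> \<phi> i y \<noteq> \<phi> j y"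
    and op: "\<And>i. i < m \<Longrightarrow> open (\<phi> i ` ball y0 r0)"
  proof (rule sheets[OF L lip pk], goal_cases)
    case (1 r0 m y0 \<phi>)
    show ?case by (rule 1(1)[OF 1(2-8)])
  qed
  define V where "V = ball y0 r0"
  have \<phi>lm: "\<phi> i ` F \<in> lmeasurable" if "compact F" "F \<subseteq> V" "i < m" for F i
  proof -
    have "(real N + 1)-lipschitz_on F (\<phi> i)" using \<phi>lip that unfolding V_def by (intro lipschitz_onI) (auto simp: dist_norm subset_iff)
    then show ?thesis by (intro lmeasurable_compact compact_continuous_image that lipschitz_on_continuous_on)
  qed
  have pre: "measure lebesgue (T \<inter> H -` F) = (\<Sum>i<m. measure lebesgue (T \<inter> \<phi> i ` F))"
    if F: "compact F" "F \<subseteq> V" and T: "T \<in> sets lebesgue" for F T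
  proof -
    have "T \<inter> H -` F = (\<Union>i<m. T \<inter> \<phi> i ` F)"
    proof (intro equalityI subsetI)
      fix u assume u: "u \<in> T \<inter> H -` F"
      then have "H u \<in> ball y0 r0" using F(2) unfolding V_def by blast
      then obtain i where "i < m" "u = \<phi> i (H u)" using all by blast
      then show "u \<in> (\<Union>i<m. T \<inter> \<phi> i ` F)" using u by blast
    next
      fix u assume "u \<in> (\<Union>i<m. T \<inter> \<phi> i ` F)"
      then obtain i y where "i < m" "u \<in> T" "y \<in> F" "u = \<phi> i y" by blast
      then show "u \<in> T \<inter> H -` F" using H\<phi>[of i y] F(2) unfolding V_def by auto
    qed
    moreover have "measure lebesgue (\<Union>i<m. T \<inter> \<phi> i ` F) = (\<Sum>i<m. measure lebesgue (T \<inter> \<phi> i ` F))"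
    proof (rule measure_UNION')
      show "T \<inter> \<phi> i ` F \<in> lmeasurable" if "i \<in> {..<m}" for i
        using \<phi>lm[OF F, of i] that T by (metis fmeasurable_Int_fmeasurable Int_commute lessThan_iff)
      show "pairwise (\<lambda>i j. disjnt (T \<inter> \<phi> i ` F) (T \<inter> \<phi> j ` F)) {..<m}"
        unfolding pairwise_def disjnt_iff
      proof (intro ballI impI allI notI, elim conjE IntE imageE)
        fix i j u y y' assume *: "i \<in> {..<m}" "j \<in> {..<m}" "i \<noteq> j" "u = \<phi> i y" "y \<in> F" "u = \<phi> j y'" "y' \<in> F"
        then have "H (\<phi> i y) = y" "H (\<phi> j y') = y'" using H\<phi> F(2) unfolding V_def by blast+
        then have "y = y'" using *(4,6) by simp
        then show False using disj[of i j y] * F(2) unfolding V_def by auto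
      qed
    qed simp
    ultimately show ?thesis by simp
  qed
  have idn: "(\<Sum>i<m. measure lebesgue (\<phi> i ` F)) + measure lebesgue (S1 \<inter> H -` F) = measure lebesgue F + measure lebesgue (S2 \<inter> F)"
    if F: "compact F" "F \<subseteq> V" for F
    using bal[OF F(1)] pre[OF F, of UNIV] by simp
  \<comment> \<open>One constant for all maps involved: \<open>L\<close> bounds \<open>H\<close>,
    \<open>N + 1\<close> bounds the sheets, and the product bounds their compositions.\<close>
  define M where "M = (real N + 1) * (L + 1)"
  have M: "M \<ge> 1" "M \<ge> L" "M \<ge> real N + 1" "M \<ge> (real N + 1) * L"
  proof -
    have "1 * 1 \<le> M" "1 * L \<le> M" "(real N + 1) * 1 \<le> M" "(real N + 1) * L \<le> M"
      unfolding M_def using L by (intro mult_mono; simp)+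
    then show "M \<ge> 1" "M \<ge> L" "M \<ge> real N + 1" "M \<ge> (real N + 1) * L" by auto
  qed
  have Mle: "t \<le> M * norm v" if "t \<le> c * norm v" "c \<le> M" for t c and v :: 'a
    using that mult_right_mono[OF that(2) norm_ge_zero[of v]] by linarith
  show False
    using S12
  proof
    assume S: "S1 = S \<and> S2 = {}"
    \<comment> \<open>With \<open>S\<close> on the source, the parameters range over a ball
      \<open>W\<close> inside sheet 0. Composing with \<open>H\<close> makes this sheet the
      identity. Index \<open>m\<close> is the image in the target, which enters with sign -1 and
      without \<open>S\<close>.\<close>
    define \<xi> where "\<xi> i x = (if i < m then \<phi> i (H x) else H x)" for i x
    have "\<phi> 0 y0 \<in> \<phi> 0 ` V" unfolding V_def using r0 by simp
    then obtain rW where rW: "rW > 0" "ball (\<phi> 0 y0) rW \<subseteq> \<phi> 0 ` V"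
      using op[of 0] m unfolding V_def open_contains_ball by (metis less_le_trans zero_less_one)
    define W where "W = ball (\<phi> 0 y0) rW"
    have W\<phi>: "\<phi> 0 (H x) = x" "H x \<in> V" if x: "x \<in> W" for x
    proof -
      obtain y where "y \<in> V" "x = \<phi> 0 y" using x rW(2) unfolding W_def by blast
      then show "\<phi> 0 (H x) = x" "H x \<in> V" using H\<phi>[of 0 y] m unfolding V_def by auto
    qed
    show False
    proof (rule no_balanced_sheets[OF e d, where W = W and I = "{..m}" and J = "{..<m}" and ?i0.0 = 0 and M = M and \<xi> = \<xi> and S = S
          and s = "\<lambda>i. if i < m then 1 else - 1"])
      show "norm (\<xi> i x - \<xi> i y) \<le> M * norm (x - y)" if i: "i \<in> {..m}" and xy: "x \<in> W" "y \<in> W" for i x y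
      proof (cases "i < m")
        case True
        have "norm (\<xi> i x - \<xi> i y) \<le> (real N + 1) * norm (H x - H y)"
          unfolding \<xi>_def using True \<phi>lip[OF True] W\<phi>(2)[OF xy(1)] W\<phi>(2)[OF xy(2)] unfolding V_def by simp
        also have "\<dots> \<le> (real N + 1) * (L * norm (x - y))" by (intro mult_left_mono lip) simp
        finally show ?thesis by (intro Mle[OF _ M(4)]) (simp add: mult.assoc)
      next
        case False
        then show ?thesis unfolding \<xi>_def using Mle[OF lip M(2)] by simp
      qed
      show "norm (x - y) \<le> M * norm (\<xi> i x - \<xi> i y)" if i: "i \<in> {..m}" and xy: "x \<in> W" "y \<in> W" for i x y
      proof -
        have *: "norm (x - y) \<le> (real N + 1) * norm (H x - H y)"
          using \<phi>lip[of 0 "H x" "H y"] m W\<phi>[OF xy(1)] W\<phi>[OF xy(2)] unfolding V_def by simp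
        show ?thesis
        proof (cases "i < m")
          case True
          have "norm (H x - H y) \<le> L * norm (\<xi> i x - \<xi> i y)"
            using lip[of "\<phi> i (H x)" "\<phi> i (H y)"] H\<phi>[OF True] W\<phi>(2)[OF xy(1)] W\<phi>(2)[OF xy(2)] True unfolding \<xi>_def V_def by simp
          then have "(real N + 1) * norm (H x - H y) \<le> (real N + 1) * (L * norm (\<xi> i x - \<xi> i y))" by (intro mult_left_mono) auto
          then have "norm (x - y) \<le> ((real N + 1) * L) * norm (\<xi> i x - \<xi> i y)" using * unfolding mult.assoc by linarith
          then show ?thesis by (rule Mle[OF _ M(4)])
        next
          case False
          then show ?thesis unfolding \<xi>_def using Mle[OF * M(3)] by simp
        qed
      qed
      show "\<xi> 0 x = x" if "x \<in> W" for x using W\<phi>(1)[OF that] m unfolding \<xi>_def by simp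
      show "(\<Sum>i\<in>{..m}. (if i < m then 1 else - 1) * measure lebesgue (\<xi> i ` F)) + (\<Sum>i\<in>{..<m}. measure lebesgue (S \<inter> \<xi> i ` F)) = 0"
        if F: "compact F" "F \<subseteq> W" for F
      proof -
        have "L-lipschitz_on F H" using L lip by (intro lipschitz_onI) (auto simp: dist_norm)
        then have F': "compact (H ` F)" by (intro compact_continuous_image F lipschitz_on_continuous_on)
        have F'V: "H ` F \<subseteq> V" using W\<phi>(2) F(2) by blast
        have im: "\<xi> i ` F = \<phi> i ` H ` F" if "i < m" for i using that unfolding \<xi>_def by (simp add: image_image)
        have im': "\<xi> m ` F = H ` F" unfolding \<xi>_def by simp
        have "(\<Sum>i\<in>{..m}. (if i < m then 1 else - 1) * measure lebesgue (\<xi> i ` F)) = (\<Sum>i<m. measure lebesgue (\<phi> i ` H ` F)) - measure lebesgue (H ` F)"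
          unfolding lessThan_Suc_atMost[symmetric] sum.lessThan_Suc im' by (simp add: im)
        moreover have "(\<Sum>i\<in>{..<m}. measure lebesgue (S \<inter> \<xi> i ` F)) = measure lebesgue (S \<inter> H -` H ` F)"
          unfolding pre[OF F' F'V Sm] by (simp add: im)
        ultimately show ?thesis using idn[OF F' F'V] S by simp
      qed
      show "0 \<in> {..<m}" using m by simp
    qed (use M(1) rW pat add rem in \<open>auto simp: W_def\<close>)
  next
    assume S: "S1 = {} \<and> S2 = S"
    \<comment> \<open>With \<open>S\<close> on the target, the target ball itself is the parameter
      space. Index \<open>m\<close> is the identity and the only sheet weighted by \<open>S\<close>;
      the preimages enter with sign -1.\<close>
    define \<xi> where "\<xi> i x = (if i < m then \<phi> i x else x)" for i x
    show False
    proof (rule no_balanced_sheets[OF e d, where W = V and I = "{..m}" and J = "{m}" and ?i0.0 = m and M = M and \<xi> = \<xi> and S = S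
          and s = "\<lambda>i. if i < m then - 1 else 1"])
      show "norm (\<xi> i x - \<xi> i y) \<le> M * norm (x - y)" if i: "i \<in> {..m}" and xy: "x \<in> V" "y \<in> V" for i x y
      proof (cases "i < m")
        case True
        then show ?thesis unfolding \<xi>_def using Mle[OF \<phi>lip[OF True, of x y] M(3)] xy unfolding V_def by simp
      next
        case False
        then show ?thesis unfolding \<xi>_def using Mle[of "norm (x - y)" 1 "x - y"] M(1) by simp
      qed
      show "norm (x - y) \<le> M * norm (\<xi> i x - \<xi> i y)" if i: "i \<in> {..m}" and xy: "x \<in> V" "y \<in> V" for i x y
      proof (cases "i < m")
        case True
        then have "norm (x - y) \<le> L * norm (\<xi> i x - \<xi> i y)"
          using lip[of "\<phi> i x" "\<phi> i y"] H\<phi>[OF True] xy unfolding \<xi>_def V_def by simp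
        then show ?thesis by (rule Mle[OF _ M(2)])
      next
        case False
        then show ?thesis unfolding \<xi>_def using Mle[of "norm (x - y)" 1 "x - y"] M(1) by simp
      qed
      show "(\<Sum>i\<in>{..m}. (if i < m then - 1 else 1) * measure lebesgue (\<xi> i ` F)) + (\<Sum>i\<in>{m}. measure lebesgue (S \<inter> \<xi> i ` F)) = 0"
        if F: "compact F" "F \<subseteq> V" for F
      proof -
        have im: "\<xi> i ` F = \<phi> i ` F" if "i < m" for i using that unfolding \<xi>_def by simp
        have im': "\<xi> m ` F = F" unfolding \<xi>_def by simp
        have "(\<Sum>i\<in>{..m}. (if i < m then - 1 else 1) * measure lebesgue (\<xi> i ` F)) = measure lebesgue F - (\<Sum>i<m. measure lebesgue (\<phi> i ` F))"
          unfolding lessThan_Suc_atMost[symmetric] sum.lessThan_Suc im' by (simp add: im sum_negf)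
        then show ?thesis using idn[OF F] S im' by simp
      qed
      show "\<xi> m x = x" for x unfolding \<xi>_def by simp
    qed (use M(1) r0 pat add rem in \<open>auto simp: V_def\<close>)
  qed
qed

section \<open>The Delone set and the reduction of homogeneity to linear growth\<close>

lemma lattice_separated:
  fixes x y :: "'a::euclidean_space"
  assumes "x \<in> lattice" "y \<in> lattice" "x \<noteq> y"
  shows "norm (x - y) \<ge> 1"
proof -
  obtain b where b: "b \<in> Basis" "x \<bullet> b \<noteq> y \<bullet> b" using assms(3) euclidean_eqI by blast
  obtain k k' :: int where k: "x \<bullet> b = of_int k" "y \<bullet> b = of_int k'" using assms(1,2) b(1) unfolding lattice_def by (metis (mono_tags, lifting) Ints_cases mem_Collect_eq)
  then have "k \<noteq> k'" using b by auto
  then have "1 \<le> \<bar>k - k'\<bar>" by linarith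
  then have "1 \<le> \<bar>real_of_int (k - k')\<bar>" by linarith
  then have "1 \<le> \<bar>(x - y) \<bullet> b\<bar>" using k by (simp add: inner_diff_left)
  also have "\<dots> \<le> norm (x - y)" by (rule Basis_le_norm[OF b(1)])
  finally show ?thesis .
qed

lemma delone_doubled:
  fixes e :: "'a::euclidean_space"
  assumes e: "e \<in> Basis" and \<Lambda>: "\<Lambda> \<subseteq> lattice"
  shows "delone (doubled e \<Lambda>)"
  unfolding delone_def
proof
  have e_l: "e \<in> lattice" unfolding lattice_def using e by (auto simp: inner_Basis)
  \<comment> \<open>Doubling all coordinates lands in the lattice, whose points have distance at
    least 1. So distances here are at least 1/2.\<close>
  have two: "2 *\<^sub>R y \<in> lattice" if "y \<in> doubled e \<Lambda>" for y
    using that \<Lambda> e_l unfolding doubled_def lattice_def by (auto simp: inner_add_left subset_iff)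
  have sep: "norm (x - y) \<ge> 1/2" if "x \<in> doubled e \<Lambda>" "y \<in> doubled e \<Lambda>" "x \<noteq> y" for x y
    using lattice_separated[OF two[OF that(1)] two[OF that(2)]] that(3) by (simp flip: scaleR_diff_right)
  have "\<exists>\<^sub>\<le>\<^sub>1y. y \<in> doubled e \<Lambda> \<inter> cball z (1/5)" for z
  proof (rule Uniq_I, rule ccontr)
    fix x y assume xy: "x \<in> doubled e \<Lambda> \<inter> cball z (1/5)" "y \<in> doubled e \<Lambda> \<inter> cball z (1/5)" "x \<noteq> y"
    then have "norm (x - y) \<ge> 1/2" using sep by blast
    moreover have "dist x y \<le> 1/5 + 1/5" using xy dist_triangle[of x y z] by (simp add: dist_commute)
    ultimately show False by (simp add: dist_norm)
  qed
  then show "\<exists>s>0. \<forall>z. \<exists>\<^sub>\<le>\<^sub>1y. y \<in> doubled e \<Lambda> \<inter> cball z s" by (intro exI[of _ "1/5"]) auto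
  show "\<exists>S>0. \<forall>z. \<exists>y. y \<in> doubled e \<Lambda> \<inter> cball z S"
  proof (intro exI[of _ "real DIM('a)"] conjI allI)
    fix z :: 'a
    have "floor_point z \<in> doubled e \<Lambda> \<inter> cball z (real DIM('a))"
      unfolding doubled_def using floor_point_in_lattice[of z] floor_point_near[of z] by (simp add: dist_norm)
    then show "\<exists>y. y \<in> doubled e \<Lambda> \<inter> cball z (real DIM('a))" by blast
  qed simp
qed

lemma homogeneous_linear_growth:
  assumes "homogeneous_on K g" "0 \<in> K"
  obtains C where "C \<ge> 0" "\<And>u. u \<in> K \<Longrightarrow> norm (g u) \<le> C * (1 + norm u)"
proof -
  obtain \<omega> c where \<omega>: "modulus \<omega>" and c: "c > 0"
    "\<And>R x y. R > 0 \<Longrightarrow> x \<in> ball 0 R \<inter> K \<Longrightarrow> y \<in> ball 0 R \<inter> K \<Longrightarrow> norm (g x - g y) \<le> c * R * \<omega> (norm (x - y) / R)"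
    using assms(1) unfolding homogeneous_on_def omega_homogeneous_on_def by blast
  have \<omega>1: "\<omega> 1 \<ge> 0" using \<omega> unfolding modulus_def by auto
  show thesis
  proof (rule that)
    show "norm (g 0) + 2 * c * \<omega> 1 \<ge> 0" using c(1) \<omega>1 by simp
    fix u assume u: "u \<in> K"
    \<comment> \<open>Both \<open>u\<close> and 0 lie in this ball, and the argument of \<omega> is
      at most 1, a point of its domain. A single value of \<omega> thus serves for every
      \<open>u\<close>.\<close>
    define R where "R = 2 * (1 + norm u)"
    have R: "R > 0" unfolding R_def by (simp add: add_pos_nonneg)
    have "norm (u - 0) / R \<in> {0..<2}" "norm (u - 0) / R \<le> 1" unfolding R_def by (auto simp: field_simps add_pos_nonneg)
    then have le: "\<omega> (norm (u - 0) / R) \<le> \<omega> 1" using \<omega> unfolding modulus_def by (intro mono_onD[of "{0..<2}" \<omega>]) auto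
    have "norm u < 1 + norm u" by simp
    also have "\<dots> \<le> R" unfolding R_def by simp
    finally have "u \<in> ball 0 R \<inter> K" "0 \<in> ball 0 R \<inter> K" using u assms(2) R by auto
    then have "norm (g u - g 0) \<le> c * R * \<omega> (norm (u - 0) / R)" by (rule c(2)[OF R])
    also have "\<dots> \<le> c * R * \<omega> 1" using le c(1) R by (intro mult_left_mono) auto
    finally have "norm (g u) \<le> norm (g 0) * 1 + c * R * \<omega> 1" using norm_triangle_ineq2[of "g u" "g 0"] by simp
    also have "\<dots> \<le> norm (g 0) * (1 + norm u) + c * R * \<omega> 1" by (intro add_right_mono mult_left_mono) auto
    also have "\<dots> = (norm (g 0) + 2 * c * \<omega> 1) * (1 + norm u)" unfolding R_def by (simp add: algebra_simps)
    finally show "norm (g u) \<le> (norm (g 0) + 2 * c * \<omega> 1) * (1 + norm u)" .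
  qed
qed

text \<open>Different scales use disjoint shells of lattice points; shell \<open>k\<close> carries a
  copy of \<open>SS k\<close> magnified by \<open>R k\<close>. After rescaling, the shells have
  inner radius 2^-k and outer radius 2^k, so they exhaust everything except the origin.\<close>

lemma unmappable_doubled_lattice:
  fixes e :: "'a::euclidean_space"
  assumes e: "e \<in> Basis" and d: "DIM('a) \<ge> 2"
  obtains \<Lambda> where "\<Lambda> \<subseteq> lattice"
    "\<And>\<Lambda>1 \<Lambda>2 h L C. \<Lambda>1 = \<Lambda> \<and> \<Lambda>2 = {} \<or> \<Lambda>1 = {} \<and> \<Lambda>2 = \<Lambda> \<Longrightarrow> bij_betw h (doubled e \<Lambda>1) (doubled e \<Lambda>2) \<Longrightarrow>
       L \<ge> 0 \<Longrightarrow> C \<ge> 0 \<Longrightarrow>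
       (\<And>x y. x \<in> doubled e \<Lambda>1 \<Longrightarrow> y \<in> doubled e \<Lambda>1 \<Longrightarrow> norm (h x - h y) \<le> L * norm (x - y)) \<Longrightarrow>
       (\<And>y. y \<in> doubled e \<Lambda>1 \<Longrightarrow> norm y \<le> C * (1 + norm (h y))) \<Longrightarrow> False"
proof -
  obtain a p SS S where pat: "pattern_sequence e a p SS S"
    and add: "\<And>k. \<exists>\<^sub>\<infinity>n. p n = k \<and> SS (Suc n) = SS n \<union> pattern_cells e a p n"
    and rem: "\<And>k. \<exists>\<^sub>\<infinity>n. p n = k \<and> SS (Suc n) = SS n - pattern_cells e a p n"
    and dy: "\<And>n. dyadic (a n) (SS n)"
    by (rule pattern_sequence_exists[of e]) blast
  \<comment> \<open>The quadratic part keeps consecutive shells, of width \<open>k\<close> on either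
    side in the exponent, from overlapping. The sum makes the rescaled lattice at least as fine as
    the grid of \<open>SS k\<close>.\<close>
  define \<beta> where "\<beta> k = k * k + 3 * k + (\<Sum>j\<le>k. a j)" for k
  have \<beta>k: "k \<le> \<beta> k" and \<beta>a: "a k \<le> \<beta> k" for k
    unfolding \<beta>_def using member_le_sum[of k "{..k}" a] by auto
  have step: "\<beta> k + k \<le> \<beta> (Suc k) - Suc k" for k unfolding \<beta>_def by simp
  have gap: "\<beta> k + k \<le> \<beta> k' - k'" if "k < k'" for k k'
    using that
  proof (induction k')
    case (Suc k')
    show ?case
    proof (cases "k = k'")
      case False
      then have "\<beta> k + k \<le> \<beta> k' - k'" using Suc by simp
      also have "\<dots> \<le> \<beta> k' + k'" by simp
      also have "\<dots> \<le> \<beta> (Suc k') - Suc k'" by (rule step)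
      finally show ?thesis .
    qed (use step in simp)
  qed simp
  define R where "R k = (2::real) ^ \<beta> k" for k
  define shell where "shell k z \<longleftrightarrow> 2 ^ (\<beta> k - k) \<le> norm z \<and> norm z < 2 ^ (\<beta> k + k)" for k and z :: 'a
  have shell_less: "\<not> (shell k z \<and> shell k' z)" if "k < k'" for k k' z
  proof -
    have "(2::real) ^ (\<beta> k + k) \<le> 2 ^ (\<beta> k' - k')" using gap[OF that] by (intro power_increasing) auto
    then show ?thesis unfolding shell_def by linarith
  qed
  then have shell_unique: "k = k'" if "shell k z" "shell k' z" for k k' z using that by (metis nat_neq_iff)
  define \<Lambda> where "\<Lambda> = {z \<in> lattice. \<exists>k. shell k z \<and> z /\<^sub>R R k \<in> SS k}"
  have \<Lambda>: "\<Lambda> \<subseteq> lattice" unfolding \<Lambda>_def by blast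
  have R1: "R k \<ge> 1" for k unfolding R_def by simp
  have Rt: "filterlim R at_top sequentially"
  proof (rule filterlim_at_top_mono[OF filterlim_real_sequentially])
    have "real k \<le> R k" for k
    proof -
      have "real k \<le> 2 ^ k" using of_nat_less_two_power[of k, where 'a = real] by simp
      also have "\<dots> \<le> 2 ^ \<beta> k" using \<beta>k by (intro power_increasing) auto
      finally show ?thesis unfolding R_def .
    qed
    then show "\<forall>\<^sub>F k in sequentially. real k \<le> R k" by simp
  qed
  have Sm: "S \<in> sets lebesgue" using pat unfolding pattern_sequence_def by blast
  \<comment> \<open>Rounding to a grid that refines the one of \<open>SS k\<close> does not change
    membership, so the lattice reproduces this set exactly and not just approximately.\<close>
  have SSfl: "floor_point (R k *\<^sub>R x) /\<^sub>R R k \<in> SS k \<longleftrightarrow> x \<in> SS k" for k x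
  proof -
    have "dyadic (\<beta> k) (SS k)" by (rule dyadic_mono[OF dy \<beta>a])
    moreover have "\<lfloor>2 ^ \<beta> k * ((floor_point (R k *\<^sub>R x) /\<^sub>R R k) \<bullet> b)\<rfloor> = \<lfloor>2 ^ \<beta> k * (x \<bullet> b)\<rfloor>" if "b \<in> Basis" for b
      using that by (simp add: floor_point_inner R_def mult.assoc[symmetric])
    ultimately show ?thesis unfolding dyadic_def by blast
  qed
  have AES: "AE x in lebesgue. \<forall>\<^sub>F k in sequentially. floor_point (R k *\<^sub>R x) \<in> \<Lambda> \<longleftrightarrow> x \<in> S"
  proof -
    have "{0::'a} \<in> null_sets lebesgue" unfolding negligible_iff_null_sets[symmetric] by simp
    then have "AE x in lebesgue. x \<notin> {0::'a}" by (rule AE_not_in)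
    then show ?thesis using pattern_sequence_AE[OF pat d]
    proof eventually_elim
      case (elim x)
      define z where "z k = floor_point (R k *\<^sub>R x)" for k
      have n: "norm x > 0" using elim(1) by simp
      have lim: "(\<lambda>k. norm (z k /\<^sub>R R k)) \<longlonglongrightarrow> norm x" unfolding z_def by (intro tendsto_norm rescaled_floor_tendsto Rt)
      have h1: "\<forall>\<^sub>F k in sequentially. norm (z k /\<^sub>R R k) > norm x / 2" by (rule order_tendstoD(1)[OF lim]) (use n in simp)
      have h2: "\<forall>\<^sub>F k in sequentially. norm (z k /\<^sub>R R k) < 2 * norm x" by (rule order_tendstoD(2)[OF lim]) (use n in simp)
      have h3: "\<forall>\<^sub>F k in sequentially. (1/2::real) ^ k < norm x / 2"
        by (rule order_tendstoD(2)[OF LIMSEQ_power_zero]) (use n in auto)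
      have h4: "\<forall>\<^sub>F k in sequentially. real k > 2 * norm x"
        using filterlim_real_sequentially unfolding filterlim_at_top_dense by blast
      show ?case using h1 h2 h3 h4 elim(2)
      proof eventually_elim
        case (elim k)
        have Rk: "R k > 0" using R1[of k] by linarith
        have nz: "norm (z k /\<^sub>R R k) = norm (z k) / R k" using Rk by (simp add: divide_inverse)
        have split1: "R k = 2 ^ (\<beta> k - k) * 2 ^ k" unfolding R_def using \<beta>k[of k] by (simp flip: power_add)
        have "(1/2) ^ k < norm (z k) / R k" using elim(1,3) unfolding nz by linarith
        then have "(1/2) ^ k * R k \<le> norm (z k)" unfolding pos_less_divide_eq[OF Rk] by simp
        moreover have "(1/2) ^ k * R k = 2 ^ (\<beta> k - k)" unfolding split1 by (simp add: power_divide)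
        moreover have "norm (z k) < 2 ^ (\<beta> k + k)"
        proof -
          have "norm (z k) < (2 * norm x) * R k" using elim(2) Rk unfolding nz by (simp add: field_simps)
          also have "\<dots> \<le> 2 ^ k * R k"
          proof (intro mult_right_mono)
            have "real k < 2 ^ k" by (rule of_nat_less_two_power)
            then show "2 * norm x \<le> 2 ^ k" using elim(4) by linarith
          qed (use Rk in simp)
          also have "\<dots> = 2 ^ (\<beta> k + k)" unfolding R_def by (simp add: power_add)
          finally show ?thesis .
        qed
        ultimately have sh: "shell k (z k)" unfolding shell_def by simp
        have "z k \<in> \<Lambda> \<longleftrightarrow> z k /\<^sub>R R k \<in> SS k"
          unfolding \<Lambda>_def using sh shell_unique[OF sh] floor_point_in_lattice unfolding z_def by blast
        then show ?case using SSfl[of k x] elim(5) unfolding z_def by blast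
      qed
    qed
  qed
  have AE0: "AE x in lebesgue. \<forall>\<^sub>F k in sequentially. floor_point (R k *\<^sub>R x) \<in> {} \<longleftrightarrow> x \<in> ({}::'a set)" by simp
  show thesis
  proof (rule that[OF \<Lambda>])
    fix \<Lambda>1 \<Lambda>2 h and L C :: real
    assume c: "\<Lambda>1 = \<Lambda> \<and> \<Lambda>2 = {} \<or> \<Lambda>1 = {} \<and> \<Lambda>2 = \<Lambda>" and bij: "bij_betw h (doubled e \<Lambda>1) (doubled e \<Lambda>2)"
      and L: "L \<ge> 0" and C: "C \<ge> 0"
      and lip: "\<And>x y. x \<in> doubled e \<Lambda>1 \<Longrightarrow> y \<in> doubled e \<Lambda>1 \<Longrightarrow> norm (h x - h y) \<le> L * norm (x - y)"
      and grow: "\<And>y. y \<in> doubled e \<Lambda>1 \<Longrightarrow> norm y \<le> C * (1 + norm (h y))"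
    define S1 S2 where "S1 = (if \<Lambda>1 = \<Lambda> \<and> \<Lambda>2 = {} then S else {})" and "S2 = (if \<Lambda>1 = \<Lambda> \<and> \<Lambda>2 = {} then {} else S)"
    have A1: "AE x in lebesgue. \<forall>\<^sub>F k in sequentially. floor_point (R k *\<^sub>R x) \<in> \<Lambda>1 \<longleftrightarrow> x \<in> S1"
      and A2: "AE x in lebesgue. \<forall>\<^sub>F k in sequentially. floor_point (R k *\<^sub>R x) \<in> \<Lambda>2 \<longleftrightarrow> x \<in> S2"
      using c AES AE0 unfolding S1_def S2_def by auto
    have \<Lambda>12: "\<Lambda>1 \<subseteq> lattice" "\<Lambda>2 \<subseteq> lattice" using c \<Lambda> by auto
    have S12: "S1 \<in> sets lebesgue" "S2 \<in> sets lebesgue" unfolding S1_def S2_def using Sm by auto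
    obtain H where H: "\<And>x y. norm (H x - H y) \<le> L * norm (x - y)"
      "\<And>F. compact F \<Longrightarrow> H -` F \<in> lmeasurable \<and>
         measure lebesgue (H -` F) + measure lebesgue (S1 \<inter> H -` F) = measure lebesgue F + measure lebesgue (S2 \<inter> F)"
      using limit_map[OF e \<Lambda>12 L C bij lip grow R1 Rt S12 A1 A2] by blast
    show False
      by (rule no_balanced_map[OF e d L H(1) pat add rem H(2)]) (auto simp: S1_def S2_def)
  qed
qed

lemma integer_lattice_eq: "(integer_lattice :: (real ^ 'n) set) = lattice"
  unfolding integer_lattice_def lattice_def by (auto simp: Basis_vec_def inner_axis)

theorem theorem1p8:
  assumes "CARD('n::finite) \<ge> 2"
  shows "\<exists>Y :: (real ^ 'n) set. delone Y \<and>
    \<not> (\<exists>f :: real ^ 'n \<Rightarrow> real ^ 'n. bij_betw f Y integer_lattice \<and>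
          Lipschitz_map_on Y f \<and> co_homogeneous_on Y f) \<and>
    \<not> (\<exists>f :: real ^ 'n \<Rightarrow> real ^ 'n. bij_betw f Y integer_lattice \<and>
          co_Lipschitz_on Y f \<and> homogeneous_on Y f)"
proof -
  obtain e :: "real ^ 'n" where e: "e \<in> Basis" using nonempty_Basis by blast
  have d: "DIM(real ^ 'n) \<ge> 2" using assms by simp
  obtain \<Lambda> :: "(real ^ 'n) set" where \<Lambda>: "\<Lambda> \<subseteq> lattice" and no:
    "\<And>\<Lambda>1 \<Lambda>2 h L C. \<Lambda>1 = \<Lambda> \<and> \<Lambda>2 = {} \<or> \<Lambda>1 = {} \<and> \<Lambda>2 = \<Lambda> \<Longrightarrow> bij_betw h (doubled e \<Lambda>1) (doubled e \<Lambda>2) \<Longrightarrow>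
       L \<ge> 0 \<Longrightarrow> C \<ge> 0 \<Longrightarrow>
       (\<And>x y. x \<in> doubled e \<Lambda>1 \<Longrightarrow> y \<in> doubled e \<Lambda>1 \<Longrightarrow> norm (h x - h y) \<le> L * norm (x - y)) \<Longrightarrow>
       (\<And>y. y \<in> doubled e \<Lambda>1 \<Longrightarrow> norm y \<le> C * (1 + norm (h y))) \<Longrightarrow> False"
    by (rule unmappable_doubled_lattice[OF e d]) blast
  define Y where "Y = doubled e \<Lambda>"
  have Z: "integer_lattice = doubled e {}" unfolding integer_lattice_eq doubled_def by simp
  have zero: "0 \<in> doubled e \<Lambda>'" for \<Lambda>' unfolding doubled_def lattice_def by simp
  show ?thesis
  proof (intro exI[of _ Y] conjI notI)
    show "delone Y" unfolding Y_def by (rule delone_doubled[OF e \<Lambda>])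
  next
    assume "\<exists>f :: real ^ 'n \<Rightarrow> real ^ 'n. bij_betw f Y integer_lattice \<and> Lipschitz_map_on Y f \<and> co_homogeneous_on Y f"
    then obtain f L where bij: "bij_betw f Y (doubled e {})" and f: "L-lipschitz_on Y f"
      and hom: "homogeneous_on (f ` Y) (inv_into Y f)"
      unfolding Z Lipschitz_map_on_def co_homogeneous_on_def by blast
    have im: "f ` Y = doubled e {}" and inj: "inj_on f Y" using bij unfolding bij_betw_def by auto
    obtain C where C: "C \<ge> 0" "\<And>u. u \<in> f ` Y \<Longrightarrow> norm (inv_into Y f u) \<le> C * (1 + norm u)"
      using homogeneous_linear_growth[OF hom] zero unfolding im by blast
    \<comment> \<open>Here \<Lambda> is on the source: \<open>f\<close> is the Lipschitz map, and
      the growth of its inverse is read as a lower growth bound for \<open>f\<close>.\<close>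
    show False
    proof (rule no[of \<Lambda> "{}" f L C])
      show "norm (f x - f y) \<le> L * norm (x - y)" if "x \<in> doubled e \<Lambda>" "y \<in> doubled e \<Lambda>" for x y
        using lipschitz_onD[OF f] that unfolding Y_def by (simp add: dist_norm)
      show "norm y \<le> C * (1 + norm (f y))" if "y \<in> doubled e \<Lambda>" for y
        using C(2)[of "f y"] inv_into_f_f[OF inj] that unfolding Y_def by simp
    qed (use bij C(1) lipschitz_on_nonneg[OF f] in \<open>auto simp: Y_def\<close>)
  next
    assume "\<exists>f :: real ^ 'n \<Rightarrow> real ^ 'n. bij_betw f Y integer_lattice \<and> co_Lipschitz_on Y f \<and> homogeneous_on Y f"
    then obtain f L where bij: "bij_betw f Y (doubled e {})" and g: "L-lipschitz_on (f ` Y) (inv_into Y f)"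
      and hom: "homogeneous_on Y f"
      unfolding Z Lipschitz_map_on_def co_Lipschitz_on_def by blast
    have im: "f ` Y = doubled e {}" using bij unfolding bij_betw_def by auto
    obtain C where C: "C \<ge> 0" "\<And>u. u \<in> Y \<Longrightarrow> norm (f u) \<le> C * (1 + norm u)"
      using homogeneous_linear_growth[OF hom] zero unfolding Y_def by blast
    \<comment> \<open>Here the Lipschitz map is the inverse of \<open>f\<close>, so \<Lambda> is on
      the target, and the growth of \<open>f\<close> is the lower growth bound.\<close>
    show False
    proof (rule no[of "{}" \<Lambda> "inv_into Y f" L C])
      show "bij_betw (inv_into Y f) (doubled e {}) (doubled e \<Lambda>)" using bij_betw_inv_into[OF bij] unfolding Y_def .
      show "norm (inv_into Y f x - inv_into Y f y) \<le> L * norm (x - y)" if "x \<in> doubled e {}" "y \<in> doubled e {}" for x y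
        using lipschitz_onD[OF g] that unfolding im by (simp add: dist_norm)
      show "norm y \<le> C * (1 + norm (inv_into Y f y))" if "y \<in> doubled e {}" for y
        using C(2)[OF inv_into_into[of y f Y]] f_inv_into_f[of y f Y] that unfolding im by simp
    qed (use C(1) lipschitz_on_nonneg[OF g] in auto)
  qed
qed

end
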